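(* Let $a\ge 0$ and $b\ge 1$ be integers and let $\alpha=(1^a,b)$ be the composition $(1,\dots,1,b)$ with $a$ ones followed by $b$. Then $$\chi(\mathbf{H}_\alpha^q)=H_{(b,1^a)}^q ,$$ where $\mathbf{H}_\alpha^q=\sum_{\beta\ge\alpha} q^{c(\alpha,\beta^c)}\,\mathbf{s}_\beta$ and $H_\lambda^q=\sum_{\mu\vdash|\lambda|}K_{\mu\lambda}(q)\,s_\mu$ is the Hall-Littlewood symmetric function.
   Context: A composition $\alpha$ of a positive integer $n$ ($\alpha\models n$) is a sequence $(\alpha_1,\dots,\alpha_\ell)$ of positive integers with sum $n$; $|\alpha|=n$, $\ell(\alpha)=\ell$. Its descent set is $D(\alpha)=\{\alpha_1,\alpha_1+\alpha_2,\dots,\alpha_1+\cdots+\alpha_{\ell-1}\}\subseteq\{1,\dots,n-1\}$; $\alpha\mapsto D(\alpha)$ is a bijection onto subsets of $\{1,\dots,n-1\}$. For compositions of the same $n$, $\alpha\le\beta$ (equivalently $\beta\ge\alpha$) means $D(\beta)\subseteq D(\alpha)$. The composition $\alpha^c$ of $n$ is defined by $D(\alpha^c)=\{1,\dots,n-1\}\setminus D(\alpha)$. For $\alpha,\beta\models n$, $c(\alpha,\beta)=\sum_{i\in D(\alpha)\cap D(\beta)} i$. $NC\Lambda$ is the free associative algebra on $\mathbf{h}_1,\mathbf{h}_2,\dots$ over $\mathbb{Q}$, with coefficients extended to $\mathbb{Q}(q)$. Put $\mathbf{h}_\alpha=\mathbf{h}_{\alpha_1}\cdots\mathbf{h}_{\alpha_\ell}$.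 The ribbon Schur functions are $\mathbf{s}_\alpha=\sum_{\beta\ge\alpha}(-1)^{\ell(\alpha)-\ell(\beta)}\mathbf{h}_\beta$. $\Lambda$ is the ring of (commutative) symmetric functions, with complete homogeneous functions $h_k$ and Schur functions $s_\mu$. $\chi:NC\Lambda\to\Lambda$ is the algebra homomorphism with $\chi(\mathbf{h}_k)=h_k$, extended linearly to coefficients in $\mathbb{Q}(q)$. $K_{\mu\lambda}(q)$ are the Kostka-Foulkes polynomials, as in Macdonald's book: $s_\mu=\sum_\lambda K_{\mu\lambda}(q)P_\lambda(x;q)$ with $P_\lambda(x;q)$ the Hall-Littlewood $P$-functions. *)

theory Defs
  imports
    "HOL-Library.Poly_Mapping"
    "HOL-Computational_Algebra.Polynomial_Factorial"
    "HOL-Combinatorics.Permutations"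
    "Jordan_Normal_Form.Determinant"
begin

section \<open>The coefficient field\<close>

type_synonym Qq = "rat poly fract"

definition q :: Qq where
  "q = to_fract [:0, 1:]"


section \<open>Compositions\<close>

typedef composition = "{xs :: nat list. 0 \<notin> set xs}"
  morphisms parts Composition
  by (rule exI[of _ "[]"]) simp

setup_lifting type_definition_composition

text \<open>
  Concatenation turns compositions into the free monoid on the positive integers, so that
  finitely supported functions \<^typ>\<open>composition \<Rightarrow>\<^sub>0 'a\<close> form the free associative algebra.
\<close>

instantiation composition :: monoid_add
begin

lift_definition zero_composition :: composition is "[]" by simp

lift_definition plus_composition :: "composition \<Rightarrow> composition \<Rightarrow> composition" is "(@)" by simp

instance by standard (transfer, simp)+

end

definition csize :: "composition \<Rightarrow> nat" where
  "csize \<alpha> = sum_list (parts \<alpha>)"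

definition clength :: "composition \<Rightarrow> nat" where
  "clength \<alpha> = length (parts \<alpha>)"

definition descents :: "composition \<Rightarrow> nat set" where
  "descents \<alpha> = {sum_list (take k (parts \<alpha>)) | k. 1 \<le> k \<and> k < clength \<alpha>}"

definition coarsenings :: "composition \<Rightarrow> composition set" where
  "coarsenings \<alpha> = {\<beta>. csize \<beta> = csize \<alpha> \<and> descents \<beta> \<subseteq> descents \<alpha>}"

definition complement :: "composition \<Rightarrow> composition" where
  "complement \<alpha> =
     (THE \<beta>. csize \<beta> = csize \<alpha> \<and> descents \<beta> = {1..<csize \<alpha>} - descents \<alpha>)"

definition c_stat :: "composition \<Rightarrow> composition \<Rightarrow> nat" where
  "c_stat \<alpha> \<beta> = \<Sum>(descents \<alpha> \<inter> descents \<beta>)"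

lemma finite_bounded_lists:
  "finite {xs :: nat list. 0 \<notin> set xs \<and> sum_list xs = n}"
proof (rule finite_subset)
  have len: "length xs \<le> sum_list xs" if "0 \<notin> set xs" for xs :: "nat list"
    using that by (induction xs) auto
  show "{xs :: nat list. 0 \<notin> set xs \<and> sum_list xs = n} \<subseteq>
          {xs. set xs \<subseteq> {..n} \<and> length xs \<le> n}"
    using len by (auto simp: member_le_sum_list)
  show "finite {xs :: nat list. set xs \<subseteq> {..n} \<and> length xs \<le> n}"
    by (rule finite_lists_length_le) simp
qed

lemma finite_coarsenings: "finite (coarsenings \<alpha>)"
proof -
  have "parts ` coarsenings \<alpha> \<subseteq> {xs. 0 \<notin> set xs \<and> sum_list xs = csize \<alpha>}"
    using parts by (auto simp: coarsenings_def csize_def)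
  then have "finite (parts ` coarsenings \<alpha>)"
    by (rule finite_subset) (rule finite_bounded_lists)
  then show ?thesis
    by (rule finite_imageD) (simp add: inj_on_def parts_inject)
qed

lemma sum_list_take_less:
  fixes xs :: "nat list"
  assumes "0 \<notin> set xs" "k < length xs"
  shows "sum_list (take k xs) < sum_list xs"
proof -
  have "xs ! k \<noteq> 0"
    using assms by (metis nth_mem)
  then have "sum_list (take k xs) < sum_list (take (Suc k) xs)"
    using assms by (simp add: take_Suc_conv_app_nth)
  also have "\<dots> \<le> sum_list xs"
    by (metis append_take_drop_id le_add1 sum_list_append)
  finally show ?thesis .
qed

lemma descents_snoc:
  assumes "0 \<notin> set xs" "k > 0"
  shows "descents (Composition (xs @ [k])) =
    (if xs = [] then {} else insert (sum_list xs) (descents (Composition xs)))"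
proof -
  have *: "parts (Composition (xs @ [k])) = xs @ [k]" "parts (Composition xs) = xs"
    using assms by (simp_all add: Composition_inverse)
  show ?thesis
    unfolding descents_def clength_def *
  proof (cases "xs = []")
    case False
    have "{sum_list (take j (xs @ [k])) | j. 1 \<le> j \<and> j < length (xs @ [k])} =
        {sum_list (take j xs) | j. 1 \<le> j \<and> (j = length xs \<or> j < length xs)}"
      by (force simp: less_Suc_eq)
    also have "\<dots> = insert (sum_list xs) {sum_list (take j xs) | j. 1 \<le> j \<and> j < length xs}"
    proof -
      have "1 \<le> length xs"
        using False by (simp add: Suc_leI)
      then have "{f j | j. 1 \<le> j \<and> (j = length xs \<or> j < length xs)} =
          insert (f (length xs)) {f j | j. 1 \<le> j \<and> j < length xs}" for f :: "nat \<Rightarrow> nat"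
        by blast
      from this[of "\<lambda>j. sum_list (take j xs)"] show ?thesis by simp
    qed
    finally show "{sum_list (take j (xs @ [k])) | j. 1 \<le> j \<and> j < length (xs @ [k])} =
        (if xs = [] then {}
         else insert (sum_list xs) {sum_list (take j xs) | j. 1 \<le> j \<and> j < length xs})"
      using False by simp
  qed auto
qed

lemma descents_subset: "descents \<alpha> \<subseteq> {1..<csize \<alpha>}"
proof
  fix s assume "s \<in> descents \<alpha>"
  then obtain k where k: "s = sum_list (take k (parts \<alpha>))" "1 \<le> k" "k < length (parts \<alpha>)"
    by (auto simp: descents_def clength_def)
  have nz: "0 \<notin> set (parts \<alpha>)"
    using parts by auto
  have "hd (parts \<alpha>) \<in> set (take k (parts \<alpha>))"
    using k by (metis hd_in_set hd_take length_greater_0_conv less_le_trans not_one_le_zero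
      take_eq_Nil gr_zeroI list.size(3) not_less0)
  moreover from this have "hd (parts \<alpha>) \<noteq> 0"
    using nz by (metis in_set_takeD)
  ultimately have "s \<ge> 1"
    unfolding k using member_le_sum_list[of "hd (parts \<alpha>)" "take k (parts \<alpha>)"] by linarith
  then show "s \<in> {1..<csize \<alpha>}"
    using sum_list_take_less[OF nz k(3)] by (simp add: k csize_def)
qed

lemma ex_composition_descents:
  "S \<subseteq> {1..<n} \<Longrightarrow> \<exists>\<alpha>. csize \<alpha> = n \<and> descents \<alpha> = S"
proof (induction n arbitrary: S rule: less_induct)
  case (less n)
  show ?case
  proof (cases "S = {}")
    case True
    define xs where "xs = (if n = 0 then [] else [n])"
    have p: "parts (Composition xs) = xs"
      by (rule Composition_inverse) (auto simp: xs_def)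
    have "csize (Composition xs) = n \<and> descents (Composition xs) = {}"
      unfolding csize_def descents_def clength_def p by (auto simp: xs_def)
    then show ?thesis using True by blast
  next
    case False
    have fin: "finite S"
      using less.prems finite_subset by blast
    define m where "m = Max S"
    have m: "m \<in> S"
      unfolding m_def using fin False by (rule Max_in)
    with less.prems have m: "m \<in> S" "m < n" "m \<ge> 1"
      by auto
    have "S - {m} \<subseteq> {1..<m}"
      using fin less.prems Max_ge[of S] by (fastforce simp: m_def le_neq_implies_less)
    from less.IH[OF m(2) this] obtain \<alpha> where a: "csize \<alpha> = m" "descents \<alpha> = S - {m}"
      by blast
    have nz: "0 \<notin> set (parts \<alpha>)"
      using parts by auto
    have ne: "parts \<alpha> \<noteq> []"
      using a(1) m(3) unfolding csize_def by (metis not_one_le_zero sum_list.Nil)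
    let ?b = "Composition (parts \<alpha> @ [n - m])"
    have "parts ?b = parts \<alpha> @ [n - m]"
      by (rule Composition_inverse) (use nz m in auto)
    then have "csize ?b = n"
      using a(1) m(2) by (simp add: csize_def)
    moreover have "descents ?b = S"
    proof -
      have "descents ?b = insert m (S - {m})"
        using descents_snoc[OF nz, of "n - m"] m(2) ne
        by (simp add: parts_inverse a(2) flip: csize_def a(1))
      then show ?thesis using m(1) by (simp only: insert_Diff)
    qed
    ultimately show ?thesis by blast
  qed
qed

lemma descents_inject:
  assumes "csize \<alpha> = csize \<beta>" "descents \<alpha> = descents \<beta>"
  shows "\<alpha> = \<beta>"
proof -
  have "xs = ys" if "0 \<notin> set xs" "0 \<notin> set ys" "sum_list xs = sum_list ys"
    "descents (Composition xs) = descents (Composition ys)" for xs ys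
    using that
  proof (induction xs arbitrary: ys rule: rev_induct)
    case Nil
    then show ?case by (cases ys) auto
  next
    case (snoc x xs)
    from snoc.prems obtain y zs where ys: "ys = zs @ [y]"
      by (cases ys rule: rev_cases) auto
    have nz: "0 \<notin> set xs" "0 < x" "0 \<notin> set zs" "0 < y"
      using snoc.prems by (auto simp: ys)
    have eq: "(if xs = [] then {} else insert (sum_list xs) (descents (Composition xs))) =
              (if zs = [] then {} else insert (sum_list zs) (descents (Composition zs)))"
      using snoc.prems(4) by (simp only: ys descents_snoc[OF nz(1,2)] descents_snoc[OF nz(3,4)])
    have sub: "descents (Composition us) \<subseteq> {1..<sum_list us}" if "0 \<notin> set us" for us
      using descents_subset[of "Composition us"] that
      by (simp add: csize_def Composition_inverse)
    show ?case
    proof (cases "xs = [] \<or> zs = []")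
      case True
      then show ?thesis
        using eq snoc.prems(3) by (auto simp: ys split: if_splits)
    next
      case False
      then have eq': "insert (sum_list xs) (descents (Composition xs)) =
                 insert (sum_list zs) (descents (Composition zs))"
        using eq by simp
      have s: "sum_list xs = sum_list zs"
        using eq' sub[OF nz(1)] sub[OF nz(3)]
        by (metis (no_types, lifting) atLeastLessThan_iff insert_iff not_less_iff_gr_or_eq subsetD)
      have "descents (Composition xs) = descents (Composition zs)"
        using eq' s sub[OF nz(1)] sub[OF nz(3)]
        by (metis atLeastLessThan_iff insert_ident less_irrefl subsetD)
      then have "xs = zs"
        using snoc.IH nz s by blast
      then show ?thesis
        using snoc.prems(3) by (simp add: ys)
    qed
  qed
  from this[of "parts \<alpha>" "parts \<beta>"] show ?thesis
    using assms parts[of \<alpha>] parts[of \<beta>] by (simp add: csize_def parts_inverse parts_inject)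
qed

lemma complement:
  "csize (complement \<alpha>) = csize \<alpha>"
  "descents (complement \<alpha>) = {1..<csize \<alpha>} - descents \<alpha>"
proof -
  have "\<exists>!\<beta>. csize \<beta> = csize \<alpha> \<and> descents \<beta> = {1..<csize \<alpha>} - descents \<alpha>"
    using ex_composition_descents[of "{1..<csize \<alpha>} - descents \<alpha>" "csize \<alpha>"]
    by (auto intro: descents_inject)
  from theI'[OF this] show
    "csize (complement \<alpha>) = csize \<alpha>"
    "descents (complement \<alpha>) = {1..<csize \<alpha>} - descents \<alpha>"
    by (simp_all add: complement_def)
qed


section \<open>Noncommutative symmetric functions\<close>

type_synonym ncsym = "composition \<Rightarrow>\<^sub>0 Qq"

definition nc_scale :: "Qq \<Rightarrow> ncsym \<Rightarrow> ncsym" where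
  "nc_scale c F = Poly_Mapping.single 0 c * F"

text \<open>The generators are \<open>nc_h k\<close> for \<open>k \<ge> 1\<close>; the value at \<open>0\<close> is junk and never used.\<close>

definition nc_h :: "nat \<Rightarrow> ncsym" where
  "nc_h k = Poly_Mapping.single (Composition [k]) 1"

definition nc_h_comp :: "composition \<Rightarrow> ncsym" where
  "nc_h_comp \<alpha> = prod_list (map nc_h (parts \<alpha>))"

definition ribbon :: "composition \<Rightarrow> ncsym" where
  "ribbon \<alpha> = (\<Sum>\<beta>\<in>coarsenings \<alpha>. (- 1) ^ (clength \<alpha> - clength \<beta>) * nc_h_comp \<beta>)"

definition nc_hall_littlewood :: "composition \<Rightarrow> ncsym" where
  "nc_hall_littlewood \<alpha> =
     (\<Sum>\<beta>\<in>coarsenings \<alpha>. nc_scale (q ^ c_stat \<alpha> (complement \<beta>)) (ribbon \<beta>))"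

lemma nc_h_comp_eq_single: "nc_h_comp \<alpha> = Poly_Mapping.single \<alpha> 1"
proof -
  have "prod_list (map nc_h xs) = Poly_Mapping.single (Composition xs) 1" if "0 \<notin> set xs" for xs
    using that
  proof (induction xs)
    case Nil
    show ?case by (simp add: zero_composition.abs_eq[symmetric])
  next
    case (Cons x xs)
    then have "Composition [x] + Composition xs = Composition (x # xs)"
      by (subst plus_composition.abs_eq) (auto simp: eq_onp_def)
    with Cons show ?case
      by (simp add: nc_h_def Poly_Mapping.mult_single)
  qed
  from this[of "parts \<alpha>"] show ?thesis
    using parts[of \<alpha>] by (simp add: nc_h_comp_def parts_inverse)
qed


section \<open>Symmetric functions\<close>

text \<open>
  A monomial in the variables \<open>x\<^sub>0, x\<^sub>1, \<dots>\<close> is its exponent vector. A symmetric function is a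
  formal power series of bounded degree that is invariant under all permutations of the variables.
\<close>

type_synonym monomial = "nat \<Rightarrow>\<^sub>0 nat"

definition mdeg :: "monomial \<Rightarrow> nat" where
  "mdeg m = sum (Poly_Mapping.lookup m) (Poly_Mapping.keys m)"

definition bounded_degree :: "(monomial \<Rightarrow> 'a::zero) \<Rightarrow> bool" where
  "bounded_degree F \<longleftrightarrow> (\<exists>d. \<forall>m. F m \<noteq> 0 \<longrightarrow> mdeg m \<le> d)"

definition permutation_invariant :: "(monomial \<Rightarrow> 'a) \<Rightarrow> bool" where
  "permutation_invariant F \<longleftrightarrow> (\<forall>\<pi>. bij \<pi> \<longrightarrow> (\<forall>m. F (Poly_Mapping.map_key \<pi> m) = F m))"

typedef (overloaded) 'a symfun =
    "{F :: monomial \<Rightarrow> 'a::zero. bounded_degree F \<and> permutation_invariant F}"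
  morphisms coefficient Symfun
  by (rule exI[of _ "\<lambda>_. 0"]) (simp add: bounded_degree_def permutation_invariant_def)

setup_lifting type_definition_symfun

lemma keys_add_nat:
  fixes a b :: "'b \<Rightarrow>\<^sub>0 nat"
  shows "Poly_Mapping.keys (a + b) = Poly_Mapping.keys a \<union> Poly_Mapping.keys b"
  by (auto simp: in_keys_iff lookup_add)

lemma mdeg_superset:
  assumes "finite A" "Poly_Mapping.keys m \<subseteq> A"
  shows "mdeg m = sum (Poly_Mapping.lookup m) A"
  unfolding mdeg_def using assms
  by (intro sum.mono_neutral_left) (auto simp: in_keys_iff)

lemma mdeg_add: "mdeg (a + b) = mdeg a + mdeg b"
proof -
  let ?A = "Poly_Mapping.keys a \<union> Poly_Mapping.keys b"
  have "mdeg (a + b) = sum (Poly_Mapping.lookup (a + b)) ?A"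
    by (rule mdeg_superset) (auto simp: keys_add_nat)
  also have "\<dots> = sum (Poly_Mapping.lookup a) ?A + sum (Poly_Mapping.lookup b) ?A"
    by (simp add: lookup_add sum.distrib)
  finally show ?thesis
    by (simp add: mdeg_superset[of ?A])
qed

lemma mdeg_map_key:
  assumes "bij \<pi>"
  shows "mdeg (Poly_Mapping.map_key \<pi> m) = mdeg m"
proof -
  have inj: "inj \<pi>" using assms by (rule bij_is_inj)
  have "mdeg (Poly_Mapping.map_key \<pi> m) =
      (\<Sum>i\<in>\<pi> -` Poly_Mapping.keys m. Poly_Mapping.lookup m (\<pi> i))"
    by (simp add: mdeg_def keys_map_key[OF inj] map_key.rep_eq[OF inj])
  also have "\<dots> = sum (Poly_Mapping.lookup m) (\<pi> ` (\<pi> -` Poly_Mapping.keys m))"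
    by (rule sum.reindex_cong[symmetric]) (use inj in \<open>auto simp: inj_on_def\<close>)
  also have "\<pi> ` (\<pi> -` Poly_Mapping.keys m) = Poly_Mapping.keys m"
    by (rule surj_image_vimage_eq) (use assms in \<open>simp add: bij_is_surj\<close>)
  finally show ?thesis by (simp add: mdeg_def)
qed

lemma finite_bounded_monomials:
  assumes "finite A"
  shows "finite {m. Poly_Mapping.keys m \<subseteq> A \<and> mdeg m \<le> d}" (is "finite ?M")
proof -
  have le: "Poly_Mapping.lookup m i \<le> d" if "mdeg m \<le> d" for m i
  proof (cases "i \<in> Poly_Mapping.keys m")
    case True
    then have "Poly_Mapping.lookup m i \<le> mdeg m"
      unfolding mdeg_def by (intro member_le_sum) auto
    then show ?thesis using that by simp
  qed (simp add: in_keys_iff)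
  have "Poly_Mapping.lookup ` ?M \<subseteq>
      {f. \<forall>x. (x \<in> A \<longrightarrow> f x \<in> {..d}) \<and> (x \<notin> A \<longrightarrow> f x = 0)}"
    using le by (auto simp: in_keys_iff)
  moreover have "finite {f. \<forall>x. (x \<in> A \<longrightarrow> f x \<in> {..d}) \<and> (x \<notin> A \<longrightarrow> f x = (0::nat))}"
    by (rule finite_set_of_finite_funs) (use assms in auto)
  ultimately have "finite (Poly_Mapping.lookup ` ?M)"
    by (rule finite_subset)
  then show ?thesis
    by (rule finite_imageD) (simp add: inj_on_def)
qed

lemma finite_monomial_splits: "finite {(a, b). a + b = (m :: monomial)}"
proof (rule finite_subset)
  let ?M = "{a. Poly_Mapping.keys a \<subseteq> Poly_Mapping.keys m \<and> mdeg a \<le> mdeg m}"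
  show "{(a, b). a + b = m} \<subseteq> ?M \<times> ?M"
    by (auto simp: mdeg_add keys_add_nat)
  show "finite (?M \<times> ?M)"
    by (intro finite_cartesian_product finite_bounded_monomials) auto
qed

instantiation symfun :: (zero) zero
begin

lift_definition zero_symfun :: "'a symfun" is "\<lambda>_. 0"
  by (simp add: bounded_degree_def permutation_invariant_def)

instance ..

end

instantiation symfun :: (comm_ring_1) "{one, plus, minus, uminus, times}"
begin

lift_definition one_symfun :: "'a symfun" is "\<lambda>m. if m = 0 then 1 else 0"
proof -
  have "Poly_Mapping.map_key \<pi> m = 0 \<longleftrightarrow> m = 0" if "bij \<pi>" for \<pi> and m :: monomial
  proof
    assume *: "Poly_Mapping.map_key \<pi> m = 0"
    have "\<pi> -` Poly_Mapping.keys m = {}"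
      using arg_cong[OF *, of Poly_Mapping.keys] by (simp add: keys_map_key bij_is_inj that)
    then have "Poly_Mapping.keys m = {}"
      using surj_image_vimage_eq[OF bij_is_surj[OF that]] by (metis image_empty)
    then show "m = 0" by simp
  qed (simp add: bij_is_inj that)
  then show "bounded_degree (\<lambda>m. if m = 0 then 1 else 0 :: 'a) \<and>
      permutation_invariant (\<lambda>m. if m = 0 then 1 else 0 :: 'a)"
    by (auto simp: bounded_degree_def permutation_invariant_def)
qed

lift_definition plus_symfun :: "'a symfun \<Rightarrow> 'a symfun \<Rightarrow> 'a symfun" is "\<lambda>F G m. F m + G m"
proof -
  fix F G :: "monomial \<Rightarrow> 'a"
  assume *: "bounded_degree F \<and> permutation_invariant F" "bounded_degree G \<and> permutation_invariant G"
  then obtain d e where "\<And>m. F m \<noteq> 0 \<Longrightarrow> mdeg m \<le> d" "\<And>m. G m \<noteq> 0 \<Longrightarrow> mdeg m \<le> e"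
    unfolding bounded_degree_def by blast
  then have "\<forall>m. F m + G m \<noteq> 0 \<longrightarrow> mdeg m \<le> max d e"
    by (metis add.right_neutral le_max_iff_disj)
  then show "bounded_degree (\<lambda>m. F m + G m) \<and> permutation_invariant (\<lambda>m. F m + G m)"
    using * by (auto simp: bounded_degree_def permutation_invariant_def)
qed

lift_definition uminus_symfun :: "'a symfun \<Rightarrow> 'a symfun" is "\<lambda>F m. - F m"
  by (auto simp: bounded_degree_def permutation_invariant_def)

lift_definition minus_symfun :: "'a symfun \<Rightarrow> 'a symfun \<Rightarrow> 'a symfun" is "\<lambda>F G m. F m - G m"
proof -
  fix F G :: "monomial \<Rightarrow> 'a"
  assume *: "bounded_degree F \<and> permutation_invariant F" "bounded_degree G \<and> permutation_invariant G"
  then obtain d e where "\<And>m. F m \<noteq> 0 \<Longrightarrow> mdeg m \<le> d" "\<And>m. G m \<noteq> 0 \<Longrightarrow> mdeg m \<le> e"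
    unfolding bounded_degree_def by blast
  then have "\<forall>m. F m - G m \<noteq> 0 \<longrightarrow> mdeg m \<le> max d e"
    by (metis diff_self le_max_iff_disj)
  then show "bounded_degree (\<lambda>m. F m - G m) \<and> permutation_invariant (\<lambda>m. F m - G m)"
    using * by (auto simp: bounded_degree_def permutation_invariant_def)
qed

lift_definition times_symfun :: "'a symfun \<Rightarrow> 'a symfun \<Rightarrow> 'a symfun" is
  "\<lambda>F G m. \<Sum>(a, b)\<in>{(a, b). a + b = m}. F a * G b"
proof -
  fix F G :: "monomial \<Rightarrow> 'a"
  assume *: "bounded_degree F \<and> permutation_invariant F" "bounded_degree G \<and> permutation_invariant G"
  then obtain d e where de: "\<And>m. F m \<noteq> 0 \<Longrightarrow> mdeg m \<le> d" "\<And>m. G m \<noteq> 0 \<Longrightarrow> mdeg m \<le> e"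
    unfolding bounded_degree_def by blast
  let ?P = "\<lambda>m. \<Sum>(a, b)\<in>{(a, b). a + b = m}. F a * G b"
  have "mdeg m \<le> d + e" if "?P m \<noteq> 0" for m
  proof -
    from that obtain a b where "a + b = m" "F a * G b \<noteq> 0"
      by (auto elim!: sum.not_neutral_contains_not_neutral)
    then have "F a \<noteq> 0" "G b \<noteq> 0" by auto
    with de \<open>a + b = m\<close> show ?thesis
      by (auto simp: mdeg_add intro!: add_mono)
  qed
  then have "bounded_degree ?P"
    unfolding bounded_degree_def by blast
  moreover have "?P (Poly_Mapping.map_key \<pi> m) = ?P m" if bij: "bij \<pi>" for \<pi> m
  proof -
    have inj: "inj \<pi>" using bij by (rule bij_is_inj)
    define \<rho> where "\<rho> = inv_into UNIV \<pi>"
    have inj': "inj \<rho>" and "\<pi> \<circ> \<rho> = id" "\<rho> \<circ> \<pi> = id"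
      using bij by (simp_all add: \<rho>_def bij_imp_bij_inv bij_is_inj bij_is_surj surj_iff[symmetric]
        inj_iff[symmetric])
    then have inv1: "Poly_Mapping.map_key \<pi> (Poly_Mapping.map_key \<rho> a) = a"
      and inv2: "Poly_Mapping.map_key \<rho> (Poly_Mapping.map_key \<pi> a) = a" for a :: monomial
      using inj inj' by (simp_all add: map_key_compose map_key_id id_def)
    show ?thesis
    proof (rule sum.reindex_bij_witness[where
          i = "map_prod (Poly_Mapping.map_key \<pi>) (Poly_Mapping.map_key \<pi>)" and
          j = "map_prod (Poly_Mapping.map_key \<rho>) (Poly_Mapping.map_key \<rho>)"])
      fix ab assume "ab \<in> {(a, b). a + b = Poly_Mapping.map_key \<pi> m}"
      then show "map_prod (Poly_Mapping.map_key \<rho>) (Poly_Mapping.map_key \<rho>) ab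
          \<in> {(a, b). a + b = m}"
        by (auto simp: map_key_plus[OF inj', symmetric] inv2)
    next
      fix ab :: "monomial \<times> monomial"
      have "F (Poly_Mapping.map_key \<rho> (fst ab)) = F (fst ab)"
        "G (Poly_Mapping.map_key \<rho> (snd ab)) = G (snd ab)"
        using * bij_imp_bij_inv[OF bij] by (simp_all add: permutation_invariant_def \<rho>_def)
      then show "(case map_prod (Poly_Mapping.map_key \<rho>) (Poly_Mapping.map_key \<rho>) ab of
          (a, b) \<Rightarrow> F a * G b) = (case ab of (a, b) \<Rightarrow> F a * G b)"
        by (simp add: case_prod_beta)
    qed (auto simp: map_key_plus[OF inj, symmetric] inv1 inv2)
  qed
  ultimately show "bounded_degree ?P \<and> permutation_invariant ?P"
    by (simp add: permutation_invariant_def)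
qed

instance ..

end

text \<open>Setting \<open>x\<^sub>i = 0\<close> for \<open>i \<ge> n\<close>, which turns a symmetric function into a polynomial.\<close>

lift_definition restrict_vars :: "nat \<Rightarrow> 'a::comm_ring_1 symfun \<Rightarrow> monomial \<Rightarrow>\<^sub>0 'a" is
  "\<lambda>n F m. if Poly_Mapping.keys m \<subseteq> {..<n} then F m else 0"
proof -
  fix n and F :: "monomial \<Rightarrow> 'a"
  assume "bounded_degree F \<and> permutation_invariant F"
  then obtain d where "\<And>m. F m \<noteq> 0 \<Longrightarrow> mdeg m \<le> d"
    unfolding bounded_degree_def by blast
  then have "{m. (if Poly_Mapping.keys m \<subseteq> {..<n} then F m else 0) \<noteq> 0} \<subseteq>
      {m. Poly_Mapping.keys m \<subseteq> {..<n} \<and> mdeg m \<le> d}"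
    by auto
  then show "finite {m. (if Poly_Mapping.keys m \<subseteq> {..<n} then F m else 0) \<noteq> 0}"
    by (rule finite_subset) (rule finite_bounded_monomials, simp)
qed

lemma symfun_eqI:
  assumes "\<And>n. restrict_vars n f = restrict_vars n g"
  shows "f = g"
proof -
  have "coefficient f m = coefficient g m" for m
  proof -
    obtain n where "Poly_Mapping.keys m \<subseteq> {..<n}"
      using finite_nat_bounded[of "Poly_Mapping.keys m"] by auto
    then show ?thesis
      using arg_cong[OF assms[of n], of "\<lambda>p. Poly_Mapping.lookup p m"]
      by (simp add: restrict_vars.rep_eq)
  qed
  then show ?thesis by (simp add: coefficient_inject[symmetric] fun_eq_iff)
qed

lemma lookup_mult_monomials:
  fixes p r :: "monomial \<Rightarrow>\<^sub>0 'a::comm_ring_1"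
  shows "Poly_Mapping.lookup (p * r) m =
    (\<Sum>(a, b)\<in>{(a, b). a + b = m}. Poly_Mapping.lookup p a * Poly_Mapping.lookup r b)"
proof -
  have "Poly_Mapping.lookup (p * r) m =
      (\<Sum>(a, b). Poly_Mapping.lookup p a * Poly_Mapping.lookup r b when m = a + b)"
    by (simp add: times_poly_mapping.rep_eq prod_fun_unfold_prod)
  also have "\<dots> = (\<Sum>(a, b)\<in>{(a, b). a + b = m}.
      Poly_Mapping.lookup p a * Poly_Mapping.lookup r b when m = a + b)"
    by (rule Sum_any.expand_superset[OF finite_monomial_splits]) auto
  also have "\<dots> = (\<Sum>(a, b)\<in>{(a, b). a + b = m}.
      Poly_Mapping.lookup p a * Poly_Mapping.lookup r b)"
    by (rule sum.cong) auto
  finally show ?thesis .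
qed

lemma restrict_vars_simps [simp]:
  "restrict_vars n 0 = 0"
  "restrict_vars n 1 = 1"
  "restrict_vars n (f + g) = restrict_vars n f + restrict_vars n g"
  "restrict_vars n (f - g) = restrict_vars n f - restrict_vars n g"
  "restrict_vars n (- f) = - restrict_vars n f"
  "restrict_vars n (f * g) = restrict_vars n f * restrict_vars n g"
proof -
  show "restrict_vars n (f * g) = restrict_vars n f * restrict_vars n g"
  proof (rule poly_mapping_eqI)
    fix m
    show "Poly_Mapping.lookup (restrict_vars n (f * g)) m =
        Poly_Mapping.lookup (restrict_vars n f * restrict_vars n g) m"
    proof (cases "Poly_Mapping.keys m \<subseteq> {..<n}")
      case True
      then show ?thesis
        by (auto simp: lookup_mult_monomials restrict_vars.rep_eq times_symfun.rep_eq keys_add_nat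
            intro!: sum.cong)
    next
      case False
      have "Poly_Mapping.lookup (restrict_vars n f * restrict_vars n g) m = 0"
        unfolding lookup_mult_monomials
        by (rule sum.neutral) (use False in \<open>auto simp: restrict_vars.rep_eq keys_add_nat\<close>)
      with False show ?thesis
        by (simp add: restrict_vars.rep_eq)
    qed
  qed
  show "restrict_vars n 1 = 1"
    by (rule poly_mapping_eqI)
      (simp add: restrict_vars.rep_eq one_symfun.rep_eq lookup_one when_def)
qed (rule poly_mapping_eqI, simp add: restrict_vars.rep_eq zero_symfun.rep_eq plus_symfun.rep_eq
  minus_symfun.rep_eq uminus_symfun.rep_eq lookup_add lookup_minus)+

instance symfun :: (comm_ring_1) comm_ring_1
proof
  fix a b c :: "'a symfun"
  show "a * b * c = a * (b * c)" by (rule symfun_eqI) (simp add: mult.assoc)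
  show "a * b = b * a" by (rule symfun_eqI) (simp add: mult.commute)
  show "1 * a = a" by (rule symfun_eqI) simp
  show "a + b + c = a + (b + c)" by (rule symfun_eqI) (simp add: add.assoc)
  show "a + b = b + a" by (rule symfun_eqI) (simp add: add.commute)
  show "0 + a = a" by (rule symfun_eqI) simp
  show "- a + a = 0" by (rule symfun_eqI) simp
  show "a - b = a + - b" by (rule symfun_eqI) simp
  show "(a + b) * c = a * c + b * c" by (rule symfun_eqI) (simp add: distrib_right)
  show "(0 :: 'a symfun) \<noteq> 1"
  proof
    assume "(0 :: 'a symfun) = 1"
    then have "coefficient (0 :: 'a symfun) 0 = coefficient 1 0" by simp
    then show False by (simp add: zero_symfun.rep_eq one_symfun.rep_eq)
  qed
qed

lift_definition scale :: "'a::comm_ring_1 \<Rightarrow> 'a symfun \<Rightarrow> 'a symfun" is "\<lambda>c F m. c * F m"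
proof -
  fix c :: 'a and F :: "monomial \<Rightarrow> 'a"
  assume *: "bounded_degree F \<and> permutation_invariant F"
  then obtain d where "\<And>m. F m \<noteq> 0 \<Longrightarrow> mdeg m \<le> d"
    unfolding bounded_degree_def by blast
  then have "\<forall>m. c * F m \<noteq> 0 \<longrightarrow> mdeg m \<le> d"
    by (metis mult_zero_right)
  then show "bounded_degree (\<lambda>m. c * F m) \<and> permutation_invariant (\<lambda>m. c * F m)"
    using * by (auto simp: bounded_degree_def permutation_invariant_def)
qed

lift_definition complete_h :: "nat \<Rightarrow> 'a::comm_ring_1 symfun" is
  "\<lambda>k m. if mdeg m = k then 1 else 0"
  by (auto simp: bounded_degree_def permutation_invariant_def mdeg_map_key)


section \<open>The commutative image\<close>

text \<open>
  The linear map with \<open>nc_h_comp \<alpha> \<mapsto> \<Prod>\<^sub>i complete_h \<alpha>\<^sub>i\<close>; as shown below, it is the algebra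
  homomorphism with \<open>nc_h k \<mapsto> complete_h k\<close>.
\<close>

definition chi :: "ncsym \<Rightarrow> Qq symfun" where
  "chi F = (\<Sum>\<alpha>\<in>Poly_Mapping.keys F.
     scale (Poly_Mapping.lookup F \<alpha>) (prod_list (map complete_h (parts \<alpha>))))"

lemma scale_simps:
  fixes f g :: "'a::comm_ring_1 symfun"
  shows "scale 0 f = 0" "scale 1 f = f" "scale c 0 = 0"
    "scale (c + d) f = scale c f + scale d f" "scale c (f + g) = scale c f + scale c g"
    "scale (c * d) f = scale c (scale d f)"
  by (transfer, simp add: fun_eq_iff algebra_simps)+

lemma scale_mult:
  fixes f g :: "'a::comm_ring_1 symfun"
  shows "scale c f * g = scale c (f * g)" "f * scale c g = scale c (f * g)"
  by (transfer, auto simp: fun_eq_iff sum_distrib_left algebra_simps intro!: sum.cong)+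

lemma chi_superset:
  assumes "finite A" "Poly_Mapping.keys F \<subseteq> A"
  shows "chi F = (\<Sum>\<alpha>\<in>A. scale (Poly_Mapping.lookup F \<alpha>) (prod_list (map complete_h (parts \<alpha>))))"
  unfolding chi_def using assms
  by (intro sum.mono_neutral_left) (auto simp: in_keys_iff scale_simps)

lemma chi_single:
  "chi (Poly_Mapping.single \<alpha> c) = scale c (prod_list (map complete_h (parts \<alpha>)))"
  by (subst chi_superset[of "{\<alpha>}"]) (auto split: if_splits)

lemma chi_add: "chi (F + G) = chi F + chi G"
proof -
  let ?A = "Poly_Mapping.keys F \<union> Poly_Mapping.keys G"
  have "chi (F + G) = (\<Sum>\<alpha>\<in>?A. scale (Poly_Mapping.lookup (F + G) \<alpha>)
      (prod_list (map complete_h (parts \<alpha>))))"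
    by (rule chi_superset) (use Poly_Mapping.keys_add[of F G] in auto)
  then show ?thesis
    by (simp add: chi_superset[of ?A] lookup_add scale_simps sum.distrib)
qed

lemma poly_mapping_additive_induct [case_names single sum]:
  assumes single: "\<And>k c. P (Poly_Mapping.single k c)"
    and sum: "\<And>F G. P F \<Longrightarrow> P G \<Longrightarrow> P (F + G)"
  shows "P (F :: 'a \<Rightarrow>\<^sub>0 'b::comm_monoid_add)"
proof -
  have *: "P (\<Sum>k\<in>A. Poly_Mapping.single k (Poly_Mapping.lookup F k))" if "finite A" for A
    using that
  proof (induction A rule: finite_induct)
    case empty
    show ?case using single[of undefined 0] by simp
  next
    case (insert k A)
    then show ?case by (simp add: single sum)
  qed
  have "F = (\<Sum>k\<in>Poly_Mapping.keys F. Poly_Mapping.single k (Poly_Mapping.lookup F k))"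
    by (rule poly_mapping_eqI)
      (auto simp: lookup_sum lookup_single when_def in_keys_iff)
  then show ?thesis
    using *[of "Poly_Mapping.keys F"] by simp
qed

lemma chi_mult: "chi (F * G) = chi F * chi G"
proof (induction F rule: poly_mapping_additive_induct)
  case (single \<alpha> c)
  show ?case
  proof (induction G rule: poly_mapping_additive_induct)
    case (single \<beta> d)
    then show ?case
      by (simp add: Poly_Mapping.mult_single chi_single plus_composition.rep_eq scale_mult
          scale_simps(6)[symmetric] mult.commute[of c d])
  next
    case (sum F G)
    then show ?case by (simp add: chi_add distrib_left)
  qed
next
  case (sum F' F'')
  then show ?case by (simp add: chi_add distrib_right)
qed

lemma chi_one: "chi 1 = 1"
  by (simp add: chi_single zero_composition.rep_eq scale_simps flip: Poly_Mapping.single_one)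

lemma chi_scale: "chi (nc_scale c F) = scale c (chi F)"
  by (simp add: nc_scale_def chi_mult chi_single zero_composition.rep_eq scale_mult)

lemma chi_nc_h: "k > 0 \<Longrightarrow> chi (nc_h k) = complete_h k"
  by (simp add: nc_h_def chi_single Composition_inverse scale_simps)


section \<open>Schur and Hall-Littlewood functions\<close>

definition partitions :: "nat \<Rightarrow> nat list set" where
  "partitions n = {\<mu>. sorted_wrt (\<ge>) \<mu> \<and> 0 \<notin> set \<mu> \<and> sum_list \<mu> = n}"

definition part :: "nat list \<Rightarrow> nat \<Rightarrow> nat" where
  "part \<mu> i = (if i < length \<mu> then \<mu> ! i else 0)"

lemma finite_partitions: "finite (partitions n)"
  by (rule finite_subset[OF _ finite_bounded_lists[of n]]) (auto simp: partitions_def)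

text \<open>
  The field of rational functions in \<open>x\<^sub>0, x\<^sub>1, \<dots>\<close>. Since variables are numbered from \<open>0\<close>, the usual
  \<open>x\<^sub>1, \<dots>, x\<^sub>n\<close> are the \<open>rvar i\<close> with \<open>i < n\<close>, and \<open>part \<mu> i\<close> is the usual \<open>\<mu>\<^bsub>i+1\<^esub>\<close>.
\<close>

type_synonym rfun = "(monomial \<Rightarrow>\<^sub>0 Qq) fract"

definition rvar :: "nat \<Rightarrow> rfun" where
  "rvar i = to_fract (Poly_Mapping.single (Poly_Mapping.single i 1) 1)"

definition rconst :: "Qq \<Rightarrow> rfun" where
  "rconst c = to_fract (Poly_Mapping.single 0 c)"

text \<open>
  The symmetric function whose restriction to \<open>n\<close> variables is \<open>R n\<close> for every \<open>n \<ge> N\<close>.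
\<close>

definition stable_symfun :: "nat \<Rightarrow> (nat \<Rightarrow> rfun) \<Rightarrow> Qq symfun" where
  "stable_symfun N R = (THE f. \<forall>n\<ge>N. to_fract (restrict_vars n f) = R n)"

text \<open>
  Schur functions: the bialternant quotient \<open>a\<^bsub>\<mu>+\<delta>\<^esub> / a\<^bsub>\<delta>\<^esub>\<close> with \<open>\<delta> = (n-1, \<dots>, 1, 0)\<close>.
\<close>

definition alternant :: "nat \<Rightarrow> (nat \<Rightarrow> nat) \<Rightarrow> rfun" where
  "alternant n e = det (mat n n (\<lambda>(i, j). rvar i ^ e j))"

definition schur_vars :: "nat list \<Rightarrow> nat \<Rightarrow> rfun" where
  "schur_vars \<mu> n =
     alternant n (\<lambda>j. part \<mu> j + (n - 1 - j)) / alternant n (\<lambda>j. n - 1 - j)"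

definition schur :: "nat list \<Rightarrow> Qq symfun" where
  "schur \<mu> = stable_symfun (length \<mu>) (schur_vars \<mu>)"

text \<open>
  Hall-Littlewood \<open>P\<close>-functions with parameter \<open>q\<close>:
  \<open>P\<^sub>\<lambda>(x\<^sub>1, \<dots>, x\<^sub>n; q) = v\<^sub>\<lambda>(q)\<^sup>-\<^sup>1 \<Sum>\<^sub>w w (x\<^sup>\<lambda> \<Prod>\<^bsub>i<j\<^esub> (x\<^sub>i - q x\<^sub>j) / (x\<^sub>i - x\<^sub>j))\<close>, summed over
  all permutations of the \<open>n\<close> variables. Here \<open>v\<^sub>\<lambda>\<close> is the product of the \<open>v\<^sub>m\<close> over the multiplicities
  \<open>m\<close> of the parts of \<open>\<lambda>\<close>, padded with zeros to length \<open>n\<close>.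
\<close>

definition hl_v :: "nat \<Rightarrow> Qq" where
  "hl_v m = (\<Prod>i = 1..m. (1 - q ^ i) / (1 - q))"

definition hl_v_part :: "nat list \<Rightarrow> nat \<Rightarrow> Qq" where
  "hl_v_part \<mu> n = hl_v (n - length \<mu>) * (\<Prod>i\<in>set \<mu>. hl_v (count_list \<mu> i))"

definition hall_littlewood_P_vars :: "nat list \<Rightarrow> nat \<Rightarrow> rfun" where
  "hall_littlewood_P_vars \<mu> n =
     (\<Sum>w | w permutes {..<n}.
        (\<Prod>i<n. rvar (w i) ^ part \<mu> i) *
        (\<Prod>(i, j)\<in>{(i, j). i < j \<and> j < n}.
           (rvar (w i) - rconst q * rvar (w j)) / (rvar (w i) - rvar (w j))))
     / rconst (hl_v_part \<mu> n)"

definition hall_littlewood_P :: "nat list \<Rightarrow> Qq symfun" where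
  "hall_littlewood_P \<mu> = stable_symfun (length \<mu>) (hall_littlewood_P_vars \<mu>)"

text \<open>
  The Kostka-Foulkes polynomials \<open>K\<^bsub>\<mu>\<lambda>\<^esub>(q)\<close> are the transition coefficients from the \<open>P\<^sub>\<lambda>\<close> to the
  \<open>s\<^sub>\<mu>\<close>, extended by zero.
\<close>

definition kostka_foulkes :: "nat list \<Rightarrow> nat list \<Rightarrow> Qq" where
  "kostka_foulkes = (THE K.
     (\<forall>n. \<forall>\<mu>\<in>partitions n.
        schur \<mu> = (\<Sum>\<nu>\<in>partitions n. scale (K \<mu> \<nu>) (hall_littlewood_P \<nu>))) \<and>
     (\<forall>\<mu> \<nu>. (\<nexists>n. \<mu> \<in> partitions n \<and> \<nu> \<in> partitions n) \<longrightarrow> K \<mu> \<nu> = 0))"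

definition hall_littlewood_H :: "nat list \<Rightarrow> Qq symfun" where
  "hall_littlewood_H \<nu> =
     (\<Sum>\<mu>\<in>partitions (sum_list \<nu>). scale (kostka_foulkes \<mu> \<nu>) (schur \<mu>))"

end

theory Submission
  imports Defs "HOL-Combinatorics.Multiset_Permutations"
begin

text \<open>
  Expanding the ribbons gives \<open>\<chi>(H\<^sub>\<alpha>) = \<Sum>\<^sub>T \<Prod>\<^bsub>i\<in>[a]-T\<^esub> (q\<^sup>i - 1) h\<^bsub>comp T\<^esub>\<close> over \<open>T \<subseteq> [a]\<close>. By the
  duality \<open>h\<^sub>\<beta> = \<Sum>\<^sub>\<mu> [x\<^sup>\<beta>]s\<^sub>\<mu> s\<^sub>\<mu>\<close>, the claim says that the functional
  \<open>L f = \<Sum>\<^sub>T \<Prod>\<^bsub>i\<in>[a]-T\<^esub> (q\<^sup>i - 1) [x\<^bsup>comp T\<^esup>]f\<close> extracts the coefficient of \<open>P\<^bsub>(b,1^a)\<^esub>\<close>, i.e. that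
  \<open>L P\<^sub>\<nu>\<close> is \<open>1\<close> for \<open>\<nu> = (b,1\<^sup>a)\<close> and \<open>0\<close> otherwise.

  If \<open>\<nu>\<close> has \<open>k \<le> a\<close> parts, then \<open>P\<^sub>\<nu>\<close> is a combination of products of \<open>k\<close> functions \<open>q\<^sub>r\<close>, where
  \<open>\<Sum>\<^sub>r q\<^sub>r u\<^sup>r = \<Prod>\<^sub>i (1 - q x\<^sub>i u)/(1 - x\<^sub>i u)\<close>. The coefficient of \<open>x\<^sup>\<beta>\<close> in a product of \<open>q\<^sub>r\<close>'s is
  symmetric in \<open>\<beta>\<close> and the indices \<open>r\<close>, so \<open>L\<close> of such a product is a coefficient of
  \<open>\<Sum>\<^sub>T \<Prod>\<^bsub>i\<in>[a]-T\<^esub> (q\<^sup>i - 1) q\<^bsub>comp T\<^esub>\<close> in only \<open>k\<close> variables \<open>u\<^sub>1, \<dots>, u\<^sub>k\<close>; this sum is a multiple of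
  \<open>\<Sum>\<^bsub>t\<^esub> (-1)\<^sup>t e\<^sub>t q\<^bsub>n-t\<^esub> = (-q)\<^sup>n e\<^sub>n\<close> with \<open>n = a + b > k\<close>, hence zero. If \<open>\<nu>\<close> has more than \<open>a\<close> parts,
  only \<open>T = [a]\<close> contributes and \<open>P\<^sub>\<nu> = e\<^bsub>a+1\<^esub> P\<^bsub>\<nu>-1\<^esub>\<close> in \<open>a + 1\<close> variables.

  The Kostka-Foulkes coefficients are well defined because the matrix expressing suitable multiples
  of the \<open>P\<^sub>\<nu>\<close> by the \<open>s\<^sub>\<kappa>\<close> has entries in \<open>\<rat>[q]\<close> and becomes the identity at \<open>q = 0\<close>.
\<close>

section \<open>Evaluation on finitely many variables\<close>

text \<open>Reading the coefficients of P_\<nu> off by a functional, instead of pairing in the Hall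
  scalar product, avoids orthogonality of the P_\<nu> and any Cauchy identity. Duality is replaced
  by two facts on coefficients: the exchange symmetry in products of q_r, and the agreement,
  permutation by permutation, of the Jacobi-Trudi expansion of s_\<mu> with the expansion of
  a_\<delta> that computes a Schur coefficient. Schur functions, Hall-Littlewood functions and
  Kostka-Foulkes coefficients are definite descriptions, so each needs a witness: a determinant, an
  element of the span of products of q_r, an inverse matrix. The obstacle for P_\<nu> is that the
  symmetrising sum, once its first variable x_i is chosen, continues with a symmetric function of
  the other variables only. But q_r without x_i is a polynomial in x_i whose coefficients are
  multiples of q_s in all variables, so the recursion stays in the span and each part adds exactly
  one factor. The resulting number of factors is what the vanishing argument exploits.\<close>

lemma to_fract_prod: "to_fract (prod f A) = (\<Prod>x\<in>A. to_fract (f x))"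
  by (induction A rule: infinite_finite_induct) auto

lemma to_fract_power: "to_fract (x ^ n) = to_fract x ^ n"
  by (induction n) auto

lemma coefficient_sum: "coefficient (sum F A) m = (\<Sum>x\<in>A. coefficient (F x) m)"
  for F :: "'b \<Rightarrow> 'a::comm_ring_1 symfun"
  by (induction A rule: infinite_finite_induct) (simp_all add: zero_symfun.rep_eq plus_symfun.rep_eq)

lemma scale_minus_one: "scale (- 1) f = - f" for f :: "'a::comm_ring_1 symfun"
  by (simp add: coefficient_inject[symmetric] scale.rep_eq uminus_symfun.rep_eq fun_eq_iff)

lemma scale_sum_right: "scale c (sum f A) = (\<Sum>x\<in>A. scale c (f x))"
  by (induction A rule: infinite_finite_induct) (simp_all add: scale_simps)

lemma scale_sum_left: "scale (sum g A) f = (\<Sum>x\<in>A. scale (g x) f)"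
  by (induction A rule: infinite_finite_induct) (simp_all add: scale_simps)

text \<open>Arbitrary finite variable sets are required because the symmetrising sums lose one
  variable at a time, and \<open>A - {i}\<close> is no initial segment. The guard
  \<open>finite A\<close> keeps the support finite.\<close>

lift_definition restrict_to :: "nat set \<Rightarrow> 'a::comm_ring_1 symfun \<Rightarrow> monomial \<Rightarrow>\<^sub>0 'a" is
  "\<lambda>A F m. if finite A \<and> Poly_Mapping.keys m \<subseteq> A then F m else 0"
proof -
  fix A and F :: "monomial \<Rightarrow> 'a"
  assume "bounded_degree F \<and> permutation_invariant F"
  then obtain d where d: "\<And>m. F m \<noteq> 0 \<Longrightarrow> mdeg m \<le> d"
    unfolding bounded_degree_def by blast
  show "finite {m. (if finite A \<and> Poly_Mapping.keys m \<subseteq> A then F m else 0) \<noteq> 0}"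
  proof (cases "finite A")
    case True
    show ?thesis
      by (rule finite_subset[OF _ finite_bounded_monomials[OF True, of d]]) (use d in auto)
  qed simp
qed

lemma restrict_vars_eq: "restrict_vars n f = restrict_to {..<n} f"
  by (rule poly_mapping_eqI) (simp add: restrict_vars.rep_eq restrict_to.rep_eq)

lemma restrict_to_simps [simp]:
  fixes f g :: "'a::comm_ring_1 symfun"
  assumes "finite A"
  shows "restrict_to A (0 :: 'a symfun) = 0" "restrict_to A (1 :: 'a symfun) = 1"
    "restrict_to A (f + g) = restrict_to A f + restrict_to A g"
    "restrict_to A (f - g) = restrict_to A f - restrict_to A g"
    "restrict_to A (- f) = - restrict_to A f"
    "restrict_to A (f * g) = restrict_to A f * restrict_to A g"
    "restrict_to A (scale c f) = Poly_Mapping.single 0 c * restrict_to A f"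
proof -
  have mult: "restrict_to A (f * g) = restrict_to A f * restrict_to A g" for f g :: "'a symfun"
  proof (rule poly_mapping_eqI)
    fix m
    show "Poly_Mapping.lookup (restrict_to A (f * g)) m =
        Poly_Mapping.lookup (restrict_to A f * restrict_to A g) m"
    proof (cases "Poly_Mapping.keys m \<subseteq> A")
      case True
      then show ?thesis using assms
        by (auto simp: lookup_mult_monomials restrict_to.rep_eq times_symfun.rep_eq keys_add_nat
            intro!: sum.cong)
    next
      case False
      then have "Poly_Mapping.lookup (restrict_to A f * restrict_to A g) m = 0"
        unfolding lookup_mult_monomials
        by (intro sum.neutral) (auto simp: restrict_to.rep_eq keys_add_nat)
      with False show ?thesis
        by (simp add: restrict_to.rep_eq)
    qed
  qed
  show "restrict_to A (f * g) = restrict_to A f * restrict_to A g" by (rule mult)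
  show "restrict_to A (1 :: 'a symfun) = 1"
    by (rule poly_mapping_eqI)
      (use assms in \<open>simp add: restrict_to.rep_eq one_symfun.rep_eq lookup_one when_def\<close>)
  have "restrict_to A (scale c 1) = Poly_Mapping.single 0 c"
    by (rule poly_mapping_eqI)
      (use assms in \<open>auto simp: restrict_to.rep_eq scale.rep_eq one_symfun.rep_eq lookup_single
        when_def\<close>)
  then show "restrict_to A (scale c f) = Poly_Mapping.single 0 c * restrict_to A f"
    using mult[of "scale c 1" f] by (simp add: scale_mult)
qed (rule poly_mapping_eqI, simp add: restrict_to.rep_eq zero_symfun.rep_eq plus_symfun.rep_eq
  minus_symfun.rep_eq uminus_symfun.rep_eq lookup_add lookup_minus)+

text \<open>The values lie in the fraction field, where the quotients in the Schur and
  Hall-Littlewood formulas make sense; the embedding is injective, so coefficients can be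
  recovered.\<close>

definition ev :: "nat set \<Rightarrow> Qq symfun \<Rightarrow> rfun" where
  "ev A f = to_fract (restrict_to A f)"

lemma rconst_simps [simp]:
  "rconst 0 = 0" "rconst 1 = 1" "rconst (c + d) = rconst c + rconst d"
  "rconst (c - d) = rconst c - rconst d" "rconst (- c) = - rconst c"
  "rconst (c * d) = rconst c * rconst d"
  by (simp_all add: rconst_def single_add single_diff single_uminus mult_single
    flip: to_fract_add to_fract_diff to_fract_uminus to_fract_mult)

lemma rconst_eq_iff [simp]: "rconst c = rconst d \<longleftrightarrow> c = d"
  by (simp add: rconst_def) (metis lookup_single_eq)

lemma rconst_eq_0_iff [simp]: "rconst c = 0 \<longleftrightarrow> c = 0"
  using rconst_eq_iff[of c 0] by simp

lemma rconst_power [simp]: "rconst (c ^ n) = rconst c ^ n"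
  by (induction n) auto

lemma rconst_sum [simp]: "rconst (sum f A) = (\<Sum>x\<in>A. rconst (f x))"
  by (induction A rule: infinite_finite_induct) auto

lemma rconst_prod [simp]: "rconst (prod f A) = (\<Prod>x\<in>A. rconst (f x))"
  by (induction A rule: infinite_finite_induct) auto

lemma rconst_inverse [simp]: "rconst (inverse c) = inverse (rconst c)"
proof (cases "c = 0")
  case False
  then have "rconst c * rconst (inverse c) = 1"
    by (simp flip: rconst_simps)
  then show ?thesis by (metis inverse_unique)
qed simp

lemma rconst_divide [simp]: "rconst (c / d) = rconst c / rconst d"
  by (simp add: divide_inverse)

lemma ev_simps [simp]:
  assumes "finite A"
  shows "ev A 0 = 0" "ev A 1 = 1" "ev A (f + g) = ev A f + ev A g"
    "ev A (f - g) = ev A f - ev A g" "ev A (- f) = - ev A f" "ev A (f * g) = ev A f * ev A g"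
    "ev A (scale c f) = rconst c * ev A f"
  using assms by (simp_all add: ev_def rconst_def)

lemma ev_sum [simp]: "finite A \<Longrightarrow> ev A (sum f B) = (\<Sum>x\<in>B. ev A (f x))"
  by (induction B rule: infinite_finite_induct) auto

lemma ev_prod [simp]: "finite A \<Longrightarrow> ev A (prod f B) = (\<Prod>x\<in>B. ev A (f x))"
  by (induction B rule: infinite_finite_induct) auto

lemma ev_eqD:
  assumes "ev A f = ev A g" "finite A" "Poly_Mapping.keys m \<subseteq> A"
  shows "coefficient f m = coefficient g m"
proof -
  have "Poly_Mapping.lookup (restrict_to A f) m = Poly_Mapping.lookup (restrict_to A g) m"
    using assms(1) by (simp add: ev_def)
  then show ?thesis using assms(2,3) by (simp add: restrict_to.rep_eq)
qed

lemma symfun_eqI_ev: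
  assumes "\<And>n. n \<ge> N \<Longrightarrow> ev {..<n} f = ev {..<n} g"
  shows "f = g"
proof -
  have "coefficient f m = coefficient g m" for m
  proof -
    obtain n where "Poly_Mapping.keys m \<subseteq> {..<n}"
      using finite_nat_bounded[of "Poly_Mapping.keys m"] by auto
    then have "Poly_Mapping.keys m \<subseteq> {..<max n N}" by auto
    with assms[of "max n N"] show ?thesis
      by (intro ev_eqD[of "{..<max n N}"]) auto
  qed
  then show ?thesis by (simp add: coefficient_inject[symmetric] fun_eq_iff)
qed

text \<open>Uniqueness is automatic, since evaluations in all large numbers of variables determine a
  symmetric function. Each description by \<open>stable_symfun\<close> thus reduces to exhibiting
  one witness.\<close>

lemma stable_symfun_eqI:
  assumes "\<And>n. n \<ge> N \<Longrightarrow> ev {..<n} f = R n"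
  shows "stable_symfun N R = f"
  unfolding stable_symfun_def
proof (rule the_equality)
  show "\<forall>n\<ge>N. to_fract (restrict_vars n f) = R n"
    using assms by (simp add: restrict_vars_eq ev_def)
next
  fix g assume "\<forall>n\<ge>N. to_fract (restrict_vars n g) = R n"
  then show "g = f"
    using assms by (intro symfun_eqI_ev[of N]) (simp add: restrict_vars_eq ev_def)
qed

lemma rvar_eq_iff [simp]: "rvar i = rvar j \<longleftrightarrow> i = j"
proof
  assume "rvar i = rvar j"
  then have "Poly_Mapping.single i (1::nat) = Poly_Mapping.single j 1"
    by (simp add: rvar_def) (metis lookup_single_eq lookup_single_not_eq zero_neq_one)
  then show "i = j"
    by (metis lookup_single_eq lookup_single_not_eq zero_neq_one)
qed simp

lemma rvar_neq_0 [simp]: "rvar i \<noteq> 0"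
proof
  assume "rvar i = 0"
  then have "Poly_Mapping.single (Poly_Mapping.single i (1::nat)) (1::Qq) = 0"
    by (simp add: rvar_def)
  then show False by (metis lookup_single_eq lookup_zero zero_neq_one)
qed

section \<open>The functions \<open>q\<^sub>r\<close>\<close>

lemma card_keys_map_key:
  assumes "bij \<pi>"
  shows "card (Poly_Mapping.keys (Poly_Mapping.map_key \<pi> m)) = card (Poly_Mapping.keys m)"
proof -
  have "inj \<pi>" "surj \<pi>" using assms by (auto simp: bij_def)
  then show ?thesis
    by (simp add: keys_map_key card_vimage_inj)
qed

text \<open>The coefficient of u^r in the product of (1 - t x_i u)/(1 - x_i u): each variable that
  occurs contributes a factor 1 - t, whatever its exponent. Keeping \<open>t\<close> general treats
  h_r (t = 0) and q_r (t = q) together.\<close>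

lift_definition qfun :: "'a \<Rightarrow> nat \<Rightarrow> 'a::comm_ring_1 symfun" is
  "\<lambda>t r m. if mdeg m = r then (1 - t) ^ card (Poly_Mapping.keys m) else 0"
  by (auto simp: bounded_degree_def permutation_invariant_def mdeg_map_key card_keys_map_key)

lemma complete_h_eq_qfun: "complete_h r = qfun 0 r"
  by (simp add: coefficient_inject[symmetric] complete_h.rep_eq qfun.rep_eq fun_eq_iff)

lemma mdeg_eq_0_iff [simp]: "mdeg m = 0 \<longleftrightarrow> m = 0"
  by (auto simp: mdeg_def in_keys_iff intro: poly_mapping_eqI)

lemma qfun_0 [simp]: "qfun t 0 = 1"
  by (auto simp: coefficient_inject[symmetric] one_symfun.rep_eq qfun.rep_eq fun_eq_iff)

lemma ev_empty_qfun [simp]: "ev {} (qfun t (Suc r)) = 0"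
proof -
  have "restrict_to {} (qfun t (Suc r)) = 0"
    by (rule poly_mapping_eqI) (auto simp: restrict_to.rep_eq qfun.rep_eq mdeg_def)
  then show ?thesis by (simp add: ev_def)
qed

lemma lookup_single_mult:
  fixes F :: "monomial \<Rightarrow>\<^sub>0 'a::comm_ring_1"
  shows "Poly_Mapping.lookup (Poly_Mapping.single e c * F) (e + m) = c * Poly_Mapping.lookup F m"
proof -
  have "Poly_Mapping.lookup (Poly_Mapping.single e c * F) (e + m) =
      (\<Sum>(a, b)\<in>{(e, m)}. Poly_Mapping.lookup (Poly_Mapping.single e c) a * Poly_Mapping.lookup F b)"
    unfolding lookup_mult_monomials
    by (rule sum.mono_neutral_right) (auto simp: finite_monomial_splits lookup_single when_def split: if_splits)
  then show ?thesis by simp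
qed

lemma lookup_single_mult_eq_0:
  fixes F :: "monomial \<Rightarrow>\<^sub>0 'a::comm_ring_1"
  assumes "\<And>m'. m \<noteq> e + m'"
  shows "Poly_Mapping.lookup (Poly_Mapping.single e c * F) m = 0"
  unfolding lookup_mult_monomials using assms
  by (intro sum.neutral) (auto simp: lookup_single when_def)

lemma mdeg_single [simp]: "mdeg (Poly_Mapping.single i k) = k"
  by (simp add: mdeg_def)

lemma monomial_split:
  assumes "y \<in> Poly_Mapping.keys (m :: monomial)"
  obtains m' where "m = Poly_Mapping.single y 1 + m'"
proof
  show "m = Poly_Mapping.single y 1 + (m - Poly_Mapping.single y 1)"
    by (rule poly_mapping_eqI)
      (use assms in \<open>auto simp: lookup_add lookup_minus lookup_single when_def in_keys_iff\<close>)
qed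

text \<open>For the generating functions Q this is Q_(A+y)(u) (1 - y u) = Q_A(u) (1 - t y u),
  compared at u^(r+1).\<close>

lemma ev_qfun_insert:
  assumes "finite A" "y \<notin> A"
  shows "ev (insert y A) (qfun t (Suc r)) = rvar y * ev (insert y A) (qfun t r) +
    ev A (qfun t (Suc r)) - rconst t * rvar y * ev A (qfun t r)"
proof -
  let ?e = "Poly_Mapping.single y (1::nat)"
  let ?B = "insert y A"
  let ?l = "restrict_to ?B (qfun t (Suc r))"
  let ?r = "Poly_Mapping.single ?e 1 * restrict_to ?B (qfun t r) + restrict_to A (qfun t (Suc r)) -
    Poly_Mapping.single ?e t * restrict_to A (qfun t r)"
  have "?l = ?r"
  proof (rule poly_mapping_eqI)
    fix m
    show "Poly_Mapping.lookup ?l m = Poly_Mapping.lookup ?r m"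
    proof (cases "y \<in> Poly_Mapping.keys m")
      case True
      then obtain m' where m: "m = ?e + m'" by (rule monomial_split)
      have nA: "\<not> Poly_Mapping.keys m \<subseteq> A" using True assms by auto
      have keys: "Poly_Mapping.keys m = insert y (Poly_Mapping.keys m')"
        by (simp add: m keys_add_nat)
      have deg: "mdeg m = Suc (mdeg m')" by (simp add: m mdeg_add)
      have sub: "Poly_Mapping.keys m' \<subseteq> A \<longleftrightarrow> Poly_Mapping.keys m' \<subseteq> ?B \<and> y \<notin> Poly_Mapping.keys m'"
        using assms by auto
      have "Poly_Mapping.lookup ?r m = Poly_Mapping.lookup (restrict_to ?B (qfun t r)) m' -
          t * Poly_Mapping.lookup (restrict_to A (qfun t r)) m'"
        using nA by (simp add: lookup_add lookup_minus m lookup_single_mult restrict_to.rep_eq)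
      \<comment> \<open>If \<open>y\<close> divides \<open>m'\<close>, the number of variables is
        unchanged and the second term vanishes; otherwise \<open>y\<close> is a new variable and the
        two terms combine to the factor 1 - t.\<close>
      also have "\<dots> = Poly_Mapping.lookup ?l m"
        using assms sub keys deg
        by (cases "y \<in> Poly_Mapping.keys m'")
          (auto simp: restrict_to.rep_eq qfun.rep_eq insert_absorb algebra_simps)
      finally show ?thesis by simp
    next
      case False
      then have "m \<noteq> ?e + m'" for m'
        by (auto simp: keys_add_nat)
      with False assms show ?thesis
        by (auto simp: lookup_add lookup_minus lookup_single_mult_eq_0 restrict_to.rep_eq
          qfun.rep_eq)
    qed
  qed
  then have "ev ?B (qfun t (Suc r)) = to_fract ?r" by (simp add: ev_def)
  also have "Poly_Mapping.single ?e t = Poly_Mapping.single 0 t * Poly_Mapping.single ?e 1"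
    by (simp add: mult_single)
  finally show ?thesis
    by (simp add: ev_def rvar_def rconst_def)
qed

section \<open>Symmetrising sums\<close>

definition hl_factor :: "Qq \<Rightarrow> nat set \<Rightarrow> nat \<Rightarrow> rfun" where
  "hl_factor t A i = (\<Prod>j\<in>A - {i}. (rvar i - rconst t * rvar j) / (rvar i - rvar j))"

text \<open>The partial fraction form of q_r for r > 0. At r = 0 its value is 1 - t^n in n variables
  instead of q_0 = 1, which is why r = 0 is treated separately.\<close>

definition power_sum_hl :: "Qq \<Rightarrow> nat set \<Rightarrow> nat \<Rightarrow> rfun" where
  "power_sum_hl t A r = (1 - rconst t) * (\<Sum>i\<in>A. rvar i ^ r * hl_factor t A i)"

text \<open>The factor x_i - x_y kills the term i = y and cancels one denominator in every other
  term. The outcome is the recursion already known for q_r, now including r = 0.\<close>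

lemma power_sum_hl_rec:
  assumes "finite A" "y \<in> A"
  shows "power_sum_hl t A (Suc r) - rvar y * power_sum_hl t A r =
    power_sum_hl t (A - {y}) (Suc r) - rconst t * rvar y * power_sum_hl t (A - {y}) r"
proof -
  let ?B = "A - {y}"
  have fac: "(rvar i - rvar y) * hl_factor t A i = (rvar i - rconst t * rvar y) * hl_factor t ?B i"
    if "i \<in> ?B" for i
  proof -
    have "A - {i} = insert y (?B - {i})" using that assms by auto
    then have "hl_factor t A i =
        (rvar i - rconst t * rvar y) / (rvar i - rvar y) * hl_factor t ?B i"
      using assms by (simp add: hl_factor_def)
    with that show ?thesis by simp
  qed
  have "(\<Sum>i\<in>A. rvar i ^ Suc r * hl_factor t A i) - rvar y * (\<Sum>i\<in>A. rvar i ^ r * hl_factor t A i) =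
      (\<Sum>i\<in>A. rvar i ^ r * ((rvar i - rvar y) * hl_factor t A i))"
    by (simp add: sum_subtractf sum_distrib_left algebra_simps)
  also have "\<dots> = (\<Sum>i\<in>?B. rvar i ^ r * ((rvar i - rvar y) * hl_factor t A i))"
    using assms by (subst sum.remove[of A y]) auto
  also have "\<dots> = (\<Sum>i\<in>?B. rvar i ^ r * ((rvar i - rconst t * rvar y) * hl_factor t ?B i))"
    by (rule sum.cong) (simp_all add: fac)
  also have "\<dots> = (\<Sum>i\<in>?B. rvar i ^ Suc r * hl_factor t ?B i) -
      rconst t * rvar y * (\<Sum>i\<in>?B. rvar i ^ r * hl_factor t ?B i)"
    by (simp add: sum_subtractf sum_distrib_left algebra_simps)
  finally have eq: "(\<Sum>i\<in>A. rvar i ^ Suc r * hl_factor t A i) -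
        rvar y * (\<Sum>i\<in>A. rvar i ^ r * hl_factor t A i) =
      (\<Sum>i\<in>?B. rvar i ^ Suc r * hl_factor t ?B i) -
        rconst t * rvar y * (\<Sum>i\<in>?B. rvar i ^ r * hl_factor t ?B i)" .
  have "c * a - y' * (c * b) = c * a' - z * (c * b')"
    if "a - y' * b = a' - z * b'" for a b a' b' c y' z :: rfun
    using arg_cong[OF that, of "(*) c"] by (simp add: algebra_simps)
  from this[OF eq, of "1 - rconst t"] show ?thesis
    unfolding power_sum_hl_def by (simp add: mult.assoc)
qed

text \<open>Comparing the recursion at two different variables determines the value at \<open>r = 0\<close>.\<close>

lemma power_sum_hl_0_1:
  assumes "finite A"
  shows "power_sum_hl t A 0 = 1 - rconst t ^ card A \<and>
    power_sum_hl t A 1 = (1 - rconst t) * (\<Sum>i\<in>A. rvar i)"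
  using assms
proof (induction A rule: finite_psubset_induct)
  case (psubset A)
  show ?case
  proof (cases "card A \<le> 1")
    case True
    then consider "A = {}" | y where "A = {y}"
      using psubset.hyps by (metis card_le_Suc0_iff_eq One_nat_def is_singletonI' is_singleton_def)
    then show ?thesis
      by cases (simp_all add: power_sum_hl_def hl_factor_def)
  next
    case False
    then have "\<exists>y\<in>A. \<exists>z\<in>A. y \<noteq> z"
      using psubset.hyps card_le_Suc0_iff_eq[of A] by auto
    then obtain y z where yz: "y \<in> A" "z \<in> A" "y \<noteq> z" by blast
    define E where "E = (\<Sum>i\<in>A. rvar i)"
    have rec: "power_sum_hl t A 1 = (1 - rconst t) * E +
        rvar w * (power_sum_hl t A 0 - (1 - rconst t ^ card A))" if "w \<in> A" for w
    proof -
      have "A - {w} \<subset> A" using that by auto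
      note IH = psubset.IH[OF this]
      have card: "card A = Suc (card (A - {w}))"
        by (rule card.remove) (use psubset.hyps that in auto)
      have "E = rvar w + (\<Sum>i\<in>A - {w}. rvar i)"
        unfolding E_def using psubset.hyps that by (rule sum.remove)
      then have *: "(\<Sum>i\<in>A - {w}. rvar i) = E - rvar w" by simp
      have "power_sum_hl t A 1 = rvar w * power_sum_hl t A 0 + power_sum_hl t (A - {w}) 1 -
          rconst t * rvar w * power_sum_hl t (A - {w}) 0"
        using power_sum_hl_rec[OF psubset.hyps that, of t 0] by (simp add: algebra_simps)
      also have "power_sum_hl t (A - {w}) 1 = (1 - rconst t) * (E - rvar w)"
        using IH * by simp
      also have "power_sum_hl t (A - {w}) 0 = 1 - rconst t ^ card (A - {w})"
        using IH by simp
      finally show ?thesis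
        by (simp add: card algebra_simps)
    qed
    have "(rvar y - rvar z) * (power_sum_hl t A 0 - (1 - rconst t ^ card A)) = 0"
      using rec[OF yz(1)] rec[OF yz(2)] unfolding left_diff_distrib by (metis add_left_imp_eq eq_iff_diff_eq_0)
    with yz have "power_sum_hl t A 0 = 1 - rconst t ^ card A"
      by simp
    with rec[OF yz(1)] show ?thesis by (simp add: E_def)
  qed
qed

lemma power_sum_hl_Suc:
  assumes "finite A"
  shows "power_sum_hl t A (Suc r) = ev A (qfun t (Suc r))"
  using assms
proof (induction A arbitrary: r rule: finite_induct)
  case empty
  then show ?case by (simp add: power_sum_hl_def)
next
  case (insert y A)
  have *: "insert y A - {y} = A" using insert.hyps by auto
  show ?case
  proof (induction r)
    \<comment> \<open>The deviations from q_0 = 1 on both sides cancel: (1 - t^(n+1)) - t (1 - t^n)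
      = 1 - t.\<close>
    case 0
    show ?case
      using power_sum_hl_rec[of "insert y A" y t 0] insert.hyps insert.IH[of 0]
        ev_qfun_insert[OF insert.hyps, of t 0] power_sum_hl_0_1[of "insert y A" t]
        power_sum_hl_0_1[of A t] *
      by (simp add: algebra_simps) (metis add_left_imp_eq)
  next
    case (Suc r)
    show ?case
      using power_sum_hl_rec[of "insert y A" y t "Suc r"] insert.hyps insert.IH
        ev_qfun_insert[OF insert.hyps, of t "Suc r"] * Suc.IH
      by (simp add: algebra_simps) (metis add_right_imp_eq)
  qed
qed

text \<open>For a partition this is Macdonald's Q_\<nu>: the sum over ordered choices of one
  distinct variable per part. The recursive form peels off the first part together with its
  variable.\<close>

fun hl_sum :: "Qq \<Rightarrow> nat list \<Rightarrow> nat set \<Rightarrow> rfun" where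
  "hl_sum t [] A = 1"
| "hl_sum t (k # \<nu>) A =
     (1 - rconst t) * (\<Sum>i\<in>A. rvar i ^ k * hl_factor t A i * hl_sum t \<nu> (A - {i}))"

inductive_set qspan :: "Qq \<Rightarrow> nat \<Rightarrow> nat \<Rightarrow> Qq symfun set" for t l d where
  zero: "0 \<in> qspan t l d"
| add: "f \<in> qspan t l d \<Longrightarrow> g \<in> qspan t l d \<Longrightarrow> f + g \<in> qspan t l d"
| scale: "f \<in> qspan t l d \<Longrightarrow> scale c f \<in> qspan t l d"
| prod: "length rs = l \<Longrightarrow> sum_list rs = d \<Longrightarrow> prod_list (map (qfun t) rs) \<in> qspan t l d"

lemma qspan_sum: "(\<And>x. x \<in> B \<Longrightarrow> f x \<in> qspan t l d) \<Longrightarrow> sum f B \<in> qspan t l d"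
proof (induction B rule: infinite_finite_induct)
  case (insert x B)
  then show ?case by (simp add: qspan.add)
qed (simp_all add: qspan.zero)

lemma qspan_mult: "f \<in> qspan t l d \<Longrightarrow> qfun t r * f \<in> qspan t (Suc l) (r + d)"
proof (induction rule: qspan.induct)
  case (prod rs)
  then show ?case
    using qspan.prod[of "r # rs" "Suc l" "r + d" t] by simp
qed (simp_all add: qspan.zero qspan.add qspan.scale distrib_left scale_mult)

lemma ev_qfun_remove:
  obtains c where "\<And>A i. finite A \<Longrightarrow> i \<in> A \<Longrightarrow>
    ev (A - {i}) (qfun t r) = (\<Sum>s\<le>r. rconst (c s) * rvar i ^ s * ev A (qfun t (r - s)))"
proof -
  \<comment> \<open>The coefficients of (1 - z)/(1 - t z), the factor by which the generating
    function changes at z = x_i u when x_i is removed. They depend neither on \<open>A\<close> nor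
    on \<open>i\<close>.\<close>
  define c where "c s = (if s = 0 then 1 else t ^ s - t ^ (s - 1))" for s
  have c: "c (Suc s) = t * c s - (if s = 0 then 1 else 0)" for s
    by (cases s) (simp_all add: c_def algebra_simps)
  have "ev (A - {i}) (qfun t r) = (\<Sum>s\<le>r. rconst (c s) * rvar i ^ s * ev A (qfun t (r - s)))"
    if A: "finite A" "i \<in> A" for A i
  proof (induction r)
    case 0
    with A show ?case by (simp add: c_def)
  next
    case (Suc r)
    have "(\<Sum>s\<le>Suc r. rconst (c s) * rvar i ^ s * ev A (qfun t (Suc r - s))) =
        ev A (qfun t (Suc r)) +
        (\<Sum>s\<le>r. rconst (c (Suc s)) * rvar i ^ Suc s * ev A (qfun t (r - s)))"
      by (subst sum.atMost_Suc_shift) (simp add: c_def)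
    also have "(\<Sum>s\<le>r. rconst (c (Suc s)) * rvar i ^ Suc s * ev A (qfun t (r - s))) =
        (\<Sum>s\<le>r. rconst t * rvar i * (rconst (c s) * rvar i ^ s * ev A (qfun t (r - s)))) -
        (\<Sum>s\<le>r. if s = 0 then rvar i * ev A (qfun t r) else 0)"
      by (subst sum_subtractf[symmetric], rule sum.cong) (auto simp: c algebra_simps)
    also have "(\<Sum>s\<le>r. rconst t * rvar i * (rconst (c s) * rvar i ^ s * ev A (qfun t (r - s)))) =
        rconst t * rvar i * ev (A - {i}) (qfun t r)"
      unfolding Suc.IH sum_distrib_left ..
    finally show ?case
      using ev_qfun_insert[of "A - {i}" i t r] A by (simp add: insert_absorb)
  qed
  then show ?thesis by (rule that)
qed

text \<open>The point is uniformity: the same symmetric functions \<open>F s\<close> serve all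
  \<open>A\<close> and \<open>i\<close>, so that a later sum over \<open>i\<close> sees only powers
  of x_i.\<close>

lemma qspan_remove:
  assumes "f \<in> qspan t l d"
  shows "\<exists>F. (\<forall>s\<le>d. F s \<in> qspan t l (d - s)) \<and>
    (\<forall>A i. finite A \<longrightarrow> i \<in> A \<longrightarrow> ev (A - {i}) f = (\<Sum>s\<le>d. rvar i ^ s * ev A (F s)))"
  using assms
proof (induction rule: qspan.induct)
  case zero
  show ?case by (rule exI[of _ "\<lambda>_. 0"]) (simp add: qspan.zero)
next
  case (add f g)
  from add.IH obtain F G where
    F: "(\<forall>s\<le>d. F s \<in> qspan t l (d - s)) \<and>
      (\<forall>A i. finite A \<longrightarrow> i \<in> A \<longrightarrow> ev (A - {i}) f = (\<Sum>s\<le>d. rvar i ^ s * ev A (F s)))" and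
    G: "(\<forall>s\<le>d. G s \<in> qspan t l (d - s)) \<and>
      (\<forall>A i. finite A \<longrightarrow> i \<in> A \<longrightarrow> ev (A - {i}) g = (\<Sum>s\<le>d. rvar i ^ s * ev A (G s)))"
    by (elim exE) (rule that)
  show ?case
    by (rule exI[of _ "\<lambda>s. F s + G s"])
      (use F G in \<open>simp add: qspan.add distrib_left sum.distrib\<close>)
next
  case (scale f c)
  from scale.IH obtain F where
    F: "(\<forall>s\<le>d. F s \<in> qspan t l (d - s)) \<and>
      (\<forall>A i. finite A \<longrightarrow> i \<in> A \<longrightarrow> ev (A - {i}) f = (\<Sum>s\<le>d. rvar i ^ s * ev A (F s)))"
    by (elim exE) (rule that)
  show ?case
    by (rule exI[of _ "\<lambda>s. scale c (F s)"])
      (use F in \<open>simp add: qspan.scale sum_distrib_left mult_ac\<close>)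
next
  case (prod rs)
  then show ?case
  proof (induction rs arbitrary: l d)
    case Nil
    have "1 \<in> qspan t 0 0" using qspan.prod[of "[]" 0 0 t] by simp
    with Nil show ?case by (intro exI[of _ "\<lambda>_. 1"]) auto
  next
    case (Cons r rs)
    define d' l' where "d' = sum_list rs" and "l' = length rs"
    obtain F where F: "\<And>s. s \<le> d' \<Longrightarrow> F s \<in> qspan t l' (d' - s)"
      "\<And>A i. finite A \<Longrightarrow> i \<in> A \<Longrightarrow>
        ev (A - {i}) (prod_list (map (qfun t) rs)) = (\<Sum>s\<le>d'. rvar i ^ s * ev A (F s))"
      using Cons.IH[OF l'_def[symmetric] d'_def[symmetric]] by (elim exE) (rule that, auto)
    obtain c where c: "\<And>A i. finite A \<Longrightarrow> i \<in> A \<Longrightarrow>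
        ev (A - {i}) (qfun t r) = (\<Sum>s\<le>r. rconst (c s) * rvar i ^ s * ev A (qfun t (r - s)))"
      using ev_qfun_remove by blast
    have d: "d = r + d'" and l: "l = Suc l'" using Cons.prems by (auto simp: d'_def l'_def)
    define I where "I w = {p \<in> {..r} \<times> {..d'}. fst p + snd p = w}" for w
    define G where "G w = (\<Sum>p\<in>I w. scale (c (fst p)) (qfun t (r - fst p) * F (snd p)))" for w
    show ?case
    proof (intro exI[of _ G] conjI allI impI)
      fix w assume "w \<le> d"
      show "G w \<in> qspan t l (d - w)"
        unfolding G_def
      proof (intro qspan_sum qspan.scale)
        fix p assume p: "p \<in> I w"
        then have "qfun t (r - fst p) * F (snd p) \<in>
            qspan t (Suc l') ((r - fst p) + (d' - snd p))"
          by (intro qspan_mult F) (auto simp: I_def)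
        moreover have "(r - fst p) + (d' - snd p) = d - w"
          using p by (auto simp: I_def d)
        ultimately show "qfun t (r - fst p) * F (snd p) \<in> qspan t l (d - w)"
          by (simp add: l)
      qed
    next
      fix A and i :: nat assume A: "finite A" "i \<in> A"
      have "ev (A - {i}) (prod_list (map (qfun t) (r # rs))) =
          (\<Sum>s\<le>r. rconst (c s) * rvar i ^ s * ev A (qfun t (r - s))) *
          (\<Sum>u\<le>d'. rvar i ^ u * ev A (F u))"
        using A c[OF A] F(2)[OF A] by simp
      also have "\<dots> = (\<Sum>p\<in>{..r} \<times> {..d'}.
          rvar i ^ (fst p + snd p) * ev A (scale (c (fst p)) (qfun t (r - fst p) * F (snd p))))"
        unfolding sum_product sum.cartesian_product
        by (rule sum.cong) (use A in \<open>simp_all add: case_prod_beta power_add mult_ac\<close>)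
      also have "\<dots> = (\<Sum>w\<le>d. \<Sum>p\<in>I w.
          rvar i ^ (fst p + snd p) * ev A (scale (c (fst p)) (qfun t (r - fst p) * F (snd p))))"
        unfolding I_def
        by (rule sum.group[where g = "\<lambda>p. fst p + snd p", symmetric]) (auto simp: d)
      also have "\<dots> = (\<Sum>w\<le>d. rvar i ^ w * ev A (G w))"
      proof (rule sum.cong)
        fix w
        show "(\<Sum>p\<in>I w. rvar i ^ (fst p + snd p) *
              ev A (scale (c (fst p)) (qfun t (r - fst p) * F (snd p)))) = rvar i ^ w * ev A (G w)"
          unfolding G_def ev_sum[OF A(1)] sum_distrib_left
          by (rule sum.cong) (simp_all add: I_def)
      qed simp
      finally show "ev (A - {i}) (prod_list (map (qfun t) (r # rs))) =
          (\<Sum>w\<le>d. rvar i ^ w * ev A (G w))" .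
    qed
  qed
qed

text \<open>Rewriting the inner sum over \<open>A - {i}\<close> as a polynomial in x_i turns the
  outer sum into partial fraction forms of q_(k+s). One \<open>f\<close> works for every finite
  \<open>A\<close>, which later supplies the stable limit.\<close>

lemma hl_sum_in_qspan:
  assumes "0 \<notin> set \<nu>"
  obtains f where "f \<in> qspan t (length \<nu>) (sum_list \<nu>)"
    "\<And>A. finite A \<Longrightarrow> ev A f = hl_sum t \<nu> A"
proof -
  have "\<exists>f\<in>qspan t (length \<nu>) (sum_list \<nu>). \<forall>A. finite A \<longrightarrow> ev A f = hl_sum t \<nu> A"
    using assms
  proof (induction \<nu>)
    case Nil
    show ?case using qspan.prod[of "[]" 0 0 t] by (intro bexI[of _ 1]) auto
  next
    case (Cons k \<nu>)
    then obtain f where f: "f \<in> qspan t (length \<nu>) (sum_list \<nu>)"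
      "\<And>A. finite A \<Longrightarrow> ev A f = hl_sum t \<nu> A"
      by auto
    define d where "d = sum_list \<nu>"
    obtain F where F: "\<And>s. s \<le> d \<Longrightarrow> F s \<in> qspan t (length \<nu>) (d - s)"
      "\<And>A i. finite A \<Longrightarrow> i \<in> A \<Longrightarrow> ev (A - {i}) f = (\<Sum>s\<le>d. rvar i ^ s * ev A (F s))"
      using qspan_remove[OF f(1)] unfolding d_def by blast
    define g where "g = (\<Sum>s\<le>d. qfun t (k + s) * F s)"
    have "qfun t (k + s) * F s \<in> qspan t (Suc (length \<nu>)) (k + d)" if "s \<le> d" for s
      using qspan_mult[OF F(1)[OF that], of "k + s"] that by simp
    then have "g \<in> qspan t (length (k # \<nu>)) (sum_list (k # \<nu>))"
      unfolding g_def by (auto intro: qspan_sum simp: d_def)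
    moreover have "ev A g = hl_sum t (k # \<nu>) A" if A: "finite A" for A
    proof -
      have "hl_sum t (k # \<nu>) A = (1 - rconst t) *
          (\<Sum>i\<in>A. rvar i ^ k * hl_factor t A i * (\<Sum>s\<le>d. rvar i ^ s * ev A (F s)))"
        using A f(2) F(2)[OF A] by (auto intro!: sum.cong)
      also have "\<dots> = (\<Sum>i\<in>A. \<Sum>s\<le>d. (1 - rconst t) * (rvar i ^ (k + s) * hl_factor t A i) * ev A (F s))"
        unfolding sum_distrib_left by (intro sum.cong refl) (simp add: power_add mult_ac)
      also have "\<dots> = (\<Sum>s\<le>d. power_sum_hl t A (k + s) * ev A (F s))"
        unfolding power_sum_hl_def sum_distrib_left sum_distrib_right by (rule sum.swap)
      also have "\<dots> = (\<Sum>s\<le>d. ev A (qfun t (k + s) * F s))"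
      proof (rule sum.cong)
        fix s
        \<comment> \<open>Here k > 0 is essential, as the partial fraction form differs from q_0 at
          exponent 0.\<close>
        have "power_sum_hl t A (k + s) = ev A (qfun t (k + s))"
          using power_sum_hl_Suc[OF A, of t "k + s - 1"] Cons.prems by simp
        then show "power_sum_hl t A (k + s) * ev A (F s) = ev A (qfun t (k + s) * F s)"
          using A by simp
      qed simp
      finally show ?thesis using A by (simp add: g_def)
    qed
    ultimately show ?case by blast
  qed
  then show ?thesis using that by blast
qed

section \<open>Sums over all orderings of the variables\<close>

fun ordered_term :: "Qq \<Rightarrow> (nat \<Rightarrow> nat) \<Rightarrow> nat list \<Rightarrow> rfun" where
  "ordered_term t e [] = 1"
| "ordered_term t e (x # xs) = rvar x ^ e 0 *
     (\<Prod>y\<in>set xs. (rvar x - rconst t * rvar y) / (rvar x - rvar y)) * ordered_term t (e \<circ> Suc) xs"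

text \<open>Orderings of a set replace permutations of indices so that the first variable can be
  split off, leaving the same kind of sum on a smaller set.\<close>

definition ordered_sum :: "Qq \<Rightarrow> (nat \<Rightarrow> nat) \<Rightarrow> nat set \<Rightarrow> rfun" where
  "ordered_sum t e A = (\<Sum>xs\<in>permutations_of_set A. ordered_term t e xs)"

lemma ordered_sum_empty [simp]: "ordered_sum t e {} = 1"
  by (simp add: ordered_sum_def)

lemma ordered_sum_rec:
  assumes "finite A" "A \<noteq> {}"
  shows "ordered_sum t e A =
    (\<Sum>i\<in>A. rvar i ^ e 0 * hl_factor t A i * ordered_sum t (e \<circ> Suc) (A - {i}))"
proof -
  have "ordered_sum t e A =
      (\<Sum>i\<in>A. \<Sum>xs\<in>(#) i ` permutations_of_set (A - {i}). ordered_term t e xs)"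
    unfolding ordered_sum_def permutations_of_set_nonempty[OF assms(2)]
    using assms(1) by (intro sum.UNION_disjoint) auto
  also have "\<dots> = (\<Sum>i\<in>A. rvar i ^ e 0 * hl_factor t A i * ordered_sum t (e \<circ> Suc) (A - {i}))"
  proof (rule sum.cong)
    fix i assume "i \<in> A"
    show "(\<Sum>xs\<in>(#) i ` permutations_of_set (A - {i}). ordered_term t e xs) =
        rvar i ^ e 0 * hl_factor t A i * ordered_sum t (e \<circ> Suc) (A - {i})"
      by (subst sum.reindex)
        (auto simp: ordered_sum_def hl_factor_def sum_distrib_left dest: permutations_of_setD
          intro!: sum.cong)
  qed simp
  finally show ?thesis .
qed

text \<open>Iterating the value of the partial fraction form at r = 0: with m variables left, the
  choice of the next one contributes 1 - t^m. The powers of 1 - t are kept on the left to avoid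
  division.\<close>

lemma ordered_sum_0:
  assumes "finite A"
  shows "(1 - rconst t) ^ card A * ordered_sum t (\<lambda>_. 0) A = rconst (\<Prod>i=1..card A. 1 - t ^ i)"
  using assms
proof (induction "card A" arbitrary: A)
  case (Suc n)
  have ne: "A \<noteq> {}" using Suc.hyps by auto
  have "(1 - rconst t) ^ card A * ordered_sum t (\<lambda>_. 0) A = (1 - rconst t) *
      (\<Sum>i\<in>A. hl_factor t A i * ((1 - rconst t) ^ n * ordered_sum t (\<lambda>_. 0) (A - {i})))"
    unfolding ordered_sum_rec[OF Suc.prems ne] Suc.hyps(2)[symmetric]
    by (simp add: sum_distrib_left mult_ac comp_def)
  also have "\<dots> = (1 - rconst t) * (\<Sum>i\<in>A. hl_factor t A i * rconst (\<Prod>i=1..n. 1 - t ^ i))"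
  proof (intro arg_cong2[of _ _ _ _ "(*)"] sum.cong refl)
    fix i assume "i \<in> A"
    then have "card (A - {i}) = n" using Suc by simp
    then show "(1 - rconst t) ^ n * ordered_sum t (\<lambda>_. 0) (A - {i}) = rconst (\<Prod>i=1..n. 1 - t ^ i)"
      using Suc.hyps(1)[of "A - {i}"] Suc.prems by simp
  qed
  also have "\<dots> = power_sum_hl t A 0 * rconst (\<Prod>i=1..n. 1 - t ^ i)"
    by (simp add: power_sum_hl_def sum_distrib_right)
  also have "\<dots> = rconst (\<Prod>i=1..card A. 1 - t ^ i)"
    using power_sum_hl_0_1[OF Suc.prems, of t] by (simp add: Suc.hyps(2)[symmetric] mult.commute)
  finally show ?case .
qed simp

lemma part_Cons [simp]: "part (k # \<nu>) 0 = k" "part (k # \<nu>) \<circ> Suc = part \<nu>"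
  by (auto simp: part_def)

lemma part_Nil [simp]: "part [] = (\<lambda>_. 0)"
  by (auto simp: part_def)

text \<open>Once the parts are used up, the remaining variables carry exponent 0 and contribute only
  a constant.\<close>

lemma ordered_sum_part:
  assumes "finite A" "length \<nu> \<le> card A"
  shows "(1 - rconst t) ^ card A * ordered_sum t (part \<nu>) A =
    rconst (\<Prod>i=1..card A - length \<nu>. 1 - t ^ i) * hl_sum t \<nu> A"
  using assms
proof (induction \<nu> arbitrary: A)
  case Nil
  then show ?case using ordered_sum_0[of A t] by simp
next
  case (Cons k \<nu>)
  then obtain n where n: "card A = Suc n" by (cases "card A") auto
  then have ne: "A \<noteq> {}" by auto
  have IH: "(1 - rconst t) ^ n * ordered_sum t (part \<nu>) (A - {i}) =
      rconst (\<Prod>i=1..n - length \<nu>. 1 - t ^ i) * hl_sum t \<nu> (A - {i})" if "i \<in> A" for i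
    using Cons.IH[of "A - {i}"] Cons.prems n that by simp
  have "(1 - rconst t) ^ card A * ordered_sum t (part (k # \<nu>)) A = (1 - rconst t) *
      (\<Sum>i\<in>A. rvar i ^ k * hl_factor t A i * ((1 - rconst t) ^ n * ordered_sum t (part \<nu>) (A - {i})))"
    unfolding ordered_sum_rec[OF Cons.prems(1) ne] n
    by (simp add: sum_distrib_left mult_ac)
  also have "\<dots> = (1 - rconst t) * (\<Sum>i\<in>A. rvar i ^ k * hl_factor t A i *
      (rconst (\<Prod>i=1..n - length \<nu>. 1 - t ^ i) * hl_sum t \<nu> (A - {i})))"
    by (rule arg_cong[of _ _ "(*) (1 - rconst t)"], rule sum.cong) (simp_all only: IH)
  also have "\<dots> = rconst (\<Prod>i=1..n - length \<nu>. 1 - t ^ i) * hl_sum t (k # \<nu>) A"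
    by (simp add: sum_distrib_left mult_ac)
  finally show ?case by (simp add: n)
qed

lemma ordered_term_eq:
  assumes "distinct xs"
  shows "ordered_term t e xs = (\<Prod>i<length xs. rvar (xs ! i) ^ e i) *
    (\<Prod>(i, j)\<in>{(i, j). i < j \<and> j < length xs}.
       (rvar (xs ! i) - rconst t * rvar (xs ! j)) / (rvar (xs ! i) - rvar (xs ! j)))"
  using assms
proof (induction xs arbitrary: e)
  case (Cons x xs)
  let ?f = "\<lambda>x y. (rvar x - rconst t * rvar y) / (rvar x - rvar y)"
  let ?P = "\<lambda>n. {(i, j). i < j \<and> j < (n :: nat)}"
  let ?n = "length xs"
  have fin: "finite (?P n)" for n
    by (rule finite_subset[of _ "{..<n} \<times> {..<n}"]) auto
  have split: "?P (Suc ?n) = (\<lambda>j. (0, Suc j)) ` {..<?n} \<union> map_prod Suc Suc ` ?P ?n"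
  proof (rule Set.set_eqI)
    fix p :: "nat \<times> nat"
    obtain i j where [simp]: "p = (i, j)" by force
    show "p \<in> ?P (Suc ?n) \<longleftrightarrow> p \<in> (\<lambda>j. (0, Suc j)) ` {..<?n} \<union> map_prod Suc Suc ` ?P ?n"
      by (cases i; cases j) (auto simp: image_iff)
  qed
  have "(\<Prod>(i, j)\<in>?P (Suc ?n). ?f ((x # xs) ! i) ((x # xs) ! j)) =
      (\<Prod>j<?n. ?f x (xs ! j)) * (\<Prod>(i, j)\<in>?P ?n. ?f (xs ! i) (xs ! j))"
    unfolding split using fin
    by (subst prod.union_disjoint) (auto simp: prod.reindex inj_on_def case_prod_beta)
  moreover have "(\<Prod>j<?n. ?f x (xs ! j)) = (\<Prod>y\<in>set xs. ?f x y)"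
    using Cons.prems
    by (intro prod.reindex_bij_betw) (auto simp: bij_betw_nth)
  moreover have "(\<Prod>i<Suc ?n. rvar ((x # xs) ! i) ^ e i) =
      rvar x ^ e 0 * (\<Prod>i<?n. rvar (xs ! i) ^ (e \<circ> Suc) i)"
    by (subst prod.lessThan_Suc_shift) simp
  ultimately show ?case
    using Cons by simp
qed (auto simp: case_prod_beta)

lemma bij_betw_permutations_of_set:
  "bij_betw (\<lambda>w. map w [0..<n]) {w. w permutes {..<n}} (permutations_of_set {..<n})"
proof (rule bij_betwI')
  fix v w assume *: "v \<in> {w. w permutes {..<n}}" "w \<in> {w. w permutes {..<n}}"
  show "map v [0..<n] = map w [0..<n] \<longleftrightarrow> v = w"
  proof
    assume "map v [0..<n] = map w [0..<n]"
    then have "v i = w i" if "i < n" for i using that by (auto simp: list_eq_iff_nth_eq)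
    moreover have "v i = w i" if "\<not> i < n" for i using that * by (auto simp: permutes_def)
    ultimately show "v = w" by blast
  qed simp
next
  fix w assume "w \<in> {w. w permutes {..<n}}"
  then show "map w [0..<n] \<in> permutations_of_set {..<n}"
    using permutes_image[of w "{..<n}"] permutes_inj_on[of w "{..<n}" "{..<n}"]
    by (auto simp: permutations_of_set_def distinct_map lessThan_atLeast0)
next
  fix xs assume xs: "xs \<in> permutations_of_set {..<n}"
  then have len: "length xs = n" "set xs = {..<n}" "distinct xs"
    using length_finite_permutations_of_set[OF xs] permutations_of_setD[OF xs] by simp_all
  define w where "w i = (if i < n then xs ! i else i)" for i
  have "bij_betw (\<lambda>i. xs ! i) {..<n} {..<n}"
    by (rule bij_betw_nth[OF len(3)]) (simp_all only: len)
  then have "bij_betw w {..<n} {..<n}"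
    by (subst bij_betw_cong[of _ w "\<lambda>i. xs ! i"]) (simp_all add: w_def)
  then have "w permutes {..<n}"
    by (rule bij_imp_permutes) (auto simp: w_def)
  moreover have "xs = map w [0..<n]"
    using len(1) by (intro nth_equalityI) (simp_all add: w_def)
  ultimately show "\<exists>w\<in>{w. w permutes {..<n}}. xs = map w [0..<n]" by blast
qed

lemma sum_permutes_eq_ordered_sum:
  "(\<Sum>w | w permutes {..<n}. (\<Prod>i<n. rvar (w i) ^ e i) *
      (\<Prod>(i, j)\<in>{(i, j). i < j \<and> j < n}.
         (rvar (w i) - rconst t * rvar (w j)) / (rvar (w i) - rvar (w j)))) =
    ordered_sum t e {..<n}"
proof -
  have "ordered_sum t e {..<n} =
      (\<Sum>w\<in>{w. w permutes {..<n}}. ordered_term t e (map w [0..<n]))"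
    unfolding ordered_sum_def
    by (rule sum.reindex_bij_betw[OF bij_betw_permutations_of_set, symmetric])
  also have "\<dots> = (\<Sum>w | w permutes {..<n}. (\<Prod>i<n. rvar (w i) ^ e i) *
      (\<Prod>(i, j)\<in>{(i, j). i < j \<and> j < n}.
         (rvar (w i) - rconst t * rvar (w j)) / (rvar (w i) - rvar (w j))))"
  proof (rule sum.cong)
    fix w assume "w \<in> {w. w permutes {..<n}}"
    then have "distinct (map w [0..<n])"
      using permutes_inj_on[of w "{..<n}" "{..<n}"]
      by (auto simp: distinct_map lessThan_atLeast0)
    from ordered_term_eq[OF this, of t e]
    show "ordered_term t e (map w [0..<n]) = (\<Prod>i<n. rvar (w i) ^ e i) *
      (\<Prod>(i, j)\<in>{(i, j). i < j \<and> j < n}.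
         (rvar (w i) - rconst t * rvar (w j)) / (rvar (w i) - rvar (w j)))"
    proof (rule trans, intro arg_cong2[of _ _ _ _ "(*)"])
      show "(\<Prod>i<length (map w [0..<n]). rvar (map w [0..<n] ! i) ^ e i) =
          (\<Prod>i<n. rvar (w i) ^ e i)"
        by (rule prod.cong) auto
    qed (rule prod.cong, auto)
  qed simp
  finally show ?thesis by simp
qed

section \<open>The Jacobi-Trudi formula\<close>

lemma det_last_row_unit:
  fixes A :: "'a::comm_ring_1 mat"
  assumes A: "A \<in> carrier_mat (Suc n) (Suc n)"
    and row: "\<And>j. j < n \<Longrightarrow> A $$ (n, j) = 0" "A $$ (n, n) = 1"
  shows "det A = det (mat n n (\<lambda>(i, j). A $$ (i, j)))"
proof -
  have "det A = (\<Sum>j<Suc n. A $$ (n, j) * cofactor A n j)"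
    by (rule laplace_expansion_row[OF A]) simp
  also have "\<dots> = cofactor A n n"
    by (simp add: row)
  also have "mat_delete A n n = mat n n (\<lambda>(i, j). A $$ (i, j))"
    using A by (intro eq_matI) (auto simp: mat_delete_def)
  then have "cofactor A n n = det (mat n n (\<lambda>(i, j). A $$ (i, j)))"
    by (simp add: cofactor_def flip: mult_2)
  finally show ?thesis .
qed

text \<open>Truncated subtraction would turn a negative index into h_0 = 1, where the Jacobi-Trudi
  matrix requires 0.\<close>

definition h_diff :: "nat \<Rightarrow> nat \<Rightarrow> Qq symfun" where
  "h_diff m k = (if k \<le> m then complete_h (m - k) else 0)"

definition jacobi_trudi :: "nat list \<Rightarrow> nat \<Rightarrow> Qq symfun" where
  "jacobi_trudi \<mu> n = det (mat n n (\<lambda>(i, j). h_diff (part \<mu> i + j) i))"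

lemma h_diff_simps [simp]: "h_diff k k = 1" "m < k \<Longrightarrow> h_diff m k = 0"
  by (simp_all add: h_diff_def complete_h_eq_qfun)

text \<open>Beyond the length of the partition the part is 0, so the last row is (0, ..., 0, 1) and
  can be deleted.\<close>

lemma jacobi_trudi_stable:
  assumes "n \<ge> length \<mu>"
  shows "jacobi_trudi \<mu> n = jacobi_trudi \<mu> (length \<mu>)"
  using assms
proof (induction n rule: dec_induct)
  case (step n)
  have "part \<mu> n = 0" using step.hyps by (simp add: part_def)
  then have "jacobi_trudi \<mu> (Suc n) = det (mat n n (\<lambda>(i, j).
      mat (Suc n) (Suc n) (\<lambda>(i, j). h_diff (part \<mu> i + j) i) $$ (i, j)))"
    unfolding jacobi_trudi_def by (intro det_last_row_unit) auto
  also have "\<dots> = jacobi_trudi \<mu> n"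
    unfolding jacobi_trudi_def by (intro arg_cong[of _ _ det] eq_matI) auto
  finally show ?case using step.IH by simp
qed simp

lemma comm_ring_hom_ev: "finite A \<Longrightarrow> comm_ring_hom (ev A)"
  by unfold_locales auto

lemma ev_h_diff_insert:
  assumes "finite A" "y \<notin> A"
  shows "ev (insert y A) (h_diff m k) - rvar y * ev (insert y A) (h_diff m (Suc k)) =
    ev A (h_diff m k)"
proof -
  consider "m < k" | "m = k" | r where "m = k + Suc r"
    by (metis less_iff_Suc_add linorder_neqE_nat add_Suc_right)
  then show ?thesis
  proof cases
    case (3 r)
    then show ?thesis
      using ev_qfun_insert[OF assms, of 0 r] by (simp add: h_diff_def complete_h_eq_qfun)
  qed (use assms in auto)
qed

lemma ev_singleton_h: "ev {k} (complete_h p) = rvar k ^ p"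
proof (induction p)
  case (Suc p)
  then show ?case
    using ev_qfun_insert[of "{}" k 0 p] by (simp add: complete_h_eq_qfun)
qed (simp add: complete_h_eq_qfun)

text \<open>The product of 1 - x_i u over \<open>B\<close>, with coefficients (-1)^r e_r. It cancels
  the variables of \<open>B\<close> from the generating function of the h_r.\<close>

definition drop_poly :: "nat set \<Rightarrow> rfun poly" where
  "drop_poly B = (\<Prod>i\<in>B. [:1, - rvar i:])"

lemma degree_drop_poly: "finite B \<Longrightarrow> degree (drop_poly B) \<le> card B"
proof (induction B rule: finite_induct)
  case (insert y B)
  have "drop_poly (insert y B) = [:1, - rvar y:] * drop_poly B"
    unfolding drop_poly_def by (rule prod.insert[OF insert.hyps])
  then have "degree (drop_poly (insert y B)) \<le> degree [:1, - rvar y:] + degree (drop_poly B)"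
    by (metis degree_mult_le)
  with insert show ?case by simp
qed (simp add: drop_poly_def)

text \<open>Comparison of coefficients of u^p in H_(A+B)(u) times the product of 1 - x_i u over
  \<open>B\<close>, which is H_A(u). Any \<open>N\<close> bounding the degree of that product will
  do.\<close>

lemma sum_drop_poly:
  assumes "finite A" "finite B" "A \<inter> B = {}" "card B \<le> N"
  shows "(\<Sum>r\<le>N. coeff (drop_poly B) r * ev (A \<union> B) (h_diff p r)) = ev A (complete_h p)"
  using assms(2,1,3,4)
proof (induction B rule: finite_induct)
  case empty
  have "(\<Sum>r\<le>N. coeff (drop_poly {}) r * ev (A \<union> {}) (h_diff p r)) =
      (\<Sum>r\<le>N. if r = 0 then ev A (h_diff p 0) else 0)"
    by (rule sum.cong) (auto simp: drop_poly_def)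
  then show ?case by (simp add: h_diff_def)
next
  case (insert y B)
  then obtain N' where N: "N = Suc N'" by (cases N) auto
  let ?E = "\<lambda>r. ev (insert y (A \<union> B)) (h_diff p r)"
  let ?c = "coeff (drop_poly B)"
  have top: "?c N = 0"
    using degree_drop_poly[of B] insert.hyps insert.prems by (intro coeff_eq_0) auto
  have "drop_poly (insert y B) = drop_poly B - pCons 0 (smult (rvar y) (drop_poly B))"
    using insert.hyps by (simp add: drop_poly_def)
  then have "(\<Sum>r\<le>N. coeff (drop_poly (insert y B)) r * ?E r) =
      (\<Sum>r\<le>N. ?c r * ?E r) - (\<Sum>r\<le>N. coeff (pCons 0 (smult (rvar y) (drop_poly B))) r * ?E r)"
    by (simp add: sum_subtractf left_diff_distrib)
  also have "(\<Sum>r\<le>N. coeff (pCons 0 (smult (rvar y) (drop_poly B))) r * ?E r) =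
      (\<Sum>r\<le>N'. rvar y * ?c r * ?E (Suc r))"
    unfolding N by (subst sum.atMost_Suc_shift) simp
  also have "\<dots> = (\<Sum>r\<le>N. rvar y * ?c r * ?E (Suc r))"
    using top by (simp add: N)
  also have "(\<Sum>r\<le>N. ?c r * ?E r) - \<dots> = (\<Sum>r\<le>N. ?c r * (?E r - rvar y * ?E (Suc r)))"
    by (simp add: sum_subtractf right_diff_distrib mult_ac)
  also have "\<dots> = (\<Sum>r\<le>N. ?c r * ev (A \<union> B) (h_diff p r))"
    using insert by (intro sum.cong refl) (simp add: ev_h_diff_insert)
  also have "\<dots> = ev A (complete_h p)"
    using insert by (intro insert.IH) auto
  finally show ?case by simp
qed

text \<open>Since x_k^p is h_p in the single variable x_k, deleting all other variables expresses it
  by the h_(p-r) in n variables. Hence the alternant matrix is a matrix free of \<mu> times the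
  transposed Jacobi-Trudi matrix. The constant \<open>c\<close> is identified afterwards from \<mu>
  = \<open>[]\<close>.\<close>

lemma alternant_eq_jacobi_trudi_aux:
  obtains c where "\<And>\<mu>. alternant n (\<lambda>j. part \<mu> j + (n - 1 - j)) = c * ev {..<n} (jacobi_trudi \<mu> n)"
proof
  fix \<mu>
  interpret comm_ring_hom "ev {..<n}" by (rule comm_ring_hom_ev) simp
  define M where "M = mat n n (\<lambda>(k, l). coeff (drop_poly ({..<n} - {k})) (n - 1 - l))"
  define H where "H = mat n n (\<lambda>(i, j). h_diff (part \<mu> i + j) i)"
  have carr: "M \<in> carrier_mat n n" "H \<in> carrier_mat n n" by (auto simp: M_def H_def)
  have "mat n n (\<lambda>(k, j). rvar k ^ (part \<mu> j + (n - 1 - j))) = M * (map_mat (ev {..<n}) H)\<^sup>T"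
  proof (rule eq_matI, goal_cases)
    case (1 k j)
    then have kj: "k < n" "j < n" by (auto simp: H_def M_def)
    let ?p = "part \<mu> j + (n - 1 - j)"
    have "(M * (map_mat (ev {..<n}) H)\<^sup>T) $$ (k, j) =
        (\<Sum>l<n. coeff (drop_poly ({..<n} - {k})) (n - 1 - l) * ev {..<n} (h_diff (part \<mu> j + l) j))"
      using kj by (simp add: M_def H_def scalar_prod_def lessThan_atLeast0)
    also have "\<dots> = (\<Sum>r<n. coeff (drop_poly ({..<n} - {k})) r * ev {..<n} (h_diff ?p r))"
      using kj
      by (intro sum.reindex_bij_witness[where i = "\<lambda>r. n - 1 - r" and j = "\<lambda>l. n - 1 - l"])
        (auto simp: h_diff_def intro!: arg_cong[of _ _ complete_h])
    also have "{..<n} = {..n - 1}" using kj by auto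
    then have "(\<Sum>r<n. coeff (drop_poly ({..<n} - {k})) r * ev {..<n} (h_diff ?p r)) =
        (\<Sum>r\<le>n - 1. coeff (drop_poly ({..<n} - {k})) r * ev ({k} \<union> ({..<n} - {k})) (h_diff ?p r))"
      using kj by (intro sum.cong) (auto simp: insert_absorb)
    also have "\<dots> = rvar k ^ ?p"
      using kj by (subst sum_drop_poly) (auto simp: ev_singleton_h)
    finally show ?case using kj by simp
  qed (auto simp: M_def H_def)
  then have "alternant n (\<lambda>j. part \<mu> j + (n - 1 - j)) = det (M * (map_mat (ev {..<n}) H)\<^sup>T)"
    by (simp add: alternant_def)
  also have "\<dots> = det M * det (map_mat (ev {..<n}) H)"
    using carr by (subst det_mult[of _ n]) (auto simp: det_transpose[of _ n])
  also have "det (map_mat (ev {..<n}) H) = ev {..<n} (jacobi_trudi \<mu> n)"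
    by (simp add: jacobi_trudi_def H_def)
  finally show "alternant n (\<lambda>j. part \<mu> j + (n - 1 - j)) =
      det (mat n n (\<lambda>(k, l). coeff (drop_poly ({..<n} - {k})) (n - 1 - l))) *
      ev {..<n} (jacobi_trudi \<mu> n)"
    by (simp add: M_def)
qed

lemma alternant_eq_jacobi_trudi:
  "alternant n (\<lambda>j. part \<mu> j + (n - 1 - j)) =
     alternant n (\<lambda>j. n - 1 - j) * ev {..<n} (jacobi_trudi \<mu> n)"
proof -
  obtain c where c: "\<And>\<mu>. alternant n (\<lambda>j. part \<mu> j + (n - 1 - j)) =
      c * ev {..<n} (jacobi_trudi \<mu> n)"
    by (rule alternant_eq_jacobi_trudi_aux[of n]) (rule that)
  have "jacobi_trudi [] n = 1"
    using jacobi_trudi_stable[of "[]" n] by (simp add: jacobi_trudi_def)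
  with c[of "[]"] have "alternant n (\<lambda>j. n - 1 - j) = c" by simp
  with c[of \<mu>] show ?thesis by simp
qed

section \<open>Alternating polynomials\<close>

definition mono_of :: "nat \<Rightarrow> (nat \<Rightarrow> nat) \<Rightarrow> monomial" where
  "mono_of n e = (\<Sum>i<n. Poly_Mapping.single i (e i))"

lemma lookup_mono_of: "Poly_Mapping.lookup (mono_of n e) k = (if k < n then e k else 0)"
  by (simp add: mono_of_def lookup_sum lookup_single when_def)

lemma keys_mono_of: "Poly_Mapping.keys (mono_of n e) \<subseteq> {..<n}"
  by (auto simp: in_keys_iff lookup_mono_of split: if_splits)

lemma mono_of_eq_iff: "mono_of n e = mono_of n e' \<longleftrightarrow> (\<forall>i<n. e i = e' i)"
  by (auto simp: poly_mapping_eq_iff lookup_mono_of fun_eq_iff)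

lemma mdeg_mono_of: "mdeg (mono_of n e) = (\<Sum>i<n. e i)"
proof -
  have "mdeg (mono_of n e) = sum (Poly_Mapping.lookup (mono_of n e)) {..<n}"
    by (rule mdeg_superset[OF finite_lessThan keys_mono_of])
  then show ?thesis by (simp add: lookup_mono_of)
qed

lemma mono_of_add: "mono_of n e + mono_of n e' = mono_of n (\<lambda>i. e i + e' i)"
  by (simp add: mono_of_def sum.distrib single_add)

lemma monomial_eq_mono_of:
  "Poly_Mapping.keys m \<subseteq> {..<n} \<Longrightarrow> m = mono_of n (Poly_Mapping.lookup m)"
  by (rule poly_mapping_eqI) (auto simp: lookup_mono_of in_keys_iff)

lemma map_key_mono_of:
  assumes "\<pi> permutes {..<n}"
  shows "Poly_Mapping.map_key \<pi> (mono_of n e) = mono_of n (e \<circ> \<pi>)"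
proof (rule poly_mapping_eqI)
  fix k
  have "inj \<pi>" using assms by (rule permutes_inj)
  moreover have "\<pi> k < n \<longleftrightarrow> k < n" using permutes_in_image[OF assms, of k] by simp
  ultimately show "Poly_Mapping.lookup (Poly_Mapping.map_key \<pi> (mono_of n e)) k =
      Poly_Mapping.lookup (mono_of n (e \<circ> \<pi>)) k"
    by (simp add: map_key.rep_eq lookup_mono_of)
qed

text \<open>A polynomial version of \<open>alternant\<close>: single coefficients have to be read
  off, which the fraction field does not offer.\<close>

definition alt_poly :: "nat \<Rightarrow> (nat \<Rightarrow> nat) \<Rightarrow> monomial \<Rightarrow>\<^sub>0 Qq" where
  "alt_poly n e = (\<Sum>p | p permutes {..<n}. Poly_Mapping.single (mono_of n (e \<circ> p)) (of_int (sign p)))"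

lemma rvar_power: "rvar i ^ k = to_fract (Poly_Mapping.single (Poly_Mapping.single i k) 1)"
proof (induction k)
  case (Suc k)
  have "Poly_Mapping.single (Poly_Mapping.single i (Suc k)) (1::Qq) =
      Poly_Mapping.single (Poly_Mapping.single i 1) 1 * Poly_Mapping.single (Poly_Mapping.single i k) 1"
    by (simp add: mult_single flip: single_add)
  with Suc show ?case by (simp add: rvar_def)
qed simp

lemma prod_rvar_power:
  "(\<Prod>i<n. rvar i ^ e i) = to_fract (Poly_Mapping.single (mono_of n e) 1)"
proof (induction n)
  case (Suc n)
  have "Poly_Mapping.single (mono_of (Suc n) e) (1::Qq) =
      Poly_Mapping.single (mono_of n e) 1 * Poly_Mapping.single (Poly_Mapping.single n (e n)) 1"
    by (simp add: mult_single mono_of_def)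
  with Suc show ?case by (simp add: rvar_power)
qed (simp add: mono_of_def)

lemma to_fract_alt_poly: "to_fract (alt_poly n e) = alternant n e"
proof -
  have "alternant n e = (\<Sum>p | p permutes {0..<n}. signof p * (\<Prod>i=0..<n. rvar i ^ e (p i)))"
    unfolding alternant_def
    by (subst det_def'[OF mat_carrier]) (auto intro!: sum.cong prod.cong dest: permutes_in_image)
  also have "\<dots> = (\<Sum>p | p permutes {..<n}.
      to_fract (Poly_Mapping.single (mono_of n (e \<circ> p)) (of_int (sign p))))"
  proof (intro sum.cong)
    fix p assume "p \<in> {p. p permutes {..<n}}"
    have "(\<Prod>i=0..<n. rvar i ^ e (p i)) = to_fract (Poly_Mapping.single (mono_of n (e \<circ> p)) 1)"
      using prod_rvar_power[of "e \<circ> p" n] by (simp add: lessThan_atLeast0)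
    then show "signof p * (\<Prod>i=0..<n. rvar i ^ e (p i)) =
        to_fract (Poly_Mapping.single (mono_of n (e \<circ> p)) (of_int (sign p)))"
      by (simp add: sign_def single_uminus)
  qed (simp add: lessThan_atLeast0)
  finally show ?thesis by (simp add: alt_poly_def)
qed

lemma lookup_const_mult [simp]:
  fixes F :: "monomial \<Rightarrow>\<^sub>0 'a::comm_ring_1"
  shows "Poly_Mapping.lookup (Poly_Mapping.single 0 c * F) m = c * Poly_Mapping.lookup F m"
  using lookup_single_mult[of 0 c F m] by simp

lemma lookup_alt_poly:
  "Poly_Mapping.lookup (alt_poly n e) m =
    (\<Sum>p | p permutes {..<n}. if mono_of n (e \<circ> p) = m then of_int (sign p) else 0)"
  unfolding alt_poly_def lookup_sum
  by (rule sum.cong) (auto simp: lookup_single when_def)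

lemma permutes_increasing_imp_id:
  assumes p: "p permutes {..<n :: nat}" and inc: "\<And>i j. i < j \<Longrightarrow> j < n \<Longrightarrow> p i < p j"
  shows "p = id"
proof -
  have "sorted_wrt (<) (map p [0..<n])"
    using inc by (simp add: sorted_wrt_iff_nth_less)
  moreover have "set (map p [0..<n]) = set [0..<n]"
    using permutes_image[OF p] by (simp add: lessThan_atLeast0)
  ultimately have eq: "map p [0..<n] = [0..<n]"
    by (intro strict_sorted_equal) (simp_all add: sorted_wrt_upt)
  have "p i = i" for i
  proof (cases "i < n")
    case True
    then show ?thesis using arg_cong[OF eq, of "\<lambda>xs. xs ! i"] by simp
  qed (use p in \<open>simp add: permutes_def\<close>)
  then show ?thesis by auto
qed

text \<open>A permutation carrying one strictly decreasing exponent sequence to another must be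
  increasing, hence the identity.\<close>

lemma lookup_alt_poly_strict:
  assumes e: "\<And>i j. i < j \<Longrightarrow> j < n \<Longrightarrow> e j < e i"
    and e': "\<And>i j. i < j \<Longrightarrow> j < n \<Longrightarrow> e' j < e' i"
  shows "Poly_Mapping.lookup (alt_poly n e) (mono_of n e') = (if \<forall>i<n. e i = e' i then 1 else 0)"
proof -
  have *: "p = id \<and> (\<forall>i<n. e i = e' i)"
    if p: "p permutes {..<n}" and eq: "mono_of n (e \<circ> p) = mono_of n e'" for p
  proof -
    have eq': "e (p i) = e' i" if "i < n" for i
      using eq that by (simp add: mono_of_eq_iff)
    have lt: "p i < n" if "i < n" for i
      using permutes_in_image[OF p, of i] that by simp
    have "p i < p j" if "i < j" "j < n" for i j
    proof (rule ccontr)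
      assume "\<not> p i < p j"
      then have "e (p i) \<le> e (p j)"
        using e[of "p j" "p i"] lt[of i] that by (cases "p i = p j") auto
      then show False using e'[OF that] eq' that by simp
    qed
    then have "p = id" by (rule permutes_increasing_imp_id[OF p])
    with eq' show ?thesis by simp
  qed
  have "Poly_Mapping.lookup (alt_poly n e) (mono_of n e') =
      (\<Sum>p | p permutes {..<n}. if p = id then (if \<forall>i<n. e i = e' i then 1 else 0) else 0)"
    unfolding lookup_alt_poly
  proof (rule sum.cong)
    fix p assume "p \<in> {p. p permutes {..<n}}"
    then show "(if mono_of n (e \<circ> p) = mono_of n e' then of_int (sign p) else (0 :: Qq)) =
        (if p = id then (if \<forall>i<n. e i = e' i then 1 else 0) else 0)"
      using *[of p] by (cases "p = id") (auto simp: mono_of_eq_iff)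
  qed simp
  also have "\<dots> = (if \<forall>i<n. e i = e' i then 1 else 0)"
    by (simp add: finite_permutations permutes_id)
  finally show ?thesis .
qed

definition alternating :: "nat \<Rightarrow> (monomial \<Rightarrow>\<^sub>0 Qq) \<Rightarrow> bool" where
  "alternating n F \<longleftrightarrow> (\<forall>\<pi> m. \<pi> permutes {..<n} \<longrightarrow>
     Poly_Mapping.lookup F (Poly_Mapping.map_key \<pi> m) = of_int (sign \<pi>) * Poly_Mapping.lookup F m)"

lemma map_key_inverse:
  fixes m :: monomial
  assumes "\<pi> permutes S"
  shows "Poly_Mapping.map_key \<pi> (Poly_Mapping.map_key (inv_into UNIV \<pi>) m) = m"
    "Poly_Mapping.map_key (inv_into UNIV \<pi>) (Poly_Mapping.map_key \<pi> m) = m"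
proof -
  have "inj \<pi>" "inj (inv_into UNIV \<pi>)"
    using assms permutes_inv permutes_inj by blast+
  then show "Poly_Mapping.map_key \<pi> (Poly_Mapping.map_key (inv_into UNIV \<pi>) m) = m"
    "Poly_Mapping.map_key (inv_into UNIV \<pi>) (Poly_Mapping.map_key \<pi> m) = m"
    using permutes_inverses[OF assms]
    by (auto intro!: poly_mapping_eqI simp: map_key.rep_eq)
qed

lemma map_key_eq_iff:
  fixes m m' :: monomial
  assumes "\<pi> permutes S"
  shows "Poly_Mapping.map_key \<pi> m = Poly_Mapping.map_key \<pi> m' \<longleftrightarrow> m = m'"
  by (metis map_key_inverse(2)[OF assms])

lemma alternating_alt_poly: "alternating n (alt_poly n e)"
  unfolding alternating_def
proof (intro allI impI)
  fix \<pi> and m :: monomial assume \<pi>: "\<pi> permutes {..<n}"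
  have "Poly_Mapping.lookup (alt_poly n e) (Poly_Mapping.map_key \<pi> m) =
      (\<Sum>p | p permutes {..<n}. if mono_of n (e \<circ> (p \<circ> \<pi>)) = Poly_Mapping.map_key \<pi> m
         then of_int (sign (p \<circ> \<pi>)) else 0)"
    unfolding lookup_alt_poly by (rule sum_permutations_compose_right[OF \<pi>])
  also have "\<dots> = (\<Sum>p | p permutes {..<n}.
      of_int (sign \<pi>) * (if mono_of n (e \<circ> p) = m then of_int (sign p) else 0))"
  proof (rule sum.cong)
    fix p assume "p \<in> {p. p permutes {..<n}}"
    then have "sign (p \<circ> \<pi>) = sign p * sign \<pi>"
      using \<pi> by (intro sign_compose permutes_imp_permutation[of "{..<n}"]) auto
    moreover have "mono_of n (e \<circ> (p \<circ> \<pi>)) = Poly_Mapping.map_key \<pi> (mono_of n (e \<circ> p))"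
      unfolding map_key_mono_of[OF \<pi>] by (simp only: comp_assoc)
    then have "mono_of n (e \<circ> (p \<circ> \<pi>)) = Poly_Mapping.map_key \<pi> m \<longleftrightarrow> mono_of n (e \<circ> p) = m"
      by (simp only: map_key_eq_iff[OF \<pi>])
    ultimately show "(if mono_of n (e \<circ> (p \<circ> \<pi>)) = Poly_Mapping.map_key \<pi> m
         then of_int (sign (p \<circ> \<pi>)) else 0) =
        of_int (sign \<pi>) * (if mono_of n (e \<circ> p) = m then of_int (sign p) else (0 :: Qq))"
      by simp
  qed simp
  also have "\<dots> = of_int (sign \<pi>) * Poly_Mapping.lookup (alt_poly n e) m"
    unfolding lookup_alt_poly sum_distrib_left ..
  finally show "Poly_Mapping.lookup (alt_poly n e) (Poly_Mapping.map_key \<pi> m) =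
      of_int (sign \<pi>) * Poly_Mapping.lookup (alt_poly n e) m" .
qed

lemma lookup_restrict_map_key:
  assumes \<pi>: "\<pi> permutes {..<n}"
  shows "Poly_Mapping.lookup (restrict_to {..<n} f) (Poly_Mapping.map_key \<pi> m) =
    Poly_Mapping.lookup (restrict_to {..<n} f) m"
proof -
  have inj: "inj \<pi>" using \<pi> by (rule permutes_inj)
  have "\<pi> -` Poly_Mapping.keys m \<subseteq> {..<n} \<longleftrightarrow> Poly_Mapping.keys m \<subseteq> {..<n}"
    using permutes_in_image[OF \<pi>] permutes_inverses(1)[OF \<pi>]
    by (auto simp: subset_iff vimage_def) (metis lessThan_iff)
  moreover have "coefficient f (Poly_Mapping.map_key \<pi> m) = coefficient f m"
    using coefficient[of f] permutes_bij[OF \<pi>] by (auto simp: permutation_invariant_def)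
  ultimately show ?thesis
    by (simp add: restrict_to.rep_eq keys_map_key[OF inj])
qed

lemma alternating_mult:
  assumes "alternating n F"
  shows "alternating n (restrict_to {..<n} f * F)"
  unfolding alternating_def
proof (intro allI impI)
  fix \<pi> and m :: monomial assume \<pi>: "\<pi> permutes {..<n}"
  let ?k = "Poly_Mapping.map_key \<pi>" and ?k' = "Poly_Mapping.map_key (inv_into UNIV \<pi>)"
  let ?f = "Poly_Mapping.lookup (restrict_to {..<n} f)"
  have inj: "inj \<pi>" "inj (inv_into UNIV \<pi>)" using \<pi> permutes_inv permutes_inj by blast+
  have "Poly_Mapping.lookup (restrict_to {..<n} f * F) (?k m) =
      (\<Sum>(a, b)\<in>{(a, b). a + b = m}. of_int (sign \<pi>) * (?f a * Poly_Mapping.lookup F b))"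
    unfolding lookup_mult_monomials
  proof (rule sum.reindex_bij_witness[where i = "map_prod ?k ?k" and j = "map_prod ?k' ?k'"])
    fix ab assume "ab \<in> {(a, b). a + b = ?k m}"
    then show "map_prod ?k' ?k' ab \<in> {(a, b). a + b = m}"
      by (auto simp: map_key_plus[OF inj(2), symmetric] map_key_inverse[OF \<pi>])
  next
    fix ab assume "ab \<in> {(a, b). a + b = m}"
    then show "map_prod ?k ?k ab \<in> {(a, b). a + b = ?k m}"
      by (auto simp: map_key_plus[OF inj(1), symmetric])
  next
    fix ab :: "monomial \<times> monomial"
    have "?f (?k a) = ?f a" "Poly_Mapping.lookup F (?k b) = of_int (sign \<pi>) * Poly_Mapping.lookup F b"
      for a b
      using lookup_restrict_map_key[OF \<pi>] assms \<pi> by (auto simp: alternating_def)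
    from this(1)[of "?k' (fst ab)"] this(2)[of "?k' (snd ab)"]
    show "(case map_prod ?k' ?k' ab of (a, b) \<Rightarrow>
        of_int (sign \<pi>) * (?f a * Poly_Mapping.lookup F b)) =
        (case ab of (a, b) \<Rightarrow> ?f a * Poly_Mapping.lookup F b)"
      by (simp add: case_prod_beta map_key_inverse[OF \<pi>])
  qed (auto simp: map_key_inverse[OF \<pi>])
  also have "\<dots> = of_int (sign \<pi>) * Poly_Mapping.lookup (restrict_to {..<n} f * F) m"
    unfolding lookup_mult_monomials sum_distrib_left by (rule sum.cong) auto
  finally show "Poly_Mapping.lookup (restrict_to {..<n} f * F) (?k m) =
      of_int (sign \<pi>) * Poly_Mapping.lookup (restrict_to {..<n} f * F) m" .
qed

lemma eq_minus_imp_0: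
  fixes x :: Qq
  assumes "x = - x"
  shows "x = 0"
proof -
  have "2 * x = 0" using assms by (simp add: mult_2 eq_neg_iff_add_eq_0)
  moreover have "(2 :: Qq) \<noteq> 0"
  proof
    assume "(2 :: Qq) = 0"
    then have "to_fract (1 + 1 :: rat poly) = 0" unfolding to_fract_add by simp
    then show False by simp
  qed
  ultimately show ?thesis by simp
qed

text \<open>Transposing two variables with equal exponents fixes the monomial but reverses the
  sign.\<close>

lemma alternating_repeated:
  assumes "alternating n F" "\<not> inj_on (Poly_Mapping.lookup m) {..<n}"
  shows "Poly_Mapping.lookup F m = 0"
proof -
  from assms(2) obtain i j where ij: "i < n" "j < n" "i \<noteq> j"
    "Poly_Mapping.lookup m i = Poly_Mapping.lookup m j"
    by (auto simp: inj_on_def)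
  let ?\<tau> = "transpose i j"
  have \<tau>: "?\<tau> permutes {..<n}" using ij by (intro permutes_swap_id) auto
  have "Poly_Mapping.map_key ?\<tau> m = m"
    using ij permutes_inj[OF \<tau>]
    by (intro poly_mapping_eqI) (auto simp: map_key.rep_eq transpose_def)
  then have "Poly_Mapping.lookup F m = of_int (sign ?\<tau>) * Poly_Mapping.lookup F m"
    using assms(1) \<tau> unfolding alternating_def by metis
  then show ?thesis using ij by (intro eq_minus_imp_0) (simp add: sign_swap_id)
qed

lemma monomial_sort:
  assumes "Poly_Mapping.keys m \<subseteq> {..<n}" "inj_on (Poly_Mapping.lookup m) {..<n}"
  obtains \<pi> e where "\<pi> permutes {..<n}" "Poly_Mapping.map_key \<pi> m = mono_of n e"
    "\<And>i j. i < j \<Longrightarrow> j < n \<Longrightarrow> e j < e i"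
proof -
  let ?v = "Poly_Mapping.lookup m"
  define l where "l = rev (sort_key ?v [0..<n])"
  have l: "length l = n" "distinct l" "set l = {..<n}"
    by (auto simp: l_def)
  then have "l \<in> permutations_of_set {..<n}" by auto
  then obtain \<pi> where \<pi>: "\<pi> permutes {..<n}" "l = map \<pi> [0..<n]"
    using bij_betw_permutations_of_set[of n] unfolding bij_betw_def by auto
  have "sorted_wrt (\<lambda>x y. ?v y \<le> ?v x) l"
    unfolding l_def sorted_wrt_rev using sorted_sort_key[of ?v "[0..<n]"]
    unfolding sorted_map by simp
  then have le: "?v (\<pi> j) \<le> ?v (\<pi> i)" if "i < j" "j < n" for i j
    using that unfolding sorted_wrt_iff_nth_less \<pi>(2) by simp
  have "?v (\<pi> j) < ?v (\<pi> i)" if ij: "i < j" "j < n" for i j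
  proof -
    have "\<pi> i \<noteq> \<pi> j" using permutes_inj[OF \<pi>(1)] ij by (auto dest: injD)
    moreover have "\<pi> i < n" "\<pi> j < n"
      using permutes_in_image[OF \<pi>(1)] ij by auto
    ultimately have "?v (\<pi> j) \<noteq> ?v (\<pi> i)"
      using assms(2) by (auto dest: inj_onD)
    with le[OF ij] show ?thesis by simp
  qed
  moreover have "Poly_Mapping.map_key \<pi> m = mono_of n (?v \<circ> \<pi>)"
    using monomial_eq_mono_of[OF assms(1)] map_key_mono_of[OF \<pi>(1), of ?v] by simp
  ultimately show ?thesis using \<pi>(1) by (intro that) auto
qed

section \<open>Strictly decreasing exponents and partitions\<close>

lemma length_le_sum_list: "0 \<notin> set xs \<Longrightarrow> length xs \<le> sum_list (xs :: nat list)"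
  by (induction xs) auto

lemma partition_facts:
  assumes "\<mu> \<in> partitions d"
  shows "length \<mu> \<le> d" "\<And>n. length \<mu> \<le> n \<Longrightarrow> (\<Sum>i<n. part \<mu> i) = d"
    "\<And>i j. i \<le> j \<Longrightarrow> part \<mu> j \<le> part \<mu> i"
    "\<And>i j n. i < j \<Longrightarrow> j < n \<Longrightarrow> part \<mu> j + (n - 1 - j) < part \<mu> i + (n - 1 - i)"
proof -
  have \<mu>: "sorted_wrt (\<ge>) \<mu>" "0 \<notin> set \<mu>" "sum_list \<mu> = d"
    using assms by (auto simp: partitions_def)
  from \<mu> length_le_sum_list show "length \<mu> \<le> d" by blast
  show "(\<Sum>i<n. part \<mu> i) = d" if "length \<mu> \<le> n" for n
  proof -
    have "(\<Sum>i<n. part \<mu> i) = (\<Sum>i<length \<mu>. part \<mu> i)"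
      using that by (intro sum.mono_neutral_right) (auto simp: part_def)
    also have "\<dots> = d"
      using \<mu>(3) by (simp add: part_def sum_list_sum_nth lessThan_atLeast0)
    finally show ?thesis .
  qed
  show mono: "part \<mu> j \<le> part \<mu> i" if "i \<le> j" for i j
    using that \<mu>(1) by (cases "i = j") (auto simp: part_def sorted_wrt_iff_nth_less)
  show "part \<mu> j + (n - 1 - j) < part \<mu> i + (n - 1 - i)" if "i < j" "j < n" for i j n
    using mono[of i j] that by linarith
qed

lemma partition_eqI:
  assumes "0 \<notin> set \<mu>" "0 \<notin> set \<nu>" "length \<mu> \<le> n" "length \<nu> \<le> n" "\<And>i. i < n \<Longrightarrow> part \<mu> i = part \<nu> i"
  shows "\<mu> = \<nu>"
proof -
  have pos: "part \<kappa> i \<noteq> 0 \<longleftrightarrow> i < length \<kappa>" if "0 \<notin> set \<kappa>" for \<kappa> i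
    using that by (metis nth_mem part_def)
  have "i < length \<mu> \<longleftrightarrow> i < length \<nu>" for i
  proof (cases "i < n")
    case True
    then show ?thesis using pos[of \<mu> i] pos[of \<nu> i] assms by simp
  qed (use assms in auto)
  then have len: "length \<mu> = length \<nu>" by (metis less_irrefl linorder_neqE_nat)
  show ?thesis
  proof (rule nth_equalityI[OF len])
    fix i assume "i < length \<mu>"
    with len assms(3) assms(5)[of i] show "\<mu> ! i = \<nu> ! i" by (simp add: part_def)
  qed
qed

lemma strict_eq_partition:
  assumes e: "\<And>i j. i < j \<Longrightarrow> j < n \<Longrightarrow> e j < e i" and deg: "(\<Sum>i<n. e i) = d + (\<Sum>i<n. n - 1 - i)"
  shows "\<exists>\<mu>\<in>partitions d. \<forall>i<n. e i = part \<mu> i + (n - 1 - i)"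
proof -
  have ge: "n - 1 - i \<le> e i" if "i < n" for i
    using that
  proof (induction "n - 1 - i" arbitrary: i)
    case (Suc k)
    then have "k \<le> e (Suc i)" by (metis Suc_diff_Suc Suc_lessI diff_Suc_1 diff_diff_left plus_1_eq_Suc
      nat.distinct(1) diff_self_eq_0 add.commute nat.inject zero_less_Suc zero_less_diff less_diff_conv)
    with e[of i "Suc i"] Suc show ?case by linarith
  qed simp
  define g where "g i = e i - (n - 1 - i)" for i
  have eg: "e i = g i + (n - 1 - i)" if "i < n" for i
    using ge[OF that] by (simp add: g_def)
  have step: "g (Suc i) \<le> g i" if "Suc i < n" for i
    using e[of i "Suc i"] that by (simp add: g_def)
  have g: "g j \<le> g i" if "i \<le> j" "j < n" for i j
    using that(1,2)
  proof (induction j rule: dec_induct)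
    case (step j)
    then show ?case using \<open>\<And>i. Suc i < n \<Longrightarrow> g (Suc i) \<le> g i\<close>[of j] by simp
  qed simp
  \<comment> \<open>The first index at which the exponent equals the staircase entry; from there on
    the difference is 0, so \<open>k\<close> is the length of the partition.\<close>
  define k where "k = (LEAST i. i = n \<or> g i = 0)"
  have k: "k = n \<or> g k = 0" unfolding k_def by (rule LeastI[of _ n]) simp
  have kn: "k \<le> n" unfolding k_def by (rule Least_le) simp
  have pos: "g i \<noteq> 0" if "i < k" for i
    using not_less_Least[of i "\<lambda>i. i = n \<or> g i = 0"] that unfolding k_def by blast
  have zero: "g i = 0" if "k \<le> i" "i < n" for i
    using g[OF that] k that by auto
  define \<mu> where "\<mu> = map g [0..<k]"
  have part: "part \<mu> i = g i" if "i < n" for i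
    using zero that by (auto simp: part_def \<mu>_def)
  have "sorted_wrt (\<ge>) \<mu>" using g kn by (auto simp: \<mu>_def sorted_wrt_iff_nth_less)
  moreover have "0 \<notin> set \<mu>" using pos by (force simp: \<mu>_def)
  moreover have "sum_list \<mu> = d"
  proof -
    have "sum_list \<mu> = (\<Sum>i<k. g i)" by (simp add: \<mu>_def sum_list_sum_nth lessThan_atLeast0)
    also have "\<dots> = (\<Sum>i<n. g i)"
      using kn zero by (intro sum.mono_neutral_left) auto
    finally have sum: "sum_list \<mu> = (\<Sum>i<n. g i)" .
    have "sum_list \<mu> + (\<Sum>i<n. n - 1 - i) = (\<Sum>i<n. e i)"
      unfolding sum sum.distrib[symmetric] by (intro sum.cong) (use eg in auto)
    with deg show ?thesis by simp
  qed
  ultimately have "\<mu> \<in> partitions d" by (simp add: partitions_def)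
  then show ?thesis using eg part by (intro bexI[of _ \<mu>]) auto
qed

text \<open>Repeated exponents give coefficient 0, and distinct ones can be sorted into \<mu> +
  \<delta> up to sign. The bound d \<le> n ensures that partitions of d are told apart by their
  first n parts.\<close>

lemma alternating_expansion:
  assumes alt: "alternating n F" and "d \<le> n"
    and supp: "\<And>m. Poly_Mapping.lookup F m \<noteq> 0 \<Longrightarrow>
      Poly_Mapping.keys m \<subseteq> {..<n} \<and> mdeg m = d + (\<Sum>i<n. n - 1 - i)"
  shows "F = (\<Sum>\<mu>\<in>partitions d.
    Poly_Mapping.single 0 (Poly_Mapping.lookup F (mono_of n (\<lambda>i. part \<mu> i + (n - 1 - i)))) *
    alt_poly n (\<lambda>i. part \<mu> i + (n - 1 - i)))"
proof (rule poly_mapping_eqI)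
  fix m
  define E where "E \<mu> = (\<lambda>i. part \<mu> i + (n - 1 - i))" for \<mu>
  define c where "c \<mu> = Poly_Mapping.lookup F (mono_of n (E \<mu>))" for \<mu>
  define R where "R m = (\<Sum>\<mu>\<in>partitions d. c \<mu> * Poly_Mapping.lookup (alt_poly n (E \<mu>)) m)" for m
  have "Poly_Mapping.lookup (\<Sum>\<mu>\<in>partitions d. Poly_Mapping.single 0 (c \<mu>) * alt_poly n (E \<mu>)) m = R m"
    by (simp add: lookup_sum R_def)
  moreover have "Poly_Mapping.lookup F m = R m"
  proof (cases "Poly_Mapping.keys m \<subseteq> {..<n}")
    case False
    then have "Poly_Mapping.lookup F m = 0" using supp by blast
    moreover have "Poly_Mapping.lookup (alt_poly n e) m = 0" for e
      unfolding lookup_alt_poly using False keys_mono_of by (intro sum.neutral) auto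
    ultimately show ?thesis by (simp add: R_def)
  next
    case keys: True
    show ?thesis
    proof (cases "inj_on (Poly_Mapping.lookup m) {..<n}")
      case False
      then show ?thesis
        using alternating_repeated[OF alt] alternating_repeated[OF alternating_alt_poly]
        by (simp add: R_def)
    next
      case True
      obtain \<pi> e where \<pi>: "\<pi> permutes {..<n}" and m: "Poly_Mapping.map_key \<pi> m = mono_of n e"
        and e: "\<And>i j. i < j \<Longrightarrow> j < n \<Longrightarrow> e j < e i"
        using monomial_sort[OF keys True] by blast
      have flip: "Poly_Mapping.lookup A m = of_int (sign \<pi>) * Poly_Mapping.lookup A (mono_of n e)"
        if "alternating n A" for A
      proof -
        have "Poly_Mapping.lookup A (mono_of n e) = of_int (sign \<pi>) * Poly_Mapping.lookup A m"
          using that \<pi> unfolding alternating_def m[symmetric] by blast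
        then show ?thesis by (simp add: sign_def)
      qed
      have "Poly_Mapping.lookup F (mono_of n e) = R (mono_of n e)"
      proof (cases "\<exists>\<mu>\<in>partitions d. \<forall>i<n. e i = E \<mu> i")
        case True
        then obtain \<mu> where \<mu>: "\<mu> \<in> partitions d" "\<And>i. i < n \<Longrightarrow> e i = E \<mu> i" by blast
        have "R (mono_of n e) = (\<Sum>\<kappa>\<in>partitions d. if \<kappa> = \<mu> then c \<mu> else 0)"
          unfolding R_def
        proof (rule sum.cong)
          fix \<kappa> assume \<kappa>: "\<kappa> \<in> partitions d"
          have "(\<forall>i<n. E \<kappa> i = e i) \<longleftrightarrow> \<kappa> = \<mu>"
          proof
            assume "\<forall>i<n. E \<kappa> i = e i"
            then have "part \<kappa> i = part \<mu> i" if "i < n" for i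
              using \<mu>(2)[OF that] that unfolding E_def by (metis add_right_cancel)
            then show "\<kappa> = \<mu>"
              using \<kappa> \<mu>(1) partition_facts(1)[OF \<kappa>] partition_facts(1)[OF \<mu>(1)] \<open>d \<le> n\<close>
              by (intro partition_eqI[of _ _ n]) (auto simp: partitions_def)
          qed (use \<mu> in simp)
          moreover have "Poly_Mapping.lookup (alt_poly n (E \<kappa>)) (mono_of n e) =
              (if \<forall>i<n. E \<kappa> i = e i then 1 else 0)"
            using partition_facts(4)[OF \<kappa>] e by (intro lookup_alt_poly_strict) (simp_all add: E_def)
          ultimately show "c \<kappa> * Poly_Mapping.lookup (alt_poly n (E \<kappa>)) (mono_of n e) =
              (if \<kappa> = \<mu> then c \<mu> else 0)" by simp
        qed simp
        also have "\<dots> = c \<mu>" using \<mu>(1) by (simp add: finite_partitions)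
        also have "mono_of n e = mono_of n (E \<mu>)" using \<mu>(2) by (simp add: mono_of_eq_iff)
        then have "c \<mu> = Poly_Mapping.lookup F (mono_of n e)" by (simp add: c_def)
        finally show ?thesis by simp
      next
        case False
        have "Poly_Mapping.lookup F (mono_of n e) = 0"
        proof (rule ccontr)
          assume "Poly_Mapping.lookup F (mono_of n e) \<noteq> 0"
          then have "(\<Sum>i<n. e i) = d + (\<Sum>i<n. n - 1 - i)"
            using supp mdeg_mono_of by metis
          from strict_eq_partition[OF e this] False show False
            unfolding E_def by blast
        qed
        moreover have "R (mono_of n e) = 0"
          unfolding R_def
        proof (rule sum.neutral, rule ballI)
          fix \<kappa> assume \<kappa>: "\<kappa> \<in> partitions d"
          have "Poly_Mapping.lookup (alt_poly n (E \<kappa>)) (mono_of n e) =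
              (if \<forall>i<n. E \<kappa> i = e i then 1 else 0)"
            using partition_facts(4)[OF \<kappa>] e by (intro lookup_alt_poly_strict) (simp_all add: E_def)
          moreover have "\<not> (\<forall>i<n. E \<kappa> i = e i)"
          proof
            assume "\<forall>i<n. E \<kappa> i = e i"
            then have "\<forall>i<n. e i = E \<kappa> i" by simp
            with False \<kappa> show False by blast
          qed
          ultimately show "c \<kappa> * Poly_Mapping.lookup (alt_poly n (E \<kappa>)) (mono_of n e) = 0" by simp
        qed
        ultimately show ?thesis by simp
      qed
      then show ?thesis
        using flip[OF alt] flip[OF alternating_alt_poly]
        by (simp add: R_def sum_distrib_left mult_ac)
    qed
  qed
  ultimately show "Poly_Mapping.lookup F m = Poly_Mapping.lookup (\<Sum>\<mu>\<in>partitions d.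
    Poly_Mapping.single 0 (Poly_Mapping.lookup F (mono_of n (\<lambda>i. part \<mu> i + (n - 1 - i)))) *
    alt_poly n (\<lambda>i. part \<mu> i + (n - 1 - i))) m"
    by (simp add: c_def E_def)
qed

lemma alternant_delta_nonzero: "alternant n (\<lambda>j. n - 1 - j) \<noteq> 0"
proof
  assume "alternant n (\<lambda>j. n - 1 - j) = 0"
  then have "alt_poly n (\<lambda>j. n - 1 - j) = 0" by (simp flip: to_fract_alt_poly)
  moreover have "Poly_Mapping.lookup (alt_poly n (\<lambda>j. n - 1 - j)) (mono_of n (\<lambda>j. n - 1 - j)) = 1"
    by (subst lookup_alt_poly_strict) auto
  ultimately show False by simp
qed

lemma schur_eq_jacobi_trudi:
  assumes "length \<mu> \<le> n"
  shows "schur \<mu> = jacobi_trudi \<mu> n"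
proof -
  have "schur \<mu> = jacobi_trudi \<mu> (length \<mu>)"
    unfolding schur_def
  proof (rule stable_symfun_eqI)
    fix n assume n: "length \<mu> \<le> n"
    show "ev {..<n} (jacobi_trudi \<mu> (length \<mu>)) = schur_vars \<mu> n"
      unfolding schur_vars_def alternant_eq_jacobi_trudi jacobi_trudi_stable[OF n, symmetric]
      by (rule nonzero_mult_div_cancel_left[OF alternant_delta_nonzero, symmetric])
  qed
  then show ?thesis by (simp only: jacobi_trudi_stable[OF assms])
qed

lemma alternant_eq_schur:
  assumes "length \<mu> \<le> n"
  shows "alternant n (\<lambda>j. part \<mu> j + (n - 1 - j)) =
     alternant n (\<lambda>j. n - 1 - j) * ev {..<n} (schur \<mu>)"
  using alternant_eq_jacobi_trudi schur_eq_jacobi_trudi[OF assms] by simp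

section \<open>Schur coefficients of homogeneous functions\<close>

definition homogeneous :: "nat \<Rightarrow> Qq symfun \<Rightarrow> bool" where
  "homogeneous d f \<longleftrightarrow> (\<forall>m. coefficient f m \<noteq> 0 \<longrightarrow> mdeg m = d)"

text \<open>Multiplication by a_\<delta> turns s_\<mu> into a_(\<mu>+\<delta>), in which
  x^(\<mu>+\<delta>) is the only monomial with strictly decreasing exponents. Its coefficient
  therefore isolates s_\<mu>.\<close>

definition schur_coeff :: "nat \<Rightarrow> Qq symfun \<Rightarrow> nat list \<Rightarrow> Qq" where
  "schur_coeff n f \<mu> = Poly_Mapping.lookup (restrict_to {..<n} f * alt_poly n (\<lambda>j. n - 1 - j))
     (mono_of n (\<lambda>i. part \<mu> i + (n - 1 - i)))"

lemma schur_expansion: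
  assumes "homogeneous d f" "d \<le> n"
  shows "ev {..<n} f = (\<Sum>\<mu>\<in>partitions d. rconst (schur_coeff n f \<mu>) * ev {..<n} (schur \<mu>))"
proof -
  let ?\<delta> = "\<lambda>j. n - 1 - j"
  let ?F = "restrict_to {..<n} f * alt_poly n ?\<delta>"
  have supp: "Poly_Mapping.keys m \<subseteq> {..<n} \<and> mdeg m = d + (\<Sum>i<n. ?\<delta> i)"
    if nz: "Poly_Mapping.lookup ?F m \<noteq> 0" for m
  proof -
    obtain x where x: "x \<in> {(a, b). a + b = m}" "(case x of (a, b) \<Rightarrow>
        Poly_Mapping.lookup (restrict_to {..<n} f) a * Poly_Mapping.lookup (alt_poly n ?\<delta>) b) \<noteq> 0"
      using sum.not_neutral_contains_not_neutral[OF nz[unfolded lookup_mult_monomials]] .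
    obtain a b where xab: "x = (a, b)" by (cases x)
    have ab: "a + b = m" "Poly_Mapping.lookup (restrict_to {..<n} f) a \<noteq> 0"
      "Poly_Mapping.lookup (alt_poly n ?\<delta>) b \<noteq> 0"
      using x unfolding xab by (simp, metis case_prod_conv mult_zero_left, metis case_prod_conv mult_zero_right)
    obtain p where p: "p \<in> {p. p permutes {..<n}}"
      "(if mono_of n (?\<delta> \<circ> p) = b then of_int (sign p) else 0 :: Qq) \<noteq> 0"
      using sum.not_neutral_contains_not_neutral[OF ab(3)[unfolded lookup_alt_poly]] .
    then have p: "p permutes {..<n}" "b = mono_of n (?\<delta> \<circ> p)"
      by (simp, metis (no_types))
    have "mdeg b = (\<Sum>i<n. ?\<delta> i)"
      unfolding p(2) mdeg_mono_of comp_def by (rule sum.permute[OF p(1), symmetric, unfolded comp_def])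
    moreover have "Poly_Mapping.keys b \<subseteq> {..<n}" unfolding p(2) by (rule keys_mono_of)
    moreover have "Poly_Mapping.keys a \<subseteq> {..<n}" "mdeg a = d"
      using ab(2) assms(1) by (auto simp: restrict_to.rep_eq homogeneous_def split: if_splits)
    ultimately show ?thesis by (auto simp: ab(1)[symmetric] keys_add_nat mdeg_add)
  qed
  have "alternating n ?F" by (intro alternating_mult alternating_alt_poly)
  then have "?F = (\<Sum>\<mu>\<in>partitions d. Poly_Mapping.single 0 (schur_coeff n f \<mu>) *
      alt_poly n (\<lambda>i. part \<mu> i + (n - 1 - i)))"
    unfolding schur_coeff_def by (rule alternating_expansion[OF _ assms(2) supp])
  from arg_cong[OF this, of to_fract]
  have "ev {..<n} f * alternant n ?\<delta> = (\<Sum>\<mu>\<in>partitions d. rconst (schur_coeff n f \<mu>) *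
      alternant n (\<lambda>i. part \<mu> i + (n - 1 - i)))"
    by (simp add: ev_def rconst_def to_fract_alt_poly)
  also have "\<dots> = (\<Sum>\<mu>\<in>partitions d. rconst (schur_coeff n f \<mu>) * ev {..<n} (schur \<mu>)) *
      alternant n ?\<delta>"
    unfolding sum_distrib_right
  proof (rule sum.cong)
    fix \<mu> assume "\<mu> \<in> partitions d"
    then have "length \<mu> \<le> n" using partition_facts(1) assms(2) le_trans by blast
    from alternant_eq_schur[OF this]
    show "rconst (schur_coeff n f \<mu>) * alternant n (\<lambda>i. part \<mu> i + (n - 1 - i)) =
        rconst (schur_coeff n f \<mu>) * ev {..<n} (schur \<mu>) * alternant n ?\<delta>"
      by (simp only: mult_ac)
  qed simp
  finally show ?thesis using alternant_delta_nonzero by simp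
qed

text \<open>Expand a_\<delta> over permutations: \<mu>_i + \<delta>_i - \<delta>_(p i) equals
  \<mu>_i + p i - i. The case distinction excludes negative exponents. The form is chosen to match
  the expansion of the Jacobi-Trudi determinant term by term.\<close>

lemma schur_coeff_eq:
  "schur_coeff n f \<mu> = (\<Sum>p | p permutes {..<n}. of_int (sign p) *
     (if \<forall>i<n. i \<le> part \<mu> i + p i then coefficient f (mono_of n (\<lambda>i. part \<mu> i + p i - i)) else 0))"
proof -
  let ?\<delta> = "\<lambda>j. n - 1 - j"
  let ?m = "mono_of n (\<lambda>i. part \<mu> i + (n - 1 - i))"
  have "restrict_to {..<n} f * alt_poly n ?\<delta> =
      (\<Sum>p | p permutes {..<n}. Poly_Mapping.single (mono_of n (?\<delta> \<circ> p)) (of_int (sign p)) *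
        restrict_to {..<n} f)"
    by (simp add: alt_poly_def sum_distrib_left mult.commute)
  then have "schur_coeff n f \<mu> = (\<Sum>p | p permutes {..<n}. Poly_Mapping.lookup
      (Poly_Mapping.single (mono_of n (?\<delta> \<circ> p)) (of_int (sign p)) * restrict_to {..<n} f) ?m)"
    by (simp add: schur_coeff_def lookup_sum)
  also have "\<dots> = (\<Sum>p | p permutes {..<n}. of_int (sign p) *
     (if \<forall>i<n. i \<le> part \<mu> i + p i then coefficient f (mono_of n (\<lambda>i. part \<mu> i + p i - i)) else 0))"
  proof (rule sum.cong)
    fix p assume "p \<in> {p. p permutes {..<n}}"
    then have p: "p permutes {..<n}" by simp
    have lt: "p i < n" if "i < n" for i
      using permutes_in_image[OF p, of i] that by simp
    let ?G = "Poly_Mapping.single (mono_of n (?\<delta> \<circ> p)) (of_int (sign p)) * restrict_to {..<n} f"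
    show "Poly_Mapping.lookup ?G ?m = of_int (sign p) *
      (if \<forall>i<n. i \<le> part \<mu> i + p i then coefficient f (mono_of n (\<lambda>i. part \<mu> i + p i - i)) else 0)"
    proof (cases "\<forall>i<n. i \<le> part \<mu> i + p i")
      case True
      have "?m = mono_of n (?\<delta> \<circ> p) + mono_of n (\<lambda>i. part \<mu> i + p i - i)"
        unfolding mono_of_add mono_of_eq_iff
      proof (intro allI impI)
        fix i assume "i < n"
        with True lt[of i] show "part \<mu> i + (n - 1 - i) = (?\<delta> \<circ> p) i + (part \<mu> i + p i - i)"
          by (simp add: comp_def)
      qed
      then have "Poly_Mapping.lookup ?G ?m = of_int (sign p) *
          Poly_Mapping.lookup (restrict_to {..<n} f) (mono_of n (\<lambda>i. part \<mu> i + p i - i))"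
        by (simp only: lookup_single_mult)
      then show ?thesis using True keys_mono_of by (simp add: restrict_to.rep_eq)
    next
      case False
      then obtain i where i: "i < n" "part \<mu> i + p i < i" by (auto simp: not_le)
      have "?m \<noteq> mono_of n (?\<delta> \<circ> p) + m'" for m'
      proof
        assume "?m = mono_of n (?\<delta> \<circ> p) + m'"
        then have "Poly_Mapping.lookup ?m i = Poly_Mapping.lookup (mono_of n (?\<delta> \<circ> p) + m') i" by simp
        with i lt[of i] show False by (simp add: lookup_mono_of lookup_add)
      qed
      then have "Poly_Mapping.lookup ?G ?m = 0" by (rule lookup_single_mult_eq_0)
      then show ?thesis unfolding if_not_P[OF False] by simp
    qed
  qed simp
  finally show ?thesis .
qed

section \<open>Schur expansion of the Hall-Littlewood functions\<close>

lemma finite_index_pairs: "finite {(i, j). i < j \<and> j < (n :: nat)}"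
  by (rule finite_subset[of _ "{..<n} \<times> {..<n}"]) auto

lemma vandermonde:
  fixes x :: "nat \<Rightarrow> 'a::idom"
  shows "det (mat n n (\<lambda>(i, j). x i ^ (n - 1 - j))) = (\<Prod>(i, j)\<in>{(i, j). i < j \<and> j < n}. x i - x j)"
proof (induction n)
  case 0
  then show ?case by (simp add: case_prod_beta)
next
  case (Suc n)
  define A where "A = mat (Suc n) (Suc n) (\<lambda>(i, j). x i ^ (n - j))"
  \<comment> \<open>Right multiplication by \<open>U\<close> subtracts x_n times column j+1 from
    column j. This clears the last row up to its final 1 and leaves a factor x_i - x_n in every
    other row.\<close>
  define U where "U = mat (Suc n) (Suc n)
    (\<lambda>(l, j). if l = j then 1 else if l = Suc j then - x n else 0)"
  have carr: "A \<in> carrier_mat (Suc n) (Suc n)" "U \<in> carrier_mat (Suc n) (Suc n)"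
    by (auto simp: A_def U_def)
  have "det U = prod_list (diag_mat U)"
    by (rule det_lower_triangular[of "Suc n"]) (auto simp: U_def)
  also have "\<dots> = 1"
    by (simp add: prod_list_diag_prod U_def)
  finally have "det A = det (A * U)"
    using det_mult[OF carr] by simp
  have AU: "(A * U) $$ (i, j) = (if j = n then 1 else x i ^ (n - 1 - j) * (x i - x n))"
    if "i \<le> n" "j \<le> n" for i j
  proof -
    have "(A * U) $$ (i, j) = (\<Sum>l<Suc n. x i ^ (n - l) *
        (if l = j then 1 else if l = Suc j then - x n else 0))"
      using that by (simp add: A_def U_def scalar_prod_def lessThan_atLeast0 del: sum.lessThan_Suc)
    also have "\<dots> = (\<Sum>l<Suc n. (if l = j then x i ^ (n - l) else 0) +
        (if l = Suc j then - x n * x i ^ (n - l) else 0))"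
      by (rule sum.cong) auto
    also have "\<dots> = x i ^ (n - j) + (if j = n then 0 else - x n * x i ^ (n - Suc j))"
      unfolding sum.distrib using that by (simp add: sum.delta del: sum.lessThan_Suc)
    also have "\<dots> = (if j = n then 1 else x i ^ (n - 1 - j) * (x i - x n))"
    proof (cases "j = n")
      case False
      then have "n - j = Suc (n - 1 - j)" using that by simp
      then show ?thesis using False by (simp add: algebra_simps)
    qed simp
    finally show ?thesis .
  qed
  have "det (A * U) = det (mat n n (\<lambda>(i, j). (A * U) $$ (i, j)))"
    using carr AU by (intro det_last_row_unit) auto
  also have "mat n n (\<lambda>(i, j). (A * U) $$ (i, j)) =
      mat n n (\<lambda>(i, j). x i ^ (n - 1 - j) * (x i - x n))"
    using AU by (intro eq_matI) auto
  also have "det \<dots> = (\<Sum>p | p permutes {0..<n}. signof p *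
      (\<Prod>i=0..<n. x i ^ (n - 1 - p i) * (x i - x n)))"
    by (subst det_def'[OF mat_carrier]) (auto intro!: sum.cong prod.cong dest: permutes_in_image)
  also have "\<dots> = det (mat n n (\<lambda>(i, j). x i ^ (n - 1 - j))) * (\<Prod>i<n. x i - x n)"
    by (subst det_def'[OF mat_carrier], unfold sum_distrib_right, rule sum.cong)
      (auto simp: prod.distrib lessThan_atLeast0 intro!: prod.cong dest: permutes_in_image)
  also have "\<dots> = (\<Prod>(i, j)\<in>{(i, j). i < j \<and> j < n}. x i - x j) * (\<Prod>i<n. x i - x n)"
    using Suc.IH by simp
  also have "(\<Prod>i<n. x i - x n) = (\<Prod>(i, j)\<in>(\<lambda>i. (i, n)) ` {..<n}. x i - x j)"
    by (subst prod.reindex) (auto simp: inj_on_def)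
  also have "(\<Prod>(i, j)\<in>{(i, j). i < j \<and> j < n}. x i - x j) *
        (\<Prod>(i, j)\<in>(\<lambda>i. (i, n)) ` {..<n}. x i - x j) =
      (\<Prod>(i, j)\<in>{(i, j). i < j \<and> j < n} \<union> (\<lambda>i. (i, n)) ` {..<n}. x i - x j)"
    by (rule prod.union_disjoint[symmetric]) (auto simp: finite_index_pairs)
  also have "{(i, j). i < j \<and> j < n} \<union> (\<lambda>i. (i, n)) ` {..<n} = {(i, j). i < j \<and> j < Suc n}"
    by auto
  finally show ?case
    using \<open>det A = det (A * U)\<close> by (simp add: A_def)
qed

lemma prod_differences_permuted:
  assumes "w permutes {..<n}"
  shows "(\<Prod>(i, j)\<in>{(i, j). i < j \<and> j < n}. rvar (w i) - rvar (w j)) =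
    of_int (sign w) * alternant n (\<lambda>j. n - 1 - j)"
proof -
  define A where "A = mat n n (\<lambda>(i, j). rvar i ^ (n - 1 - j))"
  have w: "w permutes {0..<n}" using assms by (simp add: lessThan_atLeast0)
  have lt: "w i < n" if "i < n" for i
    using permutes_in_image[OF w, of i] that by simp
  have "(\<Prod>(i, j)\<in>{(i, j). i < j \<and> j < n}. rvar (w i) - rvar (w j)) =
      det (mat n n (\<lambda>(i, j). rvar (w i) ^ (n - 1 - j)))"
    using vandermonde[of n "rvar \<circ> w"] by (simp add: comp_def)
  also have "mat n n (\<lambda>(i, j). rvar (w i) ^ (n - 1 - j)) = mat n n (\<lambda>(i, j). A $$ (w i, j))"
    using lt by (intro eq_matI) (auto simp: A_def)
  also have "det \<dots> = signof w * det A"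
    by (rule det_permute_rows[OF _ w]) (simp add: A_def)
  finally show ?thesis by (simp add: alternant_def A_def sign_def)
qed

section \<open>Hall-Littlewood numerators and their value at q = 0\<close>

definition var_poly :: "nat \<Rightarrow> monomial \<Rightarrow>\<^sub>0 Qq" where
  "var_poly i = Poly_Mapping.single (Poly_Mapping.single i 1) 1"

text \<open>The symmetrising sum multiplied by a_\<delta>: all denominators x_i - x_j disappear and
  the coefficients become polynomial in \<open>t\<close>.\<close>

definition hl_numerator :: "Qq \<Rightarrow> (nat \<Rightarrow> nat) \<Rightarrow> nat \<Rightarrow> monomial \<Rightarrow>\<^sub>0 Qq" where
  "hl_numerator t e n = (\<Sum>w | w permutes {..<n}. Poly_Mapping.single 0 (of_int (sign w)) *
     ((\<Prod>i<n. var_poly (w i) ^ e i) * (\<Prod>(i, j)\<in>{(i, j). i < j \<and> j < n}.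
       var_poly (w i) - Poly_Mapping.single 0 t * var_poly (w j))))"

lemma rconst_of_int [simp]: "rconst (of_int k) = of_int k"
  by (induction k rule: int_induct[of _ 0]) auto

lemma to_fract_of_int [simp]: "to_fract (of_int k) = of_int k"
  by (induction k rule: int_induct[of _ 0]) auto

lemma to_fract_var_poly [simp]: "to_fract (var_poly i) = rvar i"
  by (simp add: var_poly_def rvar_def)

lemma to_fract_const [simp]: "to_fract (Poly_Mapping.single 0 c) = rconst c"
  by (simp add: rconst_def)

lemma to_fract_hl_numerator:
  "to_fract (hl_numerator t e n) = alternant n (\<lambda>j. n - 1 - j) * ordered_sum t e {..<n}"
proof -
  let ?a = "alternant n (\<lambda>j. n - 1 - j)"
  let ?S = "{(i, j). i < j \<and> j < n}"
  have key: "?a * ((\<Prod>i<n. rvar (w i) ^ e i) *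
        (\<Prod>(i, j)\<in>?S. (rvar (w i) - rconst t * rvar (w j)) / (rvar (w i) - rvar (w j)))) =
      of_int (sign w) * ((\<Prod>i<n. rvar (w i) ^ e i) *
        (\<Prod>(i, j)\<in>?S. rvar (w i) - rconst t * rvar (w j)))" if w: "w permutes {..<n}" for w
  proof -
    have nz: "(\<Prod>(i, j)\<in>?S. rvar (w i) - rvar (w j)) \<noteq> 0"
      using permutes_inj[OF w] by (auto simp: finite_index_pairs case_prod_beta dest: injD)
    have sq: "of_int (sign w) * (of_int (sign w) :: rfun) = 1"
      by (simp add: sign_def)
    have "?a = of_int (sign w) * (\<Prod>(i, j)\<in>?S. rvar (w i) - rvar (w j))"
      unfolding prod_differences_permuted[OF w] mult.assoc[symmetric] sq by (simp only: mult_1_left)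
    moreover have "(\<Prod>(i, j)\<in>?S. (rvar (w i) - rconst t * rvar (w j)) / (rvar (w i) - rvar (w j))) =
        (\<Prod>(i, j)\<in>?S. rvar (w i) - rconst t * rvar (w j)) / (\<Prod>(i, j)\<in>?S. rvar (w i) - rvar (w j))"
      by (simp add: case_prod_beta prod_dividef)
    ultimately show ?thesis using nz by simp
  qed
  show ?thesis
    unfolding sum_permutes_eq_ordered_sum[symmetric] sum_distrib_left hl_numerator_def to_fract_sum
  proof (rule sum.cong)
    fix w assume "w \<in> {w. w permutes {..<n}}"
    then have w: "w permutes {..<n}" by simp
    show "to_fract (Poly_Mapping.single 0 (of_int (sign w)) * ((\<Prod>i<n. var_poly (w i) ^ e i) *
        (\<Prod>(i, j)\<in>?S. var_poly (w i) - Poly_Mapping.single 0 t * var_poly (w j)))) =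
      ?a * ((\<Prod>i<n. rvar (w i) ^ e i) *
        (\<Prod>(i, j)\<in>?S. (rvar (w i) - rconst t * rvar (w j)) / (rvar (w i) - rvar (w j))))"
      unfolding key[OF w]
      by (simp add: to_fract_prod to_fract_power case_prod_beta)
  qed simp
qed

text \<open>At t = 0 each factor x_i - t x_j becomes x_i, and for a fixed ordering these multiply to
  x^\<delta>.\<close>

lemma hl_numerator_0: "hl_numerator 0 e n = alt_poly n (\<lambda>i. e i + (n - 1 - i))"
proof -
  let ?E = "\<lambda>i. e i + (n - 1 - i)"
  let ?S = "{(i, j). i < j \<and> j < n}"
  define A where "A = mat n n (\<lambda>(i, j). rvar i ^ ?E j)"
  have "(\<Prod>i<n. rvar (w i) ^ e i) * (\<Prod>(i, j)\<in>?S. rvar (w i)) = (\<Prod>i<n. rvar (w i) ^ ?E i)" for w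
  proof -
    have "?S = Sigma {..<n} (\<lambda>i. {i<..<n})" by auto
    then have "(\<Prod>(i, j)\<in>?S. rvar (w i)) = (\<Prod>(i, j)\<in>Sigma {..<n} (\<lambda>i. {i<..<n}). rvar (w i))"
      by (simp only:)
    also have "\<dots> = (\<Prod>i<n. \<Prod>j\<in>{i<..<n}. rvar (w i))"
      by (rule prod.Sigma[symmetric]) auto
    also have "\<dots> = (\<Prod>i<n. rvar (w i) ^ (n - 1 - i))"
      by (rule prod.cong) auto
    finally show ?thesis by (simp only: power_add prod.distrib)
  qed
  then have "to_fract (hl_numerator 0 e n) =
      (\<Sum>w | w permutes {..<n}. of_int (sign w) * (\<Prod>i<n. rvar (w i) ^ ?E i))"
    unfolding hl_numerator_def
    by (simp add: to_fract_prod to_fract_power case_prod_beta)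
  also have "\<dots> = (\<Sum>w | w permutes {0..<n}. signof w * (\<Prod>i=0..<n. transpose_mat A $$ (i, w i)))"
    by (intro sum.cong arg_cong2[of _ _ _ _ "(*)"] prod.cong)
      (auto simp: A_def sign_def lessThan_atLeast0 dest: permutes_in_image)
  also have "\<dots> = det (transpose_mat A)"
    by (rule det_def'[symmetric]) (simp add: A_def)
  also have "\<dots> = det A"
    by (rule det_transpose[of _ n]) (simp add: A_def)
  also have "\<dots> = to_fract (alt_poly n ?E)"
    by (simp add: to_fract_alt_poly alternant_def A_def)
  finally show ?thesis by simp
qed

text \<open>Says that \<open>x\<close> is a polynomial in q and \<open>y\<close> its value at q = 0.
  A relation is used since general elements of \<rat>(q) have no value at 0.\<close>

definition specialises :: "Qq \<Rightarrow> Qq \<Rightarrow> bool" where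
  "specialises x y \<longleftrightarrow> (\<exists>p. x = to_fract p \<and> y = to_fract [:poly p 0:])"

lemma specialisesI: "specialises (to_fract p) (to_fract [:poly p 0:])"
  by (auto simp: specialises_def)

lemma specialises_0 [intro, simp]: "specialises 0 0"
  using specialisesI[of 0] by simp

lemma specialises_1 [intro, simp]: "specialises 1 1"
  using specialisesI[of 1] by (simp flip: one_pCons)

lemma specialises_q: "specialises q 0"
  using specialisesI[of "[:0, 1:]"] by (simp add: q_def)

lemma specialises_add: "specialises x y \<Longrightarrow> specialises x' y' \<Longrightarrow> specialises (x + x') (y + y')"
  unfolding specialises_def by (elim exE, rule_tac x = "p + pa" in exI) (auto simp flip: to_fract_add)

lemma specialises_mult: "specialises x y \<Longrightarrow> specialises x' y' \<Longrightarrow> specialises (x * x') (y * y')"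
  unfolding specialises_def by (elim exE, rule_tac x = "p * pa" in exI) (auto simp flip: to_fract_mult)

lemma specialises_uminus: "specialises x y \<Longrightarrow> specialises (- x) (- y)"
  unfolding specialises_def by (elim exE, rule_tac x = "- p" in exI) (auto simp flip: to_fract_uminus)

lemma specialises_diff: "specialises x y \<Longrightarrow> specialises x' y' \<Longrightarrow> specialises (x - x') (y - y')"
  using specialises_add[of x y "- x'" "- y'"] by (simp add: specialises_uminus)

lemma specialises_sum:
  "(\<And>i. i \<in> A \<Longrightarrow> specialises (f i) (g i)) \<Longrightarrow> specialises (sum f A) (sum g A)"
  by (induction A rule: infinite_finite_induct) (simp_all add: specialises_add)

lemma specialises_prod:
  "(\<And>i. i \<in> A \<Longrightarrow> specialises (f i) (g i)) \<Longrightarrow> specialises (prod f A) (prod g A)"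
  by (induction A rule: infinite_finite_induct) (simp_all add: specialises_mult)

lemma specialises_sign: "specialises (of_int (sign w)) (of_int (sign w))"
  by (simp add: sign_def specialises_uminus)

lemma specialises_1_nonzero: "specialises x 1 \<Longrightarrow> x \<noteq> 0"
  unfolding specialises_def by (metis to_fract_1 to_fract_eq_0_iff to_fract_eq_iff poly_0 zero_neq_one
    pCons_0_0 one_pCons pCons_eq_iff)

definition poly_specialises :: "(monomial \<Rightarrow>\<^sub>0 Qq) \<Rightarrow> (monomial \<Rightarrow>\<^sub>0 Qq) \<Rightarrow> bool" where
  "poly_specialises F G \<longleftrightarrow>
     (\<forall>m. specialises (Poly_Mapping.lookup F m) (Poly_Mapping.lookup G m))"

lemma poly_specialises_single: "specialises c d \<Longrightarrow>
    poly_specialises (Poly_Mapping.single e c) (Poly_Mapping.single e d)"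
  by (simp add: poly_specialises_def lookup_single when_def)

lemma poly_specialises_diff: "poly_specialises F G \<Longrightarrow> poly_specialises F' G' \<Longrightarrow>
    poly_specialises (F - F') (G - G')"
  by (simp add: poly_specialises_def lookup_minus specialises_diff)

lemma poly_specialises_mult: "poly_specialises F G \<Longrightarrow> poly_specialises F' G' \<Longrightarrow>
    poly_specialises (F * F') (G * G')"
  unfolding poly_specialises_def lookup_mult_monomials
  by (auto intro!: specialises_sum specialises_mult)

lemma poly_specialises_1: "poly_specialises 1 1"
  by (simp add: poly_specialises_def lookup_one when_def)

lemma poly_specialises_sum:
  "(\<And>i. i \<in> A \<Longrightarrow> poly_specialises (f i) (g i)) \<Longrightarrow> poly_specialises (sum f A) (sum g A)"
  by (simp add: poly_specialises_def lookup_sum specialises_sum)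

lemma poly_specialises_prod:
  "(\<And>i. i \<in> A \<Longrightarrow> poly_specialises (f i) (g i)) \<Longrightarrow> poly_specialises (prod f A) (prod g A)"
  by (induction A rule: infinite_finite_induct)
    (simp_all add: poly_specialises_mult poly_specialises_1)

lemma poly_specialises_power:
  "poly_specialises F G \<Longrightarrow> poly_specialises (F ^ n) (G ^ n)"
  by (induction n) (simp_all add: poly_specialises_mult poly_specialises_1)

lemma poly_specialises_var: "poly_specialises (var_poly i) (var_poly i)"
  by (simp add: var_poly_def poly_specialises_single)

lemma hl_numerator_specialises:
  "poly_specialises (hl_numerator q e n) (alt_poly n (\<lambda>i. e i + (n - 1 - i)))"
  unfolding hl_numerator_0[symmetric] hl_numerator_def case_prod_beta
  by (intro poly_specialises_sum poly_specialises_mult poly_specialises_prod poly_specialises_power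
    poly_specialises_diff poly_specialises_var poly_specialises_single specialises_sign
    specialises_q)

text \<open>The determinant specialises to that of the identity, so it is nonzero and the adjugate
  gives an inverse. Both products are recorded: one yields existence of the Schur expansion in the
  P_\<nu>, the other its uniqueness.\<close>

lemma inverse_family:
  assumes "finite I" and U: "\<And>i j. i \<in> I \<Longrightarrow> j \<in> I \<Longrightarrow> specialises (U i j) (if i = j then 1 else 0)"
  shows "\<exists>V. \<forall>i\<in>I. \<forall>k\<in>I. (\<Sum>j\<in>I. U i j * V j k) = (if i = k then 1 else 0) \<and>
    (\<Sum>j\<in>I. V i j * U j k) = (if i = k then 1 else 0)"
proof -
  obtain h where h: "bij_betw h {0..<card I} I"
    using ex_bij_betw_nat_finite[OF assms(1)] by blast
  define n where "n = card I"
  define A where "A = mat n n (\<lambda>(a, b). U (h a) (h b))"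
  have A: "A \<in> carrier_mat n n" by (simp add: A_def)
  have hI: "h a \<in> I" if "a < n" for a
    using h that by (auto simp: bij_betw_def n_def)
  have h_inj: "h a = h b \<longleftrightarrow> a = b" if "a < n" "b < n" for a b
    using h that by (auto simp: bij_betw_def n_def dest: inj_onD)
  have "specialises (det A) (det (1\<^sub>m n))"
    unfolding det_def'[OF A] det_def'[OF one_carrier_mat]
  proof (intro specialises_sum specialises_mult specialises_prod)
    fix p a assume "p \<in> {p. p permutes {0..<n}}" "a \<in> {0..<n}"
    then have "a < n" "p a < n" using permutes_in_image[of p "{0..<n}" a] by auto
    then show "specialises (A $$ (a, p a)) (1\<^sub>m n $$ (a, p a))"
      using U[OF hI hI, of a "p a"] h_inj[of a "p a"] by (simp add: A_def)
  qed (simp add: sign_def specialises_uminus)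
  then have nz: "det A \<noteq> 0" by (intro specialises_1_nonzero) simp
  define B where "B = inverse (det A) \<cdot>\<^sub>m adj_mat A"
  have B: "B \<in> carrier_mat n n" using adj_mat(1)[OF A] by (simp add: B_def)
  have inv: "inverse (det A) \<cdot>\<^sub>m (det A \<cdot>\<^sub>m 1\<^sub>m n) = 1\<^sub>m n"
    using nz by (intro eq_matI) auto
  have AB: "A * B = 1\<^sub>m n"
    unfolding B_def using adj_mat[OF A] A inv by (simp add: mult_smult_distrib[OF A])
  have BA: "B * A = 1\<^sub>m n"
    unfolding B_def using adj_mat[OF A] A inv by (simp add: mult_smult_assoc_mat[OF _ A])
  define g where "g = inv_into {0..<n} h"
  have g: "g i < n" "h (g i) = i" if "i \<in> I" for i
    using h that unfolding g_def n_def bij_betw_def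
    by (metis atLeastLessThan_iff inv_into_into, metis f_inv_into_f)
  have gh: "g (h a) = a" if "a < n" for a
    using h that unfolding g_def n_def bij_betw_def by (simp add: inv_into_f_f)
  have g_inj: "g i = g k \<longleftrightarrow> i = k" if "i \<in> I" "k \<in> I" for i k
    using g(2)[OF that(1)] g(2)[OF that(2)] by metis
  define V where "V i j = B $$ (g i, g j)" for i j
  have reindex: "(\<Sum>j\<in>I. F j) = (\<Sum>a<n. F (h a))" for F :: "'a \<Rightarrow> Qq"
    using sum.reindex_bij_betw[OF h, of F] by (simp add: n_def lessThan_atLeast0)
  have "(\<Sum>j\<in>I. U i j * V j k) = (if i = k then 1 else 0)" if ik: "i \<in> I" "k \<in> I" for i k
  proof -
    have "(\<Sum>j\<in>I. U i j * V j k) = (\<Sum>a<n. A $$ (g i, a) * B $$ (a, g k))"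
      unfolding reindex using g[OF ik(1)] by (intro sum.cong) (auto simp: A_def V_def gh)
    also have "\<dots> = (A * B) $$ (g i, g k)"
      using A B g(1)[OF ik(1)] g(1)[OF ik(2)] by (simp add: scalar_prod_def lessThan_atLeast0)
    also have "\<dots> = (if i = k then 1 else 0)"
      unfolding AB using g(1)[OF ik(1)] g(1)[OF ik(2)] by (simp add: g_inj[OF ik])
    finally show ?thesis .
  qed
  moreover have "(\<Sum>j\<in>I. V i j * U j k) = (if i = k then 1 else 0)" if ik: "i \<in> I" "k \<in> I" for i k
  proof -
    have "(\<Sum>j\<in>I. V i j * U j k) = (\<Sum>a<n. B $$ (g i, a) * A $$ (a, g k))"
      unfolding reindex using g[OF ik(2)] by (intro sum.cong) (auto simp: A_def V_def gh)
    also have "\<dots> = (B * A) $$ (g i, g k)"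
      using A B g(1)[OF ik(1)] g(1)[OF ik(2)] by (simp add: scalar_prod_def lessThan_atLeast0)
    also have "\<dots> = (if i = k then 1 else 0)"
      unfolding BA using g(1)[OF ik(1)] g(1)[OF ik(2)] by (simp add: g_inj[OF ik])
    finally show ?thesis .
  qed
  ultimately show ?thesis by blast
qed

section \<open>Normalisation and stability of the Hall-Littlewood functions\<close>

lemma q_power_neq_1: "i > 0 \<Longrightarrow> q ^ i \<noteq> 1"
proof
  assume "i > 0" "q ^ i = 1"
  then have "to_fract ([:0, 1:] ^ i :: rat poly) = to_fract 1"
    by (simp add: q_def to_fract_power)
  then have "poly ([:0, 1:] ^ i :: rat poly) 0 = poly 1 0"
    unfolding to_fract_eq_iff by simp
  with \<open>i > 0\<close> show False by (simp add: power_0_left)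
qed

lemma q_neq_1: "q \<noteq> 1"
  using q_power_neq_1[of 1] by simp

lemma hl_v_nonzero: "hl_v m \<noteq> 0"
  using q_power_neq_1 q_neq_1 by (auto simp: hl_v_def)

lemma hall_littlewood_P_vars_eq:
  "hall_littlewood_P_vars \<nu> n = ordered_sum q (part \<nu>) {..<n} / rconst (hl_v_part \<nu> n)"
  unfolding hall_littlewood_P_vars_def sum_permutes_eq_ordered_sum ..

text \<open>Macdonald's b_\<nu>(q), the product of (1 - q) ... (1 - q^m) over the multiplicities m
  of the parts, so that P_\<nu> = Q_\<nu> / b_\<nu>.\<close>

definition P_denom :: "nat list \<Rightarrow> Qq" where
  "P_denom \<nu> = (1 - q) ^ length \<nu> * (\<Prod>i\<in>set \<nu>. hl_v (count_list \<nu> i))"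

text \<open>The dependence of the normalisation on n cancels: the variables left without a part
  contribute exactly the factor v_(n - l) of the padding zeros.\<close>

lemma ordered_sum_eq_hl_sum:
  assumes "length \<nu> \<le> n"
  shows "ordered_sum q (part \<nu>) {..<n} / rconst (hl_v_part \<nu> n) =
    hl_sum q \<nu> {..<n} / rconst (P_denom \<nu>)"
proof -
  let ?k = "n - length \<nu>"
  let ?A = "\<Prod>i=1..?k. 1 - q ^ i"
  have A: "?A \<noteq> 0" using q_power_neq_1 by auto
  have v: "hl_v ?k = ?A / (1 - q) ^ ?k"
    by (simp add: hl_v_def prod_dividef)
  have n: "(1 - q) ^ n = (1 - q) ^ ?k * (1 - q) ^ length \<nu>"
    using assms by (simp flip: power_add)
  have "rconst ((1 - q) ^ n) * ordered_sum q (part \<nu>) {..<n} = rconst ?A * hl_sum q \<nu> {..<n}"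
    using ordered_sum_part[of "{..<n}" \<nu> q] assms by simp
  moreover have "rconst ((1 - q) ^ n) \<noteq> 0"
    unfolding rconst_eq_0_iff using q_neq_1 by simp
  ultimately have sum: "ordered_sum q (part \<nu>) {..<n} = rconst ?A * hl_sum q \<nu> {..<n} / rconst ((1 - q) ^ n)"
    by (metis nonzero_mult_div_cancel_left)
  have "?A / ((1 - q) ^ n * hl_v_part \<nu> n) = 1 / P_denom \<nu>"
    using A q_neq_1 by (simp add: hl_v_part_def v n P_denom_def field_simps del: prod_zero_iff)
  then have quot: "rconst ?A / (rconst ((1 - q) ^ n) * rconst (hl_v_part \<nu> n)) = 1 / rconst (P_denom \<nu>)"
    by (simp only: rconst_divide[symmetric] rconst_simps(6)[symmetric])
      (simp only: rconst_divide rconst_simps(2))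
  have "x * y / z / u = x / (z * u) * y" for x y z u :: rfun
    by simp
  then show ?thesis unfolding sum by (simp only: quot) simp
qed

text \<open>The evaluation formula covers all finite sets, also those with fewer variables than
  \<nu> has parts, about which the description of P_\<nu> says nothing directly.\<close>

lemma hall_littlewood_P_props:
  assumes "0 \<notin> set \<nu>"
  shows "hall_littlewood_P \<nu> \<in> qspan q (length \<nu>) (sum_list \<nu>)"
    and "\<And>A. finite A \<Longrightarrow> ev A (hall_littlewood_P \<nu>) = hl_sum q \<nu> A / rconst (P_denom \<nu>)"
proof -
  obtain f where f: "f \<in> qspan q (length \<nu>) (sum_list \<nu>)"
    "\<And>A. finite A \<Longrightarrow> ev A f = hl_sum q \<nu> A"
    using hl_sum_in_qspan[OF assms] by metis
  let ?g = "scale (1 / P_denom \<nu>) f"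
  have "hall_littlewood_P \<nu> = ?g"
    unfolding hall_littlewood_P_def
  proof (rule stable_symfun_eqI)
    fix n assume "length \<nu> \<le> n"
    then show "ev {..<n} ?g = hall_littlewood_P_vars \<nu> n"
      by (simp add: hall_littlewood_P_vars_eq ordered_sum_eq_hl_sum f(2))
  qed
  with f show "hall_littlewood_P \<nu> \<in> qspan q (length \<nu>) (sum_list \<nu>)"
    "\<And>A. finite A \<Longrightarrow> ev A (hall_littlewood_P \<nu>) = hl_sum q \<nu> A / rconst (P_denom \<nu>)"
    by (simp_all add: qspan.scale)
qed

section \<open>Homogeneity and the Schur basis\<close>

lemma homogeneous_0 [simp]: "homogeneous d 0"
  by (simp add: homogeneous_def zero_symfun.rep_eq)

lemma homogeneous_1 [simp]: "homogeneous 0 1"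
  by (simp add: homogeneous_def one_symfun.rep_eq)

lemma homogeneous_add: "homogeneous d f \<Longrightarrow> homogeneous d g \<Longrightarrow> homogeneous d (f + g)"
  by (auto simp: homogeneous_def plus_symfun.rep_eq) (metis add_0)

lemma homogeneous_scale: "homogeneous d f \<Longrightarrow> homogeneous d (scale c f)"
  by (auto simp: homogeneous_def scale.rep_eq)

lemma homogeneous_sum: "(\<And>x. x \<in> A \<Longrightarrow> homogeneous d (f x)) \<Longrightarrow> homogeneous d (sum f A)"
  by (induction A rule: infinite_finite_induct) (simp_all add: homogeneous_add)

lemma homogeneous_mult:
  assumes "homogeneous d f" "homogeneous e g"
  shows "homogeneous (d + e) (f * g)"
  unfolding homogeneous_def times_symfun.rep_eq
proof (intro allI impI)
  fix m assume "(\<Sum>(a, b)\<in>{(a, b). a + b = m}. coefficient f a * coefficient g b) \<noteq> 0"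
  then obtain x where "x \<in> {(a, b). a + b = m}" "(case x of (a, b) \<Rightarrow> coefficient f a * coefficient g b) \<noteq> 0"
    by (rule sum.not_neutral_contains_not_neutral)
  with assms show "mdeg m = d + e"
    by (cases x) (auto simp: homogeneous_def mdeg_add)
qed

lemma homogeneous_qfun: "homogeneous r (qfun t r)"
  by (simp add: homogeneous_def qfun.rep_eq)

lemma homogeneous_prod:
  "(\<And>i. i \<in> A \<Longrightarrow> homogeneous (d i) (f i)) \<Longrightarrow> homogeneous (sum d A) (prod f A)"
  by (induction A rule: infinite_finite_induct) (simp_all add: homogeneous_mult)

lemma homogeneous_prod_list: "homogeneous (sum_list rs) (prod_list (map (qfun t) rs))"
  by (induction rs) (simp_all add: homogeneous_mult homogeneous_qfun)

lemma homogeneous_qspan: "f \<in> qspan t l d \<Longrightarrow> homogeneous d f"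
  by (induction rule: qspan.induct)
    (auto intro: homogeneous_add homogeneous_scale homogeneous_prod_list)

lemma jacobi_trudi_expand:
  "jacobi_trudi \<mu> n = (\<Sum>p | p permutes {..<n}. scale (of_int (sign p))
     (if \<forall>i<n. i \<le> part \<mu> i + p i then \<Prod>i<n. complete_h (part \<mu> i + p i - i) else 0))"
proof -
  have "jacobi_trudi \<mu> n = (\<Sum>p | p permutes {..<n}. signof p *
      (\<Prod>i<n. h_diff (part \<mu> i + p i) i))"
    unfolding jacobi_trudi_def
    by (subst det_def'[OF mat_carrier])
      (auto intro!: sum.cong prod.cong simp: lessThan_atLeast0 dest: permutes_in_image)
  also have "\<dots> = (\<Sum>p | p permutes {..<n}. scale (of_int (sign p))
     (if \<forall>i<n. i \<le> part \<mu> i + p i then \<Prod>i<n. complete_h (part \<mu> i + p i - i) else 0))"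
  proof (rule sum.cong)
    fix p
    have "signof p * f = scale (of_int (sign p)) f" for f :: "Qq symfun"
      by (simp add: sign_def scale_simps scale_minus_one)
    moreover have "(\<Prod>i<n. h_diff (part \<mu> i + p i) i) =
        (if \<forall>i<n. i \<le> part \<mu> i + p i then \<Prod>i<n. complete_h (part \<mu> i + p i - i) else 0)"
    proof (cases "\<forall>i<n. i \<le> part \<mu> i + p i")
      case True
      then show ?thesis by (auto simp: h_diff_def intro!: prod.cong)
    next
      case False
      then obtain i where "i < n" "part \<mu> i + p i < i" by (auto simp: not_le)
      then have "(\<Prod>i<n. h_diff (part \<mu> i + p i) i) = 0"
        by (intro prod_zero) (auto intro!: bexI[of _ i])
      then show ?thesis unfolding if_not_P[OF False] .
    qed
    ultimately show "signof p * (\<Prod>i<n. h_diff (part \<mu> i + p i) i) = scale (of_int (sign p))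
        (if \<forall>i<n. i \<le> part \<mu> i + p i then \<Prod>i<n. complete_h (part \<mu> i + p i - i) else 0)"
      by simp
  qed simp
  finally show ?thesis .
qed

lemma sum_shifted_parts:
  assumes "p permutes {..<n}" "\<forall>i<n. i \<le> part \<mu> i + p i"
  shows "(\<Sum>i<n. part \<mu> i + p i - i) = (\<Sum>i<n. part \<mu> i)"
proof -
  have "(\<Sum>i<n. part \<mu> i + p i - i) + (\<Sum>i<n. i) = (\<Sum>i<n. part \<mu> i) + (\<Sum>i<n. p i)"
    unfolding sum.distrib[symmetric] using assms(2) by (intro sum.cong) auto
  moreover have "(\<Sum>i<n. p i) = (\<Sum>i<n. i)"
    using sum.permute[OF assms(1), of "\<lambda>i. i"] by simp
  ultimately show ?thesis by simp
qed

lemma homogeneous_schur: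
  assumes "\<mu> \<in> partitions d"
  shows "homogeneous d (schur \<mu>)"
  unfolding schur_eq_jacobi_trudi[OF partition_facts(1)[OF assms]] jacobi_trudi_expand
proof (intro homogeneous_sum homogeneous_scale)
  fix p assume "p \<in> {p. p permutes {..<d}}"
  then have p: "p permutes {..<d}" by simp
  show "homogeneous d (if \<forall>i<d. i \<le> part \<mu> i + p i
      then \<Prod>i<d. complete_h (part \<mu> i + p i - i) else 0)"
  proof (cases "\<forall>i<d. i \<le> part \<mu> i + p i")
    case True
    have "homogeneous (\<Sum>i<d. part \<mu> i + p i - i) (\<Prod>i<d. complete_h (part \<mu> i + p i - i))"
      by (intro homogeneous_prod) (simp add: complete_h_eq_qfun homogeneous_qfun)
    moreover have "(\<Sum>i<d. part \<mu> i + p i - i) = d"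
      using sum_shifted_parts[OF p True] partition_facts(1,2)[OF assms] by simp
    ultimately show ?thesis unfolding if_P[OF True] by simp
  next
    case False
    show ?thesis unfolding if_not_P[OF False] by simp
  qed
qed

lemma card_keys_le_mdeg: "card (Poly_Mapping.keys (m :: monomial)) \<le> mdeg m"
proof -
  have "card (Poly_Mapping.keys m) = (\<Sum>i\<in>Poly_Mapping.keys m. 1)" by simp
  also have "\<dots> \<le> mdeg m"
    unfolding mdeg_def by (rule sum_mono) (simp add: in_keys_iff Suc_leI)
  finally show ?thesis .
qed

text \<open>A monomial of degree d involves at most d variables, and by symmetry these may be taken
  to be the first d.\<close>

lemma homogeneous_eqI:
  assumes "homogeneous d f" "homogeneous d g" "ev {..<d} f = ev {..<d} g"
  shows "f = g"
proof -
  have "coefficient f m = coefficient g m" for m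
  proof (cases "mdeg m = d")
    case False
    then show ?thesis using assms(1,2) by (metis homogeneous_def)
  next
    case deg: True
    let ?K = "Poly_Mapping.keys m"
    obtain N where N: "?K \<subseteq> {..<N}"
      using finite_nat_bounded[of ?K] by auto
    \<comment> \<open>Listing the variables of \<open>m\<close> first makes the corresponding
      permutation move them to the initial positions.\<close>
    define l where "l = sorted_list_of_set ?K @ sorted_list_of_set ({..<N} - ?K)"
    have "l \<in> permutations_of_set {..<N}"
      using N by (auto simp: l_def permutations_of_set_def)
    then obtain \<pi> where \<pi>: "\<pi> permutes {..<N}" "l = map \<pi> [0..<N]"
      using bij_betw_permutations_of_set[of N] unfolding bij_betw_def by auto
    have "k < card ?K" if "\<pi> k \<in> ?K" for k
    proof (rule ccontr)
      assume k: "\<not> k < card ?K"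
      have kN: "k < N" using that N permutes_in_image[OF \<pi>(1), of k] by auto
      have "length l = N" by (simp add: \<pi>(2))
      then have "l ! k \<in> {..<N} - ?K"
        using k kN nth_mem[of "k - card ?K" "sorted_list_of_set ({..<N} - ?K)"]
        by (simp add: l_def nth_append)
      with kN that show False by (simp add: \<pi>(2))
    qed
    then have "Poly_Mapping.keys (Poly_Mapping.map_key \<pi> m) \<subseteq> {..<d}"
      using card_keys_le_mdeg[of m] deg
      by (fastforce simp: keys_map_key[OF permutes_inj[OF \<pi>(1)]])
    then have "coefficient f (Poly_Mapping.map_key \<pi> m) = coefficient g (Poly_Mapping.map_key \<pi> m)"
      by (intro ev_eqD[OF assms(3)]) auto
    moreover have "coefficient h (Poly_Mapping.map_key \<pi> m) = coefficient h m" for h :: "Qq symfun"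
      using coefficient[of h] permutes_bij[OF \<pi>(1)] by (auto simp: permutation_invariant_def)
    ultimately show ?thesis by simp
  qed
  then show ?thesis by (simp add: coefficient_inject[symmetric] fun_eq_iff)
qed

lemma homogeneous_schur_expansion:
  assumes "homogeneous d f"
  shows "f = (\<Sum>\<mu>\<in>partitions d. scale (schur_coeff d f \<mu>) (schur \<mu>))"
  by (rule homogeneous_eqI[OF assms])
    (auto intro!: homogeneous_sum homogeneous_scale homogeneous_schur
      simp: schur_expansion[OF assms order_refl])

lemma restrict_schur_mult_delta:
  assumes "length \<mu> \<le> d"
  shows "restrict_to {..<d} (schur \<mu>) * alt_poly d (\<lambda>j. d - 1 - j) =
    alt_poly d (\<lambda>j. part \<mu> j + (d - 1 - j))"
proof -
  have "to_fract (restrict_to {..<d} (schur \<mu>) * alt_poly d (\<lambda>j. d - 1 - j)) =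
      to_fract (alt_poly d (\<lambda>j. part \<mu> j + (d - 1 - j)))"
    unfolding to_fract_alt_poly alternant_eq_schur[OF assms] to_fract_mult ev_def[symmetric]
    by (simp only: mult.commute)
  then show ?thesis by (simp only: to_fract_eq_iff)
qed

lemma schur_coeff_schur:
  assumes "\<mu> \<in> partitions d" "\<kappa> \<in> partitions d"
  shows "schur_coeff d (schur \<mu>) \<kappa> = (if \<mu> = \<kappa> then 1 else 0)"
proof -
  have len: "length \<mu> \<le> d" "length \<kappa> \<le> d" using assms by (auto dest: partition_facts(1))
  have "schur_coeff d (schur \<mu>) \<kappa> = Poly_Mapping.lookup (alt_poly d (\<lambda>j. part \<mu> j + (d - 1 - j)))
      (mono_of d (\<lambda>j. part \<kappa> j + (d - 1 - j)))"
    unfolding schur_coeff_def by (simp only: restrict_schur_mult_delta[OF len(1)])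
  also have "\<dots> = (if \<forall>i<d. part \<mu> i + (d - 1 - i) = part \<kappa> i + (d - 1 - i) then 1 else 0)"
    using partition_facts(4)[OF assms(1)] partition_facts(4)[OF assms(2)]
    by (rule lookup_alt_poly_strict)
  also have "(\<forall>i<d. part \<mu> i + (d - 1 - i) = part \<kappa> i + (d - 1 - i)) \<longleftrightarrow> \<mu> = \<kappa>"
  proof
    assume eq: "\<forall>i<d. part \<mu> i + (d - 1 - i) = part \<kappa> i + (d - 1 - i)"
    show "\<mu> = \<kappa>"
    proof (rule partition_eqI[OF _ _ len])
      show "part \<mu> i = part \<kappa> i" if "i < d" for i
        using eq that by (metis add_right_cancel)
    qed (use assms in \<open>simp_all add: partitions_def\<close>)
  qed simp
  finally show ?thesis .
qed

lemma schur_coeff_scale: "schur_coeff d (scale c f) \<kappa> = c * schur_coeff d f \<kappa>"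
  by (simp add: schur_coeff_def mult.assoc)

lemma schur_coeff_sum:
  "schur_coeff d (\<Sum>x\<in>A. scale (c x) (f x)) \<kappa> = (\<Sum>x\<in>A. c x * schur_coeff d (f x) \<kappa>)"
proof -
  have 1: "schur_coeff d (f + g) \<kappa> = schur_coeff d f \<kappa> + schur_coeff d g \<kappa>" for f g
    by (simp add: schur_coeff_def distrib_right lookup_add)
  have 2: "schur_coeff d 0 \<kappa> = 0"
    by (simp add: schur_coeff_def)
  show ?thesis
    by (induction A rule: infinite_finite_induct) (simp_all add: 1 2 schur_coeff_scale)
qed

lemma schur_coeff_P_specialises:
  assumes "\<nu> \<in> partitions d"
  shows "\<exists>c. c \<noteq> 0 \<and> (\<forall>\<kappa>\<in>partitions d.
    specialises (c * schur_coeff d (hall_littlewood_P \<nu>) \<kappa>) (if \<nu> = \<kappa> then 1 else 0))"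
proof -
  have len: "length \<nu> \<le> d" and nz: "0 \<notin> set \<nu>"
    using partition_facts(1)[OF assms] assms by (simp_all add: partitions_def)
  \<comment> \<open>The factor v_\<nu> of the definition of P_\<nu>. Restoring it makes a_\<delta>
    P_\<nu> equal to \<open>hl_numerator\<close>, which can be specialised at q = 0 and there
    becomes a_(\<nu>+\<delta>).\<close>
  define c where "c = hl_v_part \<nu> d"
  have "c \<noteq> 0" using hl_v_nonzero by (simp add: c_def hl_v_part_def)
  have "ev {..<d} (scale c (hall_littlewood_P \<nu>)) = ordered_sum q (part \<nu>) {..<d}"
    using hall_littlewood_P_props(2)[OF nz, of "{..<d}"] \<open>c \<noteq> 0\<close>
    by (simp add: c_def flip: ordered_sum_eq_hl_sum[OF len])
  then have "to_fract (restrict_to {..<d} (scale c (hall_littlewood_P \<nu>)) * alt_poly d (\<lambda>j. d - 1 - j)) =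
      to_fract (hl_numerator q (part \<nu>) d)"
    unfolding to_fract_hl_numerator to_fract_mult to_fract_alt_poly ev_def by (simp only: mult.commute)
  then have num: "restrict_to {..<d} (scale c (hall_littlewood_P \<nu>)) * alt_poly d (\<lambda>j. d - 1 - j) =
      hl_numerator q (part \<nu>) d"
    by (simp only: to_fract_eq_iff)
  have "specialises (c * schur_coeff d (hall_littlewood_P \<nu>) \<kappa>) (if \<nu> = \<kappa> then 1 else 0)"
    if \<kappa>: "\<kappa> \<in> partitions d" for \<kappa>
  proof -
    let ?m = "mono_of d (\<lambda>i. part \<kappa> i + (d - 1 - i))"
    have "c * schur_coeff d (hall_littlewood_P \<nu>) \<kappa> =
        schur_coeff d (scale c (hall_littlewood_P \<nu>)) \<kappa>"
      by (simp only: schur_coeff_scale)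
    also have "\<dots> = Poly_Mapping.lookup (hl_numerator q (part \<nu>) d) ?m"
      by (simp only: schur_coeff_def num)
    finally have "c * schur_coeff d (hall_littlewood_P \<nu>) \<kappa> =
        Poly_Mapping.lookup (hl_numerator q (part \<nu>) d) ?m" .
    moreover have "specialises (Poly_Mapping.lookup (hl_numerator q (part \<nu>) d) ?m)
        (Poly_Mapping.lookup (alt_poly d (\<lambda>i. part \<nu> i + (d - 1 - i))) ?m)"
      using hl_numerator_specialises by (simp add: poly_specialises_def)
    moreover have "Poly_Mapping.lookup (alt_poly d (\<lambda>i. part \<nu> i + (d - 1 - i))) ?m =
        schur_coeff d (schur \<nu>) \<kappa>"
      unfolding schur_coeff_def by (simp only: restrict_schur_mult_delta[OF len])
    ultimately show ?thesis using schur_coeff_schur[OF assms \<kappa>] by simp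
  qed
  with \<open>c \<noteq> 0\<close> show ?thesis by blast
qed

section \<open>Existence and uniqueness of the Kostka-Foulkes coefficients\<close>

definition schur_P_matrix :: "nat \<Rightarrow> (nat list \<Rightarrow> nat list \<Rightarrow> Qq) \<Rightarrow> bool" where
  "schur_P_matrix d K \<longleftrightarrow> (\<forall>\<mu>\<in>partitions d.
     schur \<mu> = (\<Sum>\<nu>\<in>partitions d. scale (K \<mu> \<nu>) (hall_littlewood_P \<nu>)))"

text \<open>Schur coefficients express the P_\<nu> by a matrix \<open>U\<close>; a solution
  \<open>K\<close> is the same as an inverse of \<open>U\<close>. Only values on partitions of
  \<open>d\<close> are determined here, hence the restricted form of uniqueness.\<close>

lemma schur_P_matrix_unique:
  "\<exists>V. schur_P_matrix d V \<and> (\<forall>K. schur_P_matrix d K \<longrightarrow>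
      (\<forall>\<mu>\<in>partitions d. \<forall>\<nu>\<in>partitions d. K \<mu> \<nu> = V \<mu> \<nu>))"
proof -
  let ?I = "partitions d"
  define U where "U \<nu> \<kappa> = schur_coeff d (hall_littlewood_P \<nu>) \<kappa>" for \<nu> \<kappa>
  have "\<forall>\<nu>\<in>?I. \<exists>c. c \<noteq> 0 \<and> (\<forall>\<kappa>\<in>?I. specialises (c * U \<nu> \<kappa>) (if \<nu> = \<kappa> then 1 else 0))"
    using schur_coeff_P_specialises unfolding U_def by blast
  then obtain c where c: "\<And>\<nu>. \<nu> \<in> ?I \<Longrightarrow> c \<nu> \<noteq> 0"
    "\<And>\<nu> \<kappa>. \<nu> \<in> ?I \<Longrightarrow> \<kappa> \<in> ?I \<Longrightarrow> specialises (c \<nu> * U \<nu> \<kappa>) (if \<nu> = \<kappa> then 1 else 0)"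
    by metis
  have "\<exists>W. \<forall>i\<in>?I. \<forall>k\<in>?I. (\<Sum>j\<in>?I. (c i * U i j) * W j k) = (if i = k then 1 else 0) \<and>
      (\<Sum>j\<in>?I. W i j * (c j * U j k)) = (if i = k then 1 else 0)"
    by (rule inverse_family[OF finite_partitions c(2)])
  then obtain W where W0: "\<forall>i\<in>?I. \<forall>k\<in>?I. (\<Sum>j\<in>?I. (c i * U i j) * W j k) = (if i = k then 1 else 0) \<and>
      (\<Sum>j\<in>?I. W i j * (c j * U j k)) = (if i = k then 1 else 0)"
    by (elim exE)
  have W: "(\<Sum>j\<in>?I. (c i * U i j) * W j k) = (if i = k then 1 else 0)"
    "(\<Sum>j\<in>?I. W i j * (c j * U j k)) = (if i = k then 1 else 0)" if "i \<in> ?I" "k \<in> ?I" for i k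
    using W0[rule_format, OF that] by simp_all
  \<comment> \<open>\<open>W\<close> inverts \<open>U\<close> with its rows rescaled by
    \<open>c\<close>; moving the scalars to the columns of \<open>W\<close> inverts \<open>U\<close>
    itself.\<close>
  define V where "V \<mu> \<nu> = W \<mu> \<nu> * c \<nu>" for \<mu> \<nu>
  have VU: "(\<Sum>j\<in>?I. V i j * U j k) = (if i = k then 1 else 0)" if "i \<in> ?I" "k \<in> ?I" for i k
    using W(2)[OF that] by (simp add: V_def mult.assoc)
  have UV: "(\<Sum>j\<in>?I. U i j * V j k) = (if i = k then 1 else 0)" if ik: "i \<in> ?I" "k \<in> ?I" for i k
  proof -
    have "c i * (\<Sum>j\<in>?I. U i j * V j k) = (\<Sum>j\<in>?I. (c i * U i j) * W j k) * c k"
      by (simp add: V_def sum_distrib_left sum_distrib_right mult_ac)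
    also have "\<dots> = c i * (if i = k then 1 else 0)" using W(1)[OF ik] by simp
    finally show ?thesis using c(1)[OF ik(1)] by simp
  qed
  have P: "hall_littlewood_P \<nu> = (\<Sum>\<kappa>\<in>?I. scale (U \<nu> \<kappa>) (schur \<kappa>))" if "\<nu> \<in> ?I" for \<nu>
  proof -
    have "0 \<notin> set \<nu>" "sum_list \<nu> = d" using that by (auto simp: partitions_def)
    then have "homogeneous d (hall_littlewood_P \<nu>)"
      using hall_littlewood_P_props(1) homogeneous_qspan by blast
    then show ?thesis unfolding U_def by (rule homogeneous_schur_expansion)
  qed
  have expand: "(\<Sum>\<nu>\<in>?I. scale (K \<nu>) (hall_littlewood_P \<nu>)) =
      (\<Sum>\<kappa>\<in>?I. scale (\<Sum>\<nu>\<in>?I. K \<nu> * U \<nu> \<kappa>) (schur \<kappa>))" for K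
  proof -
    have "(\<Sum>\<nu>\<in>?I. scale (K \<nu>) (hall_littlewood_P \<nu>)) =
        (\<Sum>\<nu>\<in>?I. \<Sum>\<kappa>\<in>?I. scale (K \<nu> * U \<nu> \<kappa>) (schur \<kappa>))"
      by (rule sum.cong) (simp_all add: P scale_sum_right scale_simps)
    also have "\<dots> = (\<Sum>\<kappa>\<in>?I. \<Sum>\<nu>\<in>?I. scale (K \<nu> * U \<nu> \<kappa>) (schur \<kappa>))"
      by (rule sum.swap)
    finally show ?thesis by (simp add: scale_sum_left)
  qed
  have ex: "schur \<mu> = (\<Sum>\<nu>\<in>?I. scale (V \<mu> \<nu>) (hall_littlewood_P \<nu>))" if "\<mu> \<in> ?I" for \<mu>
  proof -
    have "(\<Sum>\<kappa>\<in>?I. scale (\<Sum>\<nu>\<in>?I. V \<mu> \<nu> * U \<nu> \<kappa>) (schur \<kappa>)) =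
        (\<Sum>\<kappa>\<in>?I. if \<kappa> = \<mu> then schur \<mu> else 0)"
      by (rule sum.cong) (auto simp: VU that scale_simps)
    then show ?thesis using that by (simp add: expand finite_partitions)
  qed
  have uniq: "K \<mu> \<nu> = V \<mu> \<nu>"
    if K: "\<forall>\<mu>\<in>?I. schur \<mu> = (\<Sum>\<nu>\<in>?I. scale (K \<mu> \<nu>) (hall_littlewood_P \<nu>))"
      and \<mu>: "\<mu> \<in> ?I" and \<nu>: "\<nu> \<in> ?I" for K \<mu> \<nu>
  proof -
    have KU: "(\<Sum>\<nu>\<in>?I. K \<mu> \<nu> * U \<nu> \<kappa>) = (if \<mu> = \<kappa> then 1 else 0)" if \<kappa>: "\<kappa> \<in> ?I" for \<kappa>
    proof -
      have "(if \<mu> = \<kappa> then 1 else 0) = schur_coeff d (schur \<mu>) \<kappa>"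
        using schur_coeff_schur[OF \<mu> \<kappa>] by simp
      also have "\<dots> = (\<Sum>\<nu>\<in>?I. K \<mu> \<nu> * U \<nu> \<kappa>)"
        unfolding K[rule_format, OF \<mu>] schur_coeff_sum U_def ..
      finally show ?thesis by simp
    qed
    have "K \<mu> \<nu> = (\<Sum>\<kappa>\<in>?I. if \<kappa> = \<nu> then K \<mu> \<nu> else 0)"
      using \<nu> by (simp add: finite_partitions)
    also have "\<dots> = (\<Sum>\<kappa>\<in>?I. K \<mu> \<kappa> * (\<Sum>j\<in>?I. U \<kappa> j * V j \<nu>))"
      by (rule sum.cong) (auto simp: UV \<nu>)
    also have "\<dots> = (\<Sum>j\<in>?I. (\<Sum>\<kappa>\<in>?I. K \<mu> \<kappa> * U \<kappa> j) * V j \<nu>)"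
      unfolding sum_distrib_left sum_distrib_right
      by (subst sum.swap) (simp add: mult.assoc)
    also have "\<dots> = (\<Sum>j\<in>?I. if j = \<mu> then V \<mu> \<nu> else 0)"
      by (rule sum.cong) (auto simp: KU)
    also have "\<dots> = V \<mu> \<nu>" using \<mu> by (simp add: finite_partitions)
    finally show ?thesis .
  qed
  show ?thesis
    unfolding schur_P_matrix_def
    by (rule exI[of _ V], intro conjI ballI allI impI) (erule ex, rule uniq)
qed

lemma schur_eq_sum_kostka_foulkes:
  assumes "\<mu> \<in> partitions d"
  shows "schur \<mu> = (\<Sum>\<nu>\<in>partitions d. scale (kostka_foulkes \<mu> \<nu>) (hall_littlewood_P \<nu>))"
proof -
  let ?spec = "\<lambda>K. (\<forall>n. \<forall>\<mu>\<in>partitions n.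
        schur \<mu> = (\<Sum>\<nu>\<in>partitions n. scale (K \<mu> \<nu>) (hall_littlewood_P \<nu>))) \<and>
     (\<forall>\<mu> \<nu>. (\<nexists>n. \<mu> \<in> partitions n \<and> \<nu> \<in> partitions n) \<longrightarrow> K \<mu> \<nu> = 0)"
  have spec: "?spec K \<longleftrightarrow> (\<forall>n. schur_P_matrix n K) \<and>
      (\<forall>\<mu> \<nu>. (\<nexists>n. \<mu> \<in> partitions n \<and> \<nu> \<in> partitions n) \<longrightarrow> K \<mu> \<nu> = 0)" for K
    by (simp only: schur_P_matrix_def)
  obtain V where V: "\<And>n. schur_P_matrix n (V n)"
    "\<And>n K \<mu> \<nu>. schur_P_matrix n K \<Longrightarrow> \<mu> \<in> partitions n \<Longrightarrow> \<nu> \<in> partitions n \<Longrightarrow>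
       K \<mu> \<nu> = V n \<mu> \<nu>"
    using schur_P_matrix_unique by metis
  have uniq: "\<mu> \<in> partitions n \<Longrightarrow> sum_list \<mu> = n" for \<mu> n by (simp add: partitions_def)
  \<comment> \<open>A partition determines its size, so the matrices of all degrees glue to one
    function; the value 0 elsewhere is the one prescribed.\<close>
  define K where "K \<mu> \<nu> = (if \<exists>n. \<mu> \<in> partitions n \<and> \<nu> \<in> partitions n
    then V (sum_list \<mu>) \<mu> \<nu> else 0)" for \<mu> \<nu>
  have K: "?spec K"
    unfolding spec
  proof (intro conjI allI impI)
    fix n
    have "K \<mu> \<nu> = V n \<mu> \<nu>" if "\<mu> \<in> partitions n" "\<nu> \<in> partitions n" for \<mu> \<nu>
      using that uniq[OF that(1)] by (auto simp: K_def)
    then show "schur_P_matrix n K"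
      using V(1)[of n] by (simp add: schur_P_matrix_def)
  qed (unfold K_def, rule if_not_P)
  have "K' = K" if K': "?spec K'" for K'
  proof (intro ext)
    fix \<mu> \<nu>
    show "K' \<mu> \<nu> = K \<mu> \<nu>"
    proof (cases "\<exists>n. \<mu> \<in> partitions n \<and> \<nu> \<in> partitions n")
      case True
      then obtain n where n: "\<mu> \<in> partitions n" "\<nu> \<in> partitions n" by blast
      have "K' \<mu> \<nu> = V n \<mu> \<nu>" "K \<mu> \<nu> = V n \<mu> \<nu>"
        using conjunct1[OF K'[unfolded spec]] conjunct1[OF K[unfolded spec]]
        by (intro V(2)[OF _ n], blast)+
      then show ?thesis by simp
    next
      case False
      have "K \<mu> \<nu> = 0" unfolding K_def by (rule if_not_P[OF False])
      moreover have "K' \<mu> \<nu> = 0" using conjunct2[OF K'] False by blast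
      ultimately show ?thesis by simp
    qed
  qed
  then have "?spec kostka_foulkes"
    using K unfolding kostka_foulkes_def by (intro theI[of ?spec K])
  with assms show ?thesis by blast
qed

section \<open>Symmetry of coefficients and duality\<close>

text \<open>Indices are encoded as an exponent vector so that indices and monomials have the same
  type and can be exchanged.\<close>

definition qprod :: "'a \<Rightarrow> monomial \<Rightarrow> 'a::comm_ring_1 symfun" where
  "qprod t r = (\<Prod>j\<in>Poly_Mapping.keys r. qfun t (Poly_Mapping.lookup r j))"

lemma qprod_superset:
  assumes "finite J" "Poly_Mapping.keys r \<subseteq> J"
  shows "qprod t r = (\<Prod>j\<in>J. qfun t (Poly_Mapping.lookup r j))"
  unfolding qprod_def using assms
  by (intro prod.mono_neutral_left) (auto simp: in_keys_iff)

lemma qprod_mono_of: "qprod t (mono_of n e) = (\<Prod>i<n. qfun t (e i))"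
proof -
  have "qprod t (mono_of n e) = (\<Prod>i<n. qfun t (Poly_Mapping.lookup (mono_of n e) i))"
    by (rule qprod_superset[OF finite_lessThan keys_mono_of])
  then show ?thesis by (simp add: lookup_mono_of)
qed

lemma qprod_add_single:
  assumes "i \<notin> Poly_Mapping.keys m"
  shows "qprod t (m + Poly_Mapping.single i p) = qfun t p * qprod t m"
proof -
  let ?J = "insert i (Poly_Mapping.keys m)"
  have "qprod t (m + Poly_Mapping.single i p) =
      (\<Prod>j\<in>?J. qfun t (Poly_Mapping.lookup (m + Poly_Mapping.single i p) j))"
    by (rule qprod_superset) (auto simp: keys_add_nat split: if_splits)
  also have "\<dots> = qfun t p * (\<Prod>j\<in>Poly_Mapping.keys m. qfun t (Poly_Mapping.lookup m j))"
    using assms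
    by (subst prod.insert)
      (auto simp: lookup_add lookup_single in_keys_iff when_def intro!: arg_cong2[of _ _ _ _ "(*)"] prod.cong)
  finally show ?thesis by (simp add: qprod_def)
qed

lemma coefficient_qfun_add_single:
  assumes "i \<notin> Poly_Mapping.keys a"
  shows "coefficient (qfun t k) (a + Poly_Mapping.single i s) =
    (if s \<le> k then (if s = 0 then 1 else 1 - t) * coefficient (qfun t (k - s)) a else 0)"
proof -
  have "mdeg (a + Poly_Mapping.single i s) = k \<longleftrightarrow> s \<le> k \<and> mdeg a = k - s"
    by (auto simp: mdeg_add)
  moreover have "card (Poly_Mapping.keys (a + Poly_Mapping.single i s)) =
      (if s = 0 then 0 else 1) + card (Poly_Mapping.keys a)"
    using assms by (simp add: keys_add_nat)
  ultimately show ?thesis by (auto simp: qfun.rep_eq)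
qed

lemma sum_monomial_splits_single:
  fixes G :: "monomial \<Rightarrow> monomial \<Rightarrow> 'a::comm_monoid_add"
  assumes "j \<notin> Poly_Mapping.keys r"
  shows "(\<Sum>(x, y)\<in>{(x, y). x + y = r + Poly_Mapping.single j k}. G x y) =
    (\<Sum>s\<le>k. \<Sum>(x, y)\<in>{(x, y). x + y = r}.
       G (x + Poly_Mapping.single j s) (y + Poly_Mapping.single j (k - s)))"
proof -
  let ?S = "{(x, y). x + y = r}" and ?e = "Poly_Mapping.single j"
  have r: "Poly_Mapping.lookup r j = 0" using assms by (simp add: in_keys_iff)
  have "(\<Sum>s\<le>k. \<Sum>(x, y)\<in>?S. G (x + ?e s) (y + ?e (k - s))) =
      (\<Sum>(s, x, y)\<in>{..k} \<times> ?S. G (x + ?e s) (y + ?e (k - s)))"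
    by (simp add: sum.cartesian_product case_prod_beta)
  also have "\<dots> = (\<Sum>(x, y)\<in>{(x, y). x + y = r + ?e k}. G x y)"
  proof (rule sum.reindex_bij_witness[where
        j = "\<lambda>(s, x, y). (x + ?e s, y + ?e (k - s))" and
        i = "\<lambda>(x, y). (Poly_Mapping.lookup x j, x - ?e (Poly_Mapping.lookup x j),
               y - ?e (Poly_Mapping.lookup y j))"], goal_cases)
    case (1 p)
    then obtain s x y where p: "p = (s, x, y)" "s \<le> k" "x + y = r" by (cases p) auto
    from r p(3) have "Poly_Mapping.lookup x j + Poly_Mapping.lookup y j = 0"
      by (simp flip: lookup_add)
    then show ?case using p by (auto intro!: poly_mapping_eqI simp: lookup_add lookup_minus lookup_single when_def)
  next
    case (2 p)
    then obtain s x y where p: "p = (s, x, y)" "s \<le> k" "x + y = r" by (cases p) auto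
    have "(x + ?e s) + (y + ?e (k - s)) = (x + y) + (?e s + ?e (k - s))" by (simp add: algebra_simps)
    also have "\<dots> = r + ?e k" using p by (simp flip: single_add)
    finally show ?case using p by simp
  next
    case (3 p)
    then obtain x y where p: "p = (x, y)" "x + y = r + ?e k" by (cases p) auto
    have "Poly_Mapping.lookup (x + y) j = k" unfolding p(2) using r by (simp add: lookup_add)
    then have k: "Poly_Mapping.lookup x j + Poly_Mapping.lookup y j = k" by (simp add: lookup_add)
    have split: "m = m - ?e (Poly_Mapping.lookup m j) + ?e (Poly_Mapping.lookup m j)" for m :: monomial
      by (auto intro!: poly_mapping_eqI simp: lookup_add lookup_minus lookup_single when_def)
    show ?case using p(1) k split[of x] split[of y] by auto
  next
    case (4 p)
    then obtain x y where p: "p = (x, y)" "x + y = r + ?e k" by (cases p) auto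
    have "Poly_Mapping.lookup (x + y) j = k" unfolding p(2) using r by (simp add: lookup_add)
    then have k: "Poly_Mapping.lookup x j + Poly_Mapping.lookup y j = k" by (simp add: lookup_add)
    have "x - ?e (Poly_Mapping.lookup x j) + (y - ?e (Poly_Mapping.lookup y j)) = r"
    proof (rule poly_mapping_eqI)
      fix i
      have "Poly_Mapping.lookup x i + Poly_Mapping.lookup y i = Poly_Mapping.lookup r i + (k when j = i)"
        using arg_cong[OF p(2), of "\<lambda>m. Poly_Mapping.lookup m i"] by (simp add: lookup_add lookup_single)
      then show "Poly_Mapping.lookup (x - ?e (Poly_Mapping.lookup x j) + (y - ?e (Poly_Mapping.lookup y j))) i =
          Poly_Mapping.lookup r i"
        using r by (auto simp: lookup_add lookup_minus lookup_single when_def)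
    qed
    then show ?case using p(1) k by simp
  next
    case (5 p)
    then show ?case by (cases p) simp
  qed
  finally show ?thesis by simp
qed

lemma monomial_remove:
  obtains m' where "m = m' + Poly_Mapping.single i (Poly_Mapping.lookup m i)"
    "i \<notin> Poly_Mapping.keys m'" "Poly_Mapping.keys m' \<subseteq> Poly_Mapping.keys (m :: monomial)"
proof
  let ?m' = "m - Poly_Mapping.single i (Poly_Mapping.lookup m i)"
  show "m = ?m' + Poly_Mapping.single i (Poly_Mapping.lookup m i)"
    by (auto intro!: poly_mapping_eqI simp: lookup_add lookup_minus lookup_single when_def)
  show "i \<notin> Poly_Mapping.keys ?m'" "Poly_Mapping.keys ?m' \<subseteq> Poly_Mapping.keys m"
    by (auto simp: in_keys_iff lookup_minus)
qed

text \<open>In terms of weighted matrices, the factors of \<open>qprod\<close> are the rows and the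
  variables are the columns. Multiplying by a factor adds a row; this is the dual rule, splitting
  off column \<open>j\<close>, proved by induction on the rows.\<close>

lemma coefficient_qprod_add_single:
  assumes "finite I" "Poly_Mapping.keys m \<subseteq> I" "j \<notin> Poly_Mapping.keys r"
  shows "coefficient (qprod t m) (r + Poly_Mapping.single j k) =
    (\<Sum>(a, b)\<in>{(a, b). a + b = m}. coefficient (qfun t k) a * coefficient (qprod t b) r)"
  using assms
proof (induction I arbitrary: m r k rule: finite_induct)
  case empty
  then have m: "m = 0" by simp
  have "{(a, b). a + b = (0 :: monomial)} = {(0, 0)}"
    by (auto simp: poly_mapping_eq_iff lookup_add fun_eq_iff)
  moreover have "r + Poly_Mapping.single j k = 0 \<longleftrightarrow> k = 0 \<and> r = 0"
    by (auto simp: poly_mapping_eq_iff lookup_add fun_eq_iff lookup_single when_def)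
  ultimately show ?case
    by (simp add: m qprod_def one_symfun.rep_eq qfun.rep_eq mdeg_def)
next
  case (insert i I)
  define p where "p = Poly_Mapping.lookup m i"
  obtain m' where m': "m = m' + Poly_Mapping.single i p" "i \<notin> Poly_Mapping.keys m'"
    "Poly_Mapping.keys m' \<subseteq> Poly_Mapping.keys m"
    unfolding p_def by (rule monomial_remove)
  have keys: "Poly_Mapping.keys m' \<subseteq> I" using m' insert.prems by auto
  let ?c = "\<lambda>k. coefficient (qfun t k)" and ?e = "Poly_Mapping.single"
  let ?R = "{(x, y). x + y = r}" and ?M = "{(a, b). a + b = m'}"
  let ?w = "\<lambda>s. if s = 0 then 1 else 1 - t"
  have sub: "j \<notin> Poly_Mapping.keys x \<and> j \<notin> Poly_Mapping.keys y" if "x + y = r" for x y :: monomial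
    using insert.prems(2) that keys_add_nat[of x y] by auto
  have sub': "i \<notin> Poly_Mapping.keys a \<and> i \<notin> Poly_Mapping.keys b" if "a + b = m'" for a b :: monomial
    using m'(2) that keys_add_nat[of a b] by auto
  have "coefficient (qprod t m) (r + ?e j k) =
      (\<Sum>(x, y)\<in>{(x, y). x + y = r + ?e j k}. ?c p x * coefficient (qprod t m') y)"
    unfolding m'(1) qprod_add_single[OF m'(2)] times_symfun.rep_eq ..
  also have "\<dots> = (\<Sum>s\<le>k. \<Sum>(x, y)\<in>?R. ?c p (x + ?e j s) * coefficient (qprod t m') (y + ?e j (k - s)))"
    by (rule sum_monomial_splits_single[OF insert.prems(2)])
  also have "\<dots> = (\<Sum>s\<le>k. if s \<le> p then \<Sum>(x, y)\<in>?R. \<Sum>(a, b)\<in>?M.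
      ?w s * ?c (p - s) x * (?c (k - s) a * coefficient (qprod t b) y) else 0)"
  proof (rule sum.cong)
    fix s
    have "(\<Sum>(x, y)\<in>?R. ?c p (x + ?e j s) * coefficient (qprod t m') (y + ?e j (k - s))) =
        (\<Sum>(x, y)\<in>?R. (if s \<le> p then ?w s * ?c (p - s) x else 0) *
          (\<Sum>(a, b)\<in>?M. ?c (k - s) a * coefficient (qprod t b) y))"
    proof (rule sum.cong)
      fix z assume "z \<in> ?R"
      then obtain x y where z: "z = (x, y)" "x + y = r" by auto
      show "(case z of (x, y) \<Rightarrow> ?c p (x + ?e j s) * coefficient (qprod t m') (y + ?e j (k - s))) =
          (case z of (x, y) \<Rightarrow> (if s \<le> p then ?w s * ?c (p - s) x else 0) *
            (\<Sum>(a, b)\<in>?M. ?c (k - s) a * coefficient (qprod t b) y))"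
        unfolding z(1) prod.case
        by (subst insert.IH[OF keys])
          (use sub[OF z(2)] in \<open>simp_all only: coefficient_qfun_add_single not_False_eq_True\<close>)
    qed simp
    then show "(\<Sum>(x, y)\<in>?R. ?c p (x + ?e j s) * coefficient (qprod t m') (y + ?e j (k - s))) =
        (if s \<le> p then \<Sum>(x, y)\<in>?R. \<Sum>(a, b)\<in>?M.
          ?w s * ?c (p - s) x * (?c (k - s) a * coefficient (qprod t b) y) else 0)"
      by (simp add: sum_distrib_left case_prod_beta)
  qed simp
  \<comment> \<open>The index \<open>s\<close> is the entry where row \<open>i\<close> and column
    \<open>j\<close> meet. It is bounded by both sums, so the two ways of splitting range over the
    same values.\<close>
  also have "\<dots> = (\<Sum>s\<in>{..k} \<inter> {..p}. \<Sum>(x, y)\<in>?R. \<Sum>(a, b)\<in>?M.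
      ?w s * ?c (p - s) x * (?c (k - s) a * coefficient (qprod t b) y))"
    by (simp only: sum.inter_restrict[OF finite_atMost] atMost_iff)
  also have "\<dots> = (\<Sum>s\<in>{..p} \<inter> {..k}. \<Sum>(a, b)\<in>?M. \<Sum>(x, y)\<in>?R.
      ?w s * ?c (k - s) a * (?c (p - s) x * coefficient (qprod t b) y))"
    unfolding case_prod_beta
  proof (rule sum.cong)
    fix s
    show "(\<Sum>x\<in>{p. fst p + snd p = r}. \<Sum>z\<in>{p. fst p + snd p = m'}.
        ?w s * ?c (p - s) (fst x) * (?c (k - s) (fst z) * coefficient (qprod t (snd z)) (snd x))) =
      (\<Sum>z\<in>{p. fst p + snd p = m'}. \<Sum>x\<in>{p. fst p + snd p = r}.
        ?w s * ?c (k - s) (fst z) * (?c (p - s) (fst x) * coefficient (qprod t (snd z)) (snd x)))"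
      by (subst sum.swap) (intro sum.cong refl, simp only: mult_ac)
  qed blast
  also have "\<dots> = (\<Sum>s\<le>p. if s \<le> k then \<Sum>(a, b)\<in>?M. \<Sum>(x, y)\<in>?R.
      ?w s * ?c (k - s) a * (?c (p - s) x * coefficient (qprod t b) y) else 0)"
    by (simp only: sum.inter_restrict[OF finite_atMost] atMost_iff)
  also have "\<dots> = (\<Sum>s\<le>p. \<Sum>(a, b)\<in>?M. ?c k (a + ?e i s) * coefficient (qprod t (b + ?e i (p - s))) r)"
  proof (rule sum.cong)
    fix s
    have "(\<Sum>(a, b)\<in>?M. ?c k (a + ?e i s) * coefficient (qprod t (b + ?e i (p - s))) r) =
        (\<Sum>(a, b)\<in>?M. (if s \<le> k then ?w s * ?c (k - s) a else 0) *
          (\<Sum>(x, y)\<in>?R. ?c (p - s) x * coefficient (qprod t b) y))"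
    proof (rule sum.cong)
      fix z assume "z \<in> ?M"
      then obtain a b where z: "z = (a, b)" "a + b = m'" by auto
      show "(case z of (a, b) \<Rightarrow> ?c k (a + ?e i s) * coefficient (qprod t (b + ?e i (p - s))) r) =
          (case z of (a, b) \<Rightarrow> (if s \<le> k then ?w s * ?c (k - s) a else 0) *
          (\<Sum>(x, y)\<in>?R. ?c (p - s) x * coefficient (qprod t b) y))"
        unfolding z(1) prod.case using sub'[OF z(2)]
        by (simp only: coefficient_qfun_add_single qprod_add_single not_False_eq_True simp_thms
          times_symfun.rep_eq)
    qed simp
    then show "(if s \<le> k then \<Sum>(a, b)\<in>?M. \<Sum>(x, y)\<in>?R.
        ?w s * ?c (k - s) a * (?c (p - s) x * coefficient (qprod t b) y) else 0) =
      (\<Sum>(a, b)\<in>?M. ?c k (a + ?e i s) * coefficient (qprod t (b + ?e i (p - s))) r)"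
      by (simp add: sum_distrib_left case_prod_beta)
  qed simp
  also have "\<dots> = (\<Sum>(a, b)\<in>{(a, b). a + b = m}. ?c k a * coefficient (qprod t b) r)"
    unfolding m'(1) by (rule sum_monomial_splits_single[OF m'(2), symmetric])
  finally show ?case .
qed

lemma coefficient_qprod_0: "coefficient (qprod t m) 0 = (if m = 0 then 1 else (0 :: Qq))"
proof (cases "m = 0")
  case True
  then show ?thesis by (simp add: qprod_def one_symfun.rep_eq)
next
  case False
  have "homogeneous (\<Sum>j\<in>Poly_Mapping.keys m. Poly_Mapping.lookup m j) (qprod t m)"
    unfolding qprod_def by (intro homogeneous_prod homogeneous_qfun)
  then have "homogeneous (mdeg m) (qprod t m)" by (simp add: mdeg_def)
  moreover have "mdeg 0 \<noteq> mdeg m" using False by (metis mdeg_eq_0_iff)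
  ultimately show ?thesis using False by (auto simp: homogeneous_def)
qed

text \<open>Both sides count nonnegative integer matrices with given row and column sums, each weighted
  by \<open>1 - t\<close> to the number of nonzero entries.\<close>

lemma coefficient_qprod_sym:
  fixes t :: Qq
  shows "coefficient (qprod t r) m = coefficient (qprod t m) r"
proof -
  have "coefficient (qprod t r) m = coefficient (qprod t m) r"
    if "finite J" "Poly_Mapping.keys r \<subseteq> J" for J
    using that
  proof (induction J arbitrary: r m rule: finite_induct)
    case empty
    then have "r = 0" by simp
    then show ?case by (simp add: coefficient_qprod_0) (simp add: qprod_def one_symfun.rep_eq)
  next
    case (insert j J)
    define k where "k = Poly_Mapping.lookup r j"
    obtain r' where r': "r = r' + Poly_Mapping.single j k" "j \<notin> Poly_Mapping.keys r'"
      "Poly_Mapping.keys r' \<subseteq> Poly_Mapping.keys r"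
      unfolding k_def by (rule monomial_remove)
    have keys: "Poly_Mapping.keys r' \<subseteq> J" using r' insert.prems by auto
    have "coefficient (qprod t r) m =
        (\<Sum>(a, b)\<in>{(a, b). a + b = m}. coefficient (qfun t k) a * coefficient (qprod t r') b)"
      unfolding r'(1) qprod_add_single[OF r'(2)] times_symfun.rep_eq ..
    also have "\<dots> = (\<Sum>(a, b)\<in>{(a, b). a + b = m}. coefficient (qfun t k) a * coefficient (qprod t b) r')"
      using insert.IH[OF keys] by (simp only:)
    also have "\<dots> = coefficient (qprod t m) r"
      unfolding r'(1)
      by (rule coefficient_qprod_add_single[OF finite_keys order_refl r'(2), symmetric])
    finally show ?case .
  qed
  from this[OF finite_keys order_refl] show ?thesis .
qed

section \<open>Complete functions in the Schur basis\<close>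

definition list_mono :: "nat list \<Rightarrow> monomial" where
  "list_mono xs = mono_of (length xs) ((!) xs)"

lemma qprod_list_mono: "qprod t (list_mono xs) = prod_list (map (qfun t) xs)"
  unfolding list_mono_def qprod_mono_of
  by (simp add: prod.list_conv_set_nth lessThan_atLeast0)

text \<open>Both the Schur coefficient of h_\<beta> and the coefficient of x^\<beta> in s_\<mu> are
  signed sums over the same permutations, and exchanging indices with exponents at t = 0 matches the
  terms. This is the duality of h and m without a scalar product.\<close>

lemma complete_h_expansion:
  "prod_list (map complete_h xs) =
    (\<Sum>\<mu>\<in>partitions (sum_list xs). scale (coefficient (schur \<mu>) (list_mono xs)) (schur \<mu>))"
proof -
  let ?n = "sum_list xs"
  have f: "prod_list (map complete_h xs) = (qprod 0 (list_mono xs) :: Qq symfun)"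
    unfolding qprod_list_mono by (simp add: complete_h_eq_qfun[abs_def])
  have hom: "homogeneous ?n (qprod 0 (list_mono xs))"
    unfolding qprod_list_mono by (rule homogeneous_prod_list)
  have "schur_coeff ?n (qprod 0 (list_mono xs)) \<mu> = coefficient (schur \<mu>) (list_mono xs)"
    if \<mu>: "\<mu> \<in> partitions ?n" for \<mu>
  proof -
    show ?thesis
      unfolding schur_coeff_eq schur_eq_jacobi_trudi[OF partition_facts(1)[OF \<mu>]]
        jacobi_trudi_expand coefficient_sum
    proof (rule sum.cong)
      fix p :: "nat \<Rightarrow> nat"
      have eq: "coefficient (qprod 0 (list_mono xs)) (mono_of ?n (\<lambda>i. part \<mu> i + p i - i)) =
          coefficient (\<Prod>i<?n. complete_h (part \<mu> i + p i - i) :: Qq symfun) (list_mono xs)"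
        unfolding coefficient_qprod_sym[of 0 "list_mono xs"] qprod_mono_of complete_h_eq_qfun ..
      show "(of_int (sign p) :: Qq) * (if \<forall>i<?n. i \<le> part \<mu> i + p i
            then coefficient (qprod 0 (list_mono xs)) (mono_of ?n (\<lambda>i. part \<mu> i + p i - i)) else 0) =
          coefficient (scale (of_int (sign p)) (if \<forall>i<?n. i \<le> part \<mu> i + p i
            then \<Prod>i<?n. complete_h (part \<mu> i + p i - i) else 0)) (list_mono xs)"
        (is "_ * (if ?C then ?x else 0) = coefficient (scale _ (if ?C then ?g else 0)) _")
      proof (cases ?C)
        case True
        show ?thesis unfolding if_P[OF True] scale.rep_eq eq ..
      next
        case False
        show ?thesis unfolding if_not_P[OF False] by (simp add: scale.rep_eq zero_symfun.rep_eq)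
      qed
    qed simp
  qed
  then show ?thesis
    unfolding f by (subst homogeneous_schur_expansion[OF hom]) (rule sum.cong, simp_all)
qed

section \<open>The coefficient functional\<close>

text \<open>For a < n these are the coarsenings of (1^a, n - a), kept as lists so that the last part
  can be split off.\<close>

definition comp_lists :: "nat \<Rightarrow> nat \<Rightarrow> nat list set" where
  "comp_lists n a = {xs. 0 \<notin> set xs \<and> sum_list xs = n \<and> descents (Composition xs) \<subseteq> {1..a}}"

definition comp_weight :: "nat \<Rightarrow> nat list \<Rightarrow> Qq" where
  "comp_weight a xs = (\<Prod>i\<in>{1..a} - descents (Composition xs). q ^ i - 1)"

lemma finite_comp_lists: "finite (comp_lists n a)"
  by (rule finite_subset[OF _ finite_bounded_lists[of n]]) (auto simp: comp_lists_def)

lemma descents_list_subset: "0 \<notin> set xs \<Longrightarrow> descents (Composition xs) \<subseteq> {1..<sum_list xs}"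
  using descents_subset[of "Composition xs"] by (simp add: csize_def Composition_inverse)

text \<open>Here \<open>t\<close> is the largest descent, or 0 if there is none, and
  \<open>comp_lists t (t - 1)\<close> consists of all compositions of \<open>t\<close>. For t = 0
  the truncated bound leaves just the empty list.\<close>

lemma comp_lists_snoc:
  assumes "a < n"
  shows "comp_lists n a = (\<Union>t\<in>{..a}. (\<lambda>ys. ys @ [n - t]) ` comp_lists t (t - 1))"
proof (intro Set.set_eqI iffI)
  fix xs assume xs: "xs \<in> comp_lists n a"
  then have "xs \<noteq> []" using assms by (auto simp: comp_lists_def)
  then obtain ys k where ysk: "xs = ys @ [k]" by (cases xs rule: rev_cases) auto
  have nz: "0 \<notin> set ys" "0 < k" "sum_list ys + k = n" and
    D: "descents (Composition (ys @ [k])) \<subseteq> {1..a}"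
    using xs by (auto simp: comp_lists_def ysk)
  have "sum_list ys \<le> a"
    using D unfolding descents_snoc[OF nz(1,2)] by (cases "ys = []") auto
  moreover have "ys \<in> comp_lists (sum_list ys) (sum_list ys - 1)"
    using descents_list_subset[OF nz(1)] nz(1) by (force simp: comp_lists_def)
  moreover have "k = n - sum_list ys" using nz by simp
  ultimately show "xs \<in> (\<Union>t\<in>{..a}. (\<lambda>ys. ys @ [n - t]) ` comp_lists t (t - 1))"
    unfolding ysk by blast
next
  fix xs assume "xs \<in> (\<Union>t\<in>{..a}. (\<lambda>ys. ys @ [n - t]) ` comp_lists t (t - 1))"
  then obtain t ys where t: "t \<le> a" and ys: "ys \<in> comp_lists t (t - 1)" and xs: "xs = ys @ [n - t]"
    by blast
  have nz: "0 \<notin> set ys" "0 < n - t" and s: "sum_list ys = t"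
    using ys t assms by (auto simp: comp_lists_def)
  have "descents (Composition xs) \<subseteq> {1..a}"
  proof (cases "ys = []")
    case True
    then show ?thesis unfolding xs descents_snoc[OF nz] by simp
  next
    case False
    then have "t \<noteq> 0" using nz s by (cases ys) auto
    then show ?thesis
      using descents_list_subset[OF nz(1)] t False unfolding xs descents_snoc[OF nz] by (auto simp: s)
  qed
  with nz s t assms show "xs \<in> comp_lists n a" by (simp add: comp_lists_def xs)
qed

text \<open>Nothing above the largest descent \<open>t\<close> is a descent, so those indices all
  contribute, while \<open>t\<close> > 0 itself drops out.\<close>

lemma comp_weight_snoc:
  assumes "ys \<in> comp_lists t (t - 1)" "t \<le> a" "a < n"
  shows "comp_weight a (ys @ [n - t]) = (\<Prod>i=Suc t..a. q ^ i - 1) * comp_weight (t - 1) ys"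
proof -
  have nz: "0 \<notin> set ys" "0 < n - t" and s: "sum_list ys = t"
    using assms by (auto simp: comp_lists_def)
  have "{1..a} - descents (Composition (ys @ [n - t])) =
      {Suc t..a} \<union> ({1..t - 1} - descents (Composition ys))"
  proof (cases "ys = []")
    case True
    then show ?thesis using s unfolding descents_snoc[OF nz] by auto
  next
    case False
    then have "t \<noteq> 0" using nz s by (cases ys) auto
    then show ?thesis
      using descents_list_subset[OF nz(1)] assms(2) False unfolding descents_snoc[OF nz] by (force simp: s)
  qed
  moreover have "{Suc t..a} \<inter> ({1..t - 1} - descents (Composition ys)) = {}" by auto
  ultimately show ?thesis
    unfolding comp_weight_def by (simp add: prod.union_disjoint)
qed

lemma sum_comp_lists_snoc:
  fixes F :: "nat list \<Rightarrow> 'a::comm_monoid_add"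
  assumes "a < n"
  shows "(\<Sum>xs\<in>comp_lists n a. F xs) = (\<Sum>t\<le>a. \<Sum>ys\<in>comp_lists t (t - 1). F (ys @ [n - t]))"
proof -
  have "(\<Sum>xs\<in>comp_lists n a. F xs) =
      (\<Sum>t\<le>a. \<Sum>xs\<in>(\<lambda>ys. ys @ [n - t]) ` comp_lists t (t - 1). F xs)"
    unfolding comp_lists_snoc[OF assms]
    by (rule sum.UNION_disjoint, simp, use finite_comp_lists in blast) (auto simp: comp_lists_def)
  also have "\<dots> = (\<Sum>t\<le>a. \<Sum>ys\<in>comp_lists t (t - 1). F (ys @ [n - t]))"
    by (rule sum.cong[OF refl]) (subst sum.reindex, auto simp: inj_on_def)
  finally show ?thesis .
qed

lemma sum_comp_lists_factor:
  assumes "a < n"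
  shows "(\<Sum>xs\<in>comp_lists n a. rconst (comp_weight a xs) * prod_list (map y xs)) =
    (\<Sum>t\<le>a. rconst (\<Prod>i=Suc t..a. q ^ i - 1) * (\<Sum>ys\<in>comp_lists t (t - 1).
       rconst (comp_weight (t - 1) ys) * prod_list (map y ys)) * y (n - t))"
  unfolding sum_comp_lists_snoc[OF assms]
proof (rule sum.cong)
  fix t assume "t \<in> {..a}"
  then show "(\<Sum>ys\<in>comp_lists t (t - 1).
      rconst (comp_weight a (ys @ [n - t])) * prod_list (map y (ys @ [n - t]))) =
    rconst (\<Prod>i=Suc t..a. q ^ i - 1) * (\<Sum>ys\<in>comp_lists t (t - 1).
      rconst (comp_weight (t - 1) ys) * prod_list (map y ys)) * y (n - t)"
    unfolding sum_distrib_left sum_distrib_right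
    using assms by (intro sum.cong refl) (simp del: rconst_prod add: comp_weight_snoc mult_ac)
qed simp

lemma prod_q_power_split:
  assumes "t \<le> a"
  shows "rconst (\<Prod>i=Suc t..a. q ^ i - 1) * (rconst (\<Prod>i=1..t. q ^ i - 1) * x) =
    rconst (\<Prod>i=1..a. q ^ i - 1) * x"
proof -
  have "{1..a} = {Suc t..a} \<union> {1..t}" using assms by auto
  then have "(\<Prod>i=1..a. q ^ i - 1) = (\<Prod>i=Suc t..a. q ^ i - 1) * (\<Prod>i=1..t. q ^ i - 1)"
    by (simp only:) (rule prod.union_disjoint, auto)
  then show ?thesis by (simp only: rconst_simps(6) mult.assoc)
qed

text \<open>The product of 1 - x_i u cancels the denominators of the generating function of the q_r,
  leaving the product of 1 - t x_i u. Compare coefficients of u^N.\<close>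

lemma sum_drop_poly_qfun:
  assumes "finite B"
  shows "(\<Sum>r\<le>N. coeff (drop_poly B) r * ev B (qfun t (N - r))) = rconst t ^ N * coeff (drop_poly B) N"
  using assms
proof (induction B arbitrary: N rule: finite_induct)
  case empty
  have "(\<Sum>r\<le>N. coeff (drop_poly {}) r * ev {} (qfun t (N - r))) =
      (\<Sum>r\<le>N. if r = 0 then ev {} (qfun t N) else 0)"
    by (rule sum.cong) (auto simp: drop_poly_def)
  then show ?case by (cases N) (auto simp: drop_poly_def)
next
  case (insert y B)
  let ?c = "coeff (drop_poly B)" and ?Q = "\<lambda>r. ev (insert y B) (qfun t r)"
  have c: "drop_poly (insert y B) = drop_poly B - pCons 0 (smult (rvar y) (drop_poly B))"
    using insert.hyps by (simp add: drop_poly_def)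
  show ?case
  proof (cases N)
    case 0
    then show ?thesis using insert by simp
  next
    case (Suc M)
    have "(\<Sum>r\<le>N. coeff (drop_poly (insert y B)) r * ?Q (N - r)) =
        (\<Sum>r\<le>N. ?c r * ?Q (N - r)) -
        (\<Sum>r\<le>N. coeff (pCons 0 (smult (rvar y) (drop_poly B))) r * ?Q (N - r))"
      unfolding c by (simp add: sum_subtractf left_diff_distrib)
    also have "(\<Sum>r\<le>N. coeff (pCons 0 (smult (rvar y) (drop_poly B))) r * ?Q (N - r)) =
        (\<Sum>r\<le>M. rvar y * ?c r * ?Q (M - r))"
      unfolding Suc by (subst sum.atMost_Suc_shift) simp
    also have "(\<Sum>r\<le>N. ?c r * ?Q (N - r)) = (\<Sum>r\<le>M. ?c r * ?Q (Suc (M - r))) + ?c N"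
      unfolding Suc using insert.hyps by (simp add: Suc_diff_le)
    also have "(\<Sum>r\<le>M. ?c r * ?Q (Suc (M - r))) =
        (\<Sum>r\<le>M. rvar y * ?c r * ?Q (M - r)) + (\<Sum>r\<le>M. ?c r * ev B (qfun t (Suc (M - r)))) -
        rconst t * rvar y * (\<Sum>r\<le>M. ?c r * ev B (qfun t (M - r)))"
      unfolding ev_qfun_insert[OF insert.hyps]
      by (simp add: sum_distrib_left sum.distrib sum_subtractf algebra_simps)
    also have "(\<Sum>r\<le>M. ?c r * ev B (qfun t (M - r))) = rconst t ^ M * ?c M"
      by (rule insert.IH)
    also have "(\<Sum>r\<le>M. ?c r * ev B (qfun t (Suc (M - r)))) = rconst t ^ N * ?c N - ?c N"
      using insert.IH[of N] insert.hyps unfolding Suc by (simp add: Suc_diff_le algebra_simps)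
    finally show ?thesis
      unfolding c by (simp add: Suc algebra_simps)
  qed
qed

text \<open>Splitting off the last part leaves the previous lemma's sum without its top term, that
  is, q^n - 1 times (-1)^n e_n. This extra factor prolongs the product of the q^i - 1 by one, which
  is why the weights have this form.\<close>

lemma sum_comp_lists_qfun:
  "(\<Sum>ys\<in>comp_lists t (t - 1). rconst (comp_weight (t - 1) ys) *
      prod_list (map (\<lambda>r. ev {..<k} (qfun q r)) ys)) =
    rconst (\<Prod>i=1..t. q ^ i - 1) * coeff (drop_poly {..<k}) t"
proof (induction t rule: less_induct)
  case (less n)
  let ?y = "\<lambda>r. ev {..<k} (qfun q r)" and ?g = "coeff (drop_poly {..<k})"
  show ?case
  proof (cases n)
    case 0
    have "comp_lists 0 0 = {[]}"
      by (auto simp: comp_lists_def descents_def clength_def Composition_inverse)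
        (metis list.exhaust list.set_intros(1))
    moreover have "?g 0 = 1"
      by (simp add: drop_poly_def coeff_0_prod_list flip: poly_0_coeff_0) (simp add: poly_prod)
    ultimately show ?thesis using 0
      by (simp add: comp_weight_def)
  next
    case (Suc m)
    have "(\<Sum>xs\<in>comp_lists n m. rconst (comp_weight m xs) * prod_list (map ?y xs)) =
        (\<Sum>t\<le>m. rconst (\<Prod>i=Suc t..m. q ^ i - 1) * (\<Sum>ys\<in>comp_lists t (t - 1).
          rconst (comp_weight (t - 1) ys) * prod_list (map ?y ys)) * ?y (n - t))"
      by (rule sum_comp_lists_factor) (simp add: Suc)
    also have "\<dots> = (\<Sum>t\<le>m. rconst (\<Prod>i=1..m. q ^ i - 1) * (?g t * ?y (n - t)))"
    proof (rule sum.cong)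
      fix t assume "t \<in> {..m}"
      then have t: "t \<le> m" "t < n" by (simp_all add: Suc)
      show "rconst (\<Prod>i=Suc t..m. q ^ i - 1) * (\<Sum>ys\<in>comp_lists t (t - 1).
          rconst (comp_weight (t - 1) ys) * prod_list (map ?y ys)) * ?y (n - t) =
        rconst (\<Prod>i=1..m. q ^ i - 1) * (?g t * ?y (n - t))"
        unfolding less.IH[OF t(2)] mult.assoc by (rule prod_q_power_split[OF t(1)])
    qed simp
    \<comment> \<open>The missing term t = n is the coefficient of index n alone, because q_0 =
      1.\<close>
    also have "\<dots> = rconst (\<Prod>i=1..m. q ^ i - 1) * ((\<Sum>t\<le>n. ?g t * ?y (n - t)) - ?g n)"
      by (simp add: sum_distrib_left Suc)
    also have "\<dots> = rconst (\<Prod>i=1..m. q ^ i - 1) * ((rconst q ^ n - 1) * ?g n)"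
      by (subst sum_drop_poly_qfun) (simp_all add: algebra_simps)
    also have "\<dots> = rconst (\<Prod>i=1..n. q ^ i - 1) * ?g n"
      by (simp add: Suc mult_ac)
    finally show ?thesis by (simp add: Suc)
  qed
qed

text \<open>With only k \<le> a variables the elementary functions beyond k vanish, so restricting
  the largest descent to at most a loses nothing. The completed sum is a multiple of e_n, which is 0
  as n > k.\<close>

lemma sum_comp_lists_qfun_eq_0:
  assumes "k \<le> a" "a < n"
  shows "(\<Sum>xs\<in>comp_lists n a. rconst (comp_weight a xs) *
      prod_list (map (\<lambda>r. ev {..<k} (qfun q r)) xs)) = 0"
proof -
  let ?y = "\<lambda>r. ev {..<k} (qfun q r)" and ?g = "coeff (drop_poly {..<k})"
  have zero: "?g t = 0" if "k < t" for t
    using degree_drop_poly[of "{..<k}"] that by (intro coeff_eq_0) auto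
  have "(\<Sum>xs\<in>comp_lists n a. rconst (comp_weight a xs) * prod_list (map ?y xs)) =
      (\<Sum>t\<le>a. rconst (\<Prod>i=1..a. q ^ i - 1) * (?g t * ?y (n - t)))"
    unfolding sum_comp_lists_factor[OF assms(2)] sum_comp_lists_qfun
    by (intro sum.cong refl, unfold mult.assoc) (simp only: prod_q_power_split atMost_iff)
  also have "\<dots> = rconst (\<Prod>i=1..a. q ^ i - 1) * (\<Sum>t\<le>n. ?g t * ?y (n - t))"
    unfolding sum_distrib_left using assms zero by (intro sum.mono_neutral_left) auto
  also have "\<dots> = 0"
    using zero[of n] assms by (simp add: sum_drop_poly_qfun)
  finally show ?thesis .
qed

definition comp_functional :: "nat \<Rightarrow> nat \<Rightarrow> Qq symfun \<Rightarrow> Qq" where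
  "comp_functional n a f = (\<Sum>xs\<in>comp_lists n a. comp_weight a xs * coefficient f (list_mono xs))"

lemma comp_functional_simps:
  "comp_functional n a 0 = 0"
  "comp_functional n a (f + g) = comp_functional n a f + comp_functional n a g"
  "comp_functional n a (scale c f) = c * comp_functional n a f"
  by (simp_all add: comp_functional_def zero_symfun.rep_eq plus_symfun.rep_eq scale.rep_eq
    distrib_left sum.distrib sum_distrib_left mult_ac)

lemma comp_functional_qspan:
  assumes "f \<in> qspan q k d" "k \<le> a" "a < n"
  shows "comp_functional n a f = 0"
  using assms(1)
proof (induction rule: qspan.induct)
  case (prod rs)
  \<comment> \<open>After the exchange of indices and exponents, the functional on the product over
    \<open>rs\<close> is one coefficient of \<open>F\<close>. Its monomial uses only
    \<open>k\<close> variables, where \<open>F\<close> vanishes.\<close>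
  define F where "F = (\<Sum>xs\<in>comp_lists n a. scale (comp_weight a xs) (qprod q (list_mono xs)))"
  have "ev {..<k} F = (\<Sum>xs\<in>comp_lists n a. rconst (comp_weight a xs) *
      prod_list (map (\<lambda>r. ev {..<k} (qfun q r)) xs))"
  proof -
    have "ev {..<k} (prod_list (map (qfun q) xs)) = prod_list (map (\<lambda>r. ev {..<k} (qfun q r)) xs)" for xs
      by (induction xs) simp_all
    then show ?thesis by (simp add: F_def qprod_list_mono)
  qed
  also have "\<dots> = ev {..<k} 0"
    using sum_comp_lists_qfun_eq_0[OF assms(2,3)] by simp
  finally have "coefficient F (list_mono rs) = coefficient 0 (list_mono rs)"
    using keys_mono_of[of "length rs" "(!) rs"] prod(1) by (intro ev_eqD) (auto simp: list_mono_def)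
  moreover have "coefficient F m = (\<Sum>xs\<in>comp_lists n a. comp_weight a xs *
      coefficient (qprod q (list_mono xs)) m)" for m
    by (simp add: F_def scale.rep_eq coefficient_sum)
  ultimately show ?case
    unfolding comp_functional_def qprod_list_mono[symmetric] coefficient_qprod_sym[of q "list_mono rs"]
    by (simp add: zero_symfun.rep_eq)
qed (simp_all add: comp_functional_simps)

section \<open>Partitions with more than \<open>a\<close> parts\<close>

lemma hl_sum_eq_0:
  assumes "finite A" "card A < length \<nu>"
  shows "hl_sum t \<nu> A = 0"
  using assms
proof (induction \<nu> arbitrary: A)
  case (Cons k \<nu>)
  have "hl_sum t \<nu> (A - {i}) = 0" if "i \<in> A" for i
    using Cons.prems that card_gt_0_iff[of A] by (intro Cons.IH) auto
  then show ?case by simp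
qed simp

lemma ordered_sum_cong:
  assumes "finite A" "\<And>i. i < card A \<Longrightarrow> e i = e' i"
  shows "ordered_sum t e A = ordered_sum t e' A"
  using assms
proof (induction "card A" arbitrary: A e e')
  case (Suc n)
  have ne: "A \<noteq> {}" using Suc.hyps(2) by auto
  have "ordered_sum t (e \<circ> Suc) (A - {i}) = ordered_sum t (e' \<circ> Suc) (A - {i})" if "i \<in> A" for i
    using Suc.prems Suc.hyps(2) that by (intro Suc.hyps(1)) auto
  moreover have "e 0 = e' 0" using Suc.prems(2)[of 0] Suc.hyps(2) by simp
  ultimately show ?case
    unfolding ordered_sum_rec[OF Suc.prems(1) ne] by (intro sum.cong) auto
qed simp

lemma ordered_sum_Suc:
  assumes "finite A"
  shows "ordered_sum t (\<lambda>i. Suc (e i)) A = (\<Prod>i\<in>A. rvar i) * ordered_sum t e A"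
  using assms
proof (induction "card A" arbitrary: A e)
  case (Suc n)
  have ne: "A \<noteq> {}" using Suc.hyps(2) by auto
  have comp: "(\<lambda>i. Suc (e i)) \<circ> Suc = (\<lambda>i. Suc ((e \<circ> Suc) i))" by auto
  have "ordered_sum t (\<lambda>i. Suc ((e \<circ> Suc) i)) (A - {i}) =
      (\<Prod>j\<in>A - {i}. rvar j) * ordered_sum t (e \<circ> Suc) (A - {i})" if "i \<in> A" for i
    using Suc.prems Suc.hyps(2) that by (intro Suc.hyps(1)) auto
  moreover have "(\<Prod>j\<in>A. rvar j) = rvar i * (\<Prod>j\<in>A - {i}. rvar j)" if "i \<in> A" for i
    using Suc.prems that by (rule prod.remove)
  ultimately show ?case
    unfolding ordered_sum_rec[OF Suc.prems(1) ne] comp sum_distrib_left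
    by (intro sum.cong refl) (simp add: mult_ac)
qed simp

lemma hl_v_part_nonzero: "hl_v_part \<nu> n \<noteq> 0"
  using hl_v_nonzero by (simp add: hl_v_part_def)

lemma ordered_sum_eq_P:
  assumes "0 \<notin> set \<nu>" "length \<nu> \<le> n"
  shows "ordered_sum q (part \<nu>) {..<n} = rconst (hl_v_part \<nu> n) * ev {..<n} (hall_littlewood_P \<nu>)"
  using ordered_sum_eq_hl_sum[OF assms(2)] hall_littlewood_P_props(2)[OF assms(1), of "{..<n}"]
    hl_v_part_nonzero[of \<nu> n]
  by (simp add: divide_eq_eq mult.commute)

text \<open>Deletes the first column of the Young diagram; parts equal to 1 disappear.\<close>

definition remove_column :: "nat list \<Rightarrow> nat list" where
  "remove_column \<nu> = filter (\<lambda>x. x \<noteq> 0) (map (\<lambda>x. x - 1) \<nu>)"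

lemma part_Cons_Suc [simp]: "part (k # \<nu>) (Suc i) = part \<nu> i"
  by (simp add: part_def)

lemma part_filter_nonzero:
  "sorted_wrt (\<ge>) l \<Longrightarrow> part (filter (\<lambda>x. x \<noteq> 0) l) i = part l i"
proof (induction l arbitrary: i)
  case (Cons x l)
  show ?case
  proof (cases "x = 0")
    case True
    then have "\<forall>y\<in>set l. y = 0" using Cons.prems by auto
    then show ?thesis using True by (cases i) (auto simp: part_def filter_empty_conv)
  next
    case False
    then show ?thesis using Cons by (cases i) auto
  qed
qed simp

lemma part_remove_column:
  assumes "\<nu> \<in> partitions n"
  shows "part (remove_column \<nu>) i = part \<nu> i - 1"
proof -
  have "sorted_wrt (\<ge>) (map (\<lambda>x. x - 1) \<nu>)"
    using assms by (auto simp: partitions_def sorted_wrt_map intro: sorted_wrt_mono_rel[rotated])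
  then show ?thesis
    unfolding remove_column_def by (subst part_filter_nonzero) (auto simp: part_def)
qed

text \<open>In exactly as many variables as parts every exponent is positive, so the product of all
  variables factors out of the symmetrising sum. The two normalising constants remain because
  multiplicities change when parts become 0.\<close>

lemma coefficient_P_remove_column:
  assumes "\<nu> \<in> partitions n" "length \<nu> = m" "Poly_Mapping.keys r \<subseteq> {..<m}"
  shows "hl_v_part \<nu> m * coefficient (hall_littlewood_P \<nu>) (mono_of m (\<lambda>_. 1) + r) =
    hl_v_part (remove_column \<nu>) m * coefficient (hall_littlewood_P (remove_column \<nu>)) r"
proof -
  let ?k = "remove_column \<nu>"
  have nz: "0 \<notin> set \<nu>" "0 \<notin> set ?k" using assms by (auto simp: partitions_def remove_column_def)
  have len: "length ?k \<le> m"
    using length_filter_le[of "\<lambda>x. x \<noteq> 0" "map (\<lambda>x. x - 1) \<nu>"] assms(2) by (simp add: remove_column_def)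
  have "part \<nu> i = Suc (part ?k i)" if "i < m" for i
  proof -
    have "part \<nu> i \<noteq> 0" using nz(1) that assms(2) by (metis nth_mem part_def)
    then show ?thesis using part_remove_column[OF assms(1)] by simp
  qed
  then have "ordered_sum q (part \<nu>) {..<m} = ordered_sum q (\<lambda>i. Suc (part ?k i)) {..<m}"
    by (intro ordered_sum_cong) auto
  also have "\<dots> = (\<Prod>i<m. rvar i ^ 1) * ordered_sum q (part ?k) {..<m}"
    by (simp add: ordered_sum_Suc)
  finally have "rconst (hl_v_part \<nu> m) * ev {..<m} (hall_littlewood_P \<nu>) =
      to_fract (Poly_Mapping.single (mono_of m (\<lambda>_. 1)) 1) *
      (rconst (hl_v_part ?k m) * ev {..<m} (hall_littlewood_P ?k))"
    unfolding prod_rvar_power ordered_sum_eq_P[OF nz(1) eq_imp_le[OF assms(2)]] ordered_sum_eq_P[OF nz(2) len] .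
  then have "Poly_Mapping.single 0 (hl_v_part \<nu> m) * restrict_to {..<m} (hall_littlewood_P \<nu>) =
      Poly_Mapping.single (mono_of m (\<lambda>_. 1)) 1 *
      (Poly_Mapping.single 0 (hl_v_part ?k m) * restrict_to {..<m} (hall_littlewood_P ?k))"
    unfolding rconst_def ev_def to_fract_mult[symmetric] to_fract_eq_iff .
  then have "Poly_Mapping.lookup (Poly_Mapping.single 0 (hl_v_part \<nu> m) *
        restrict_to {..<m} (hall_littlewood_P \<nu>)) (mono_of m (\<lambda>_. 1) + r) =
      Poly_Mapping.lookup (Poly_Mapping.single 0 (hl_v_part ?k m) * restrict_to {..<m} (hall_littlewood_P ?k)) r"
    by (simp only: lookup_single_mult mult_1_left)
  then show ?thesis
    using assms(3) keys_mono_of[of m] by (simp add: restrict_to.rep_eq keys_add_nat)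
qed

lemma hl_v_0 [simp]: "hl_v 0 = 1"
  by (simp add: hl_v_def)

lemma hl_v_1 [simp]: "hl_v (Suc 0) = 1"
  using q_neq_1 by (simp add: hl_v_def)

lemma coefficient_P_single:
  assumes "0 \<notin> set \<kappa>"
  shows "coefficient (hall_littlewood_P \<kappa>) (Poly_Mapping.single a (sum_list \<kappa>)) =
      (if length \<kappa> \<le> 1 then 1 else 0)"
    and "length \<kappa> > 1 \<Longrightarrow> coefficient (hall_littlewood_P \<kappa>) (Poly_Mapping.single a c) = 0"
proof -
  have keys: "Poly_Mapping.keys (Poly_Mapping.single a c) \<subseteq> {a}" for c :: nat by simp
  have ev: "ev {a} (hall_littlewood_P \<kappa>) = hl_sum q \<kappa> {a} / rconst (P_denom \<kappa>)"
    by (rule hall_littlewood_P_props(2)[OF assms]) simp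
  show big: "coefficient (hall_littlewood_P \<kappa>) (Poly_Mapping.single a c) = 0" if "length \<kappa> > 1" for c
  proof -
    have "ev {a} (hall_littlewood_P \<kappa>) = ev {a} 0"
      unfolding ev using that by (simp add: hl_sum_eq_0)
    from ev_eqD[OF this _ keys] show ?thesis by (simp add: zero_symfun.rep_eq)
  qed
  show "coefficient (hall_littlewood_P \<kappa>) (Poly_Mapping.single a (sum_list \<kappa>)) =
      (if length \<kappa> \<le> 1 then 1 else 0)"
  proof (cases "length \<kappa> \<le> 1")
    case True
    have one: "1 - rconst q \<noteq> 0" using q_neq_1 rconst_eq_iff[of q 1] by simp
    from True consider "\<kappa> = []" | c where "\<kappa> = [c]"
      by (cases \<kappa>) auto
    then have "ev {a} (hall_littlewood_P \<kappa>) = ev {a} (complete_h (sum_list \<kappa>))"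
    proof cases
      case 1
      then show ?thesis unfolding ev by (simp add: P_denom_def complete_h_eq_qfun)
    next
      case (2 c)
      then show ?thesis unfolding ev using one
        by (simp add: P_denom_def ev_singleton_h hl_factor_def)
    qed
    from ev_eqD[OF this _ keys] show ?thesis using True by (simp add: complete_h.rep_eq)
  qed (simp add: big)
qed

lemma count_list_replicate: "count_list (replicate n x) y = (if x = y then n else 0)"
  by (induction n) auto

text \<open>The monomial is the product of the a + 1 variables times x_a^(b-1). Removing a column
  leaves a coefficient at a power of one variable, which is nonzero only if at most one row
  survives.\<close>

lemma hook_coefficient:
  assumes "\<nu> \<in> partitions (a + b)" "length \<nu> = Suc a" "b \<ge> 1"
  shows "coefficient (hall_littlewood_P \<nu>) (list_mono (replicate a 1 @ [b])) =
    (if \<nu> = b # replicate a 1 then 1 else 0)"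
proof -
  let ?k = "remove_column \<nu>"
  have nz: "0 \<notin> set ?k" "0 \<notin> set \<nu>" and sum: "sum_list \<nu> = a + b"
    using assms(1) by (auto simp: remove_column_def partitions_def)
  have mono: "list_mono (replicate a 1 @ [b]) = mono_of (Suc a) (\<lambda>_. 1) + Poly_Mapping.single a (b - 1)"
    by (rule poly_mapping_eqI)
      (use assms(3) in \<open>auto simp: list_mono_def lookup_mono_of lookup_add lookup_single when_def nth_append\<close>)
  have main: "hl_v_part \<nu> (Suc a) * coefficient (hall_littlewood_P \<nu>) (list_mono (replicate a 1 @ [b])) =
      hl_v_part ?k (Suc a) * coefficient (hall_littlewood_P ?k) (Poly_Mapping.single a (b - 1))"
    unfolding mono by (rule coefficient_P_remove_column[OF assms(1,2)]) auto
  show ?thesis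
  proof (cases "\<nu> = b # replicate a 1")
    case True
    have k: "?k = (if b = 1 then [] else [b - 1])"
      using assms(3) by (auto simp: True remove_column_def)
    then have "coefficient (hall_littlewood_P ?k) (Poly_Mapping.single a (b - 1)) = 1"
      using coefficient_P_single(1)[OF nz(1), of a] by (simp split: if_splits)
    \<comment> \<open>The ones of \<nu> turn into padding zeros of the same multiplicity, and a
      first part b > 1 keeps multiplicity 1, so both constants are the same product.\<close>
    moreover have "hl_v_part ?k (Suc a) = hl_v_part \<nu> (Suc a)"
    proof (cases "b = 1")
      case b1: True
      then have \<nu>: "\<nu> = replicate (Suc a) 1" using True by simp
      have "?k = []" using k b1 by simp
      then show ?thesis
        unfolding hl_v_part_def by (simp add: \<nu> count_list_replicate del: replicate.simps)
    next
      case False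
      then have "?k = [b - 1]" using k by simp
      moreover have "(\<Prod>i\<in>set \<nu>. hl_v (count_list \<nu> i)) = hl_v a"
      proof (cases "a = 0")
        case a: False
        then have "set \<nu> = {b, 1}" using True by simp
        with False show ?thesis by (simp add: True count_list_replicate)
      qed (simp add: True)
      ultimately show ?thesis by (simp add: hl_v_part_def True)
    qed
    ultimately show ?thesis using main True hl_v_part_nonzero[of \<nu> "Suc a"] by simp
  next
    case False
    \<comment> \<open>If at most one row survived, every part after the first would be 1 and the
      size would force \<nu> to be the hook.\<close>
    have "length ?k > 1"
    proof (rule ccontr)
      assume "\<not> length ?k > 1"
      then have one: "part \<nu> i = 1" if "0 < i" "i < Suc a" for i
      proof -
        have "part ?k i = 0" using \<open>\<not> length ?k > 1\<close> that by (simp add: part_def)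
        moreover have "part \<nu> i \<noteq> 0" using nz(2) that assms(2) by (metis nth_mem part_def)
        ultimately show ?thesis using part_remove_column[OF assms(1), of i] by simp
      qed
      obtain c \<nu>' where c: "\<nu> = c # \<nu>'" using assms(2) by (cases \<nu>) auto
      have "\<nu>' = replicate a 1"
      proof (rule nth_equalityI)
        fix i assume "i < length \<nu>'"
        then show "\<nu>' ! i = replicate a 1 ! i" using one[of "Suc i"] assms(2) c by (simp add: part_def)
      qed (use assms(2) c in simp)
      with sum c False show False by (simp add: sum_list_replicate)
    qed
    then have "coefficient (hall_littlewood_P ?k) (Poly_Mapping.single a (b - 1)) = 0"
      by (rule coefficient_P_single(2)[OF nz(1)])
    then show ?thesis using main False hl_v_part_nonzero[of \<nu> "Suc a"] by simp
  qed
qed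

lemma sum_list_eq_length:
  "0 \<notin> set xs \<Longrightarrow> sum_list xs = length xs \<Longrightarrow> xs = replicate (length xs) (1 :: nat)"
proof (induction xs)
  case (Cons x xs)
  then have "x = 1" "sum_list xs = length xs" using length_le_sum_list[of xs] by auto
  with Cons show ?case by simp
qed simp

lemma comp_lists_length:
  assumes "xs \<in> comp_lists n a" "a < n"
  shows "length xs \<le> Suc a" "length xs = Suc a \<Longrightarrow> xs = replicate a 1 @ [n - a]"
proof -
  obtain t ys where t: "t \<le> a" "ys \<in> comp_lists t (t - 1)" "xs = ys @ [n - t]"
    using assms(1) unfolding comp_lists_snoc[OF assms(2)] by blast
  have ys: "0 \<notin> set ys" "sum_list ys = t" using t(2) by (auto simp: comp_lists_def)
  from length_le_sum_list[OF ys(1)] t ys show "length xs \<le> Suc a" by simp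
  assume "length xs = Suc a"
  then have "t = a" "length ys = a" using length_le_sum_list[OF ys(1)] t ys by auto
  with sum_list_eq_length[OF ys(1)] ys t show "xs = replicate a 1 @ [n - a]" by simp
qed

lemma parts_hook: "b \<ge> 1 \<Longrightarrow> parts (Composition (replicate a 1 @ [b])) = replicate a 1 @ [b]"
  by (rule Composition_inverse) auto

lemma descents_hook:
  assumes "b \<ge> 1"
  shows "descents (Composition (replicate a 1 @ [b])) = {1..a}"
proof -
  have "{F k | k. 1 \<le> k \<and> k < Suc a} = {1..a}" if "\<And>k. k \<le> a \<Longrightarrow> F k = k" for F :: "nat \<Rightarrow> nat"
    using that by (force simp: less_Suc_eq_le)
  from this[of "\<lambda>k. sum_list (take k (replicate a 1 @ [b]))"] show ?thesis
    unfolding descents_def clength_def parts_hook[OF assms] by (simp add: sum_list_replicate)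
qed

lemma comp_functional_P:
  assumes \<nu>: "\<nu> \<in> partitions (a + b)" and b: "b \<ge> 1"
  shows "comp_functional (a + b) a (hall_littlewood_P \<nu>) = (if \<nu> = b # replicate a 1 then 1 else 0)"
proof (cases "length \<nu> \<le> a")
  case True
  have "hall_littlewood_P \<nu> \<in> qspan q (length \<nu>) (sum_list \<nu>)"
    using \<nu> by (intro hall_littlewood_P_props) (simp add: partitions_def)
  then have "comp_functional (a + b) a (hall_littlewood_P \<nu>) = 0"
    using True b by (intro comp_functional_qspan) auto
  with True show ?thesis by auto
next
  case False
  let ?x = "replicate a 1 @ [b]"
  let ?F = "\<lambda>xs. comp_weight a xs * coefficient (hall_littlewood_P \<nu>) (list_mono xs)"
  have nz: "0 \<notin> set \<nu>" using \<nu> by (simp add: partitions_def)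
  \<comment> \<open>A monomial in fewer variables than \<nu> has parts cannot occur in
    P_\<nu>.\<close>
  have small: "coefficient (hall_littlewood_P \<nu>) (list_mono xs) = 0" if "length xs < length \<nu>" for xs
  proof -
    have "ev {..<length xs} (hall_littlewood_P \<nu>) = ev {..<length xs} 0"
      using hall_littlewood_P_props(2)[OF nz, of "{..<length xs}"] that by (simp add: hl_sum_eq_0)
    from ev_eqD[OF this _ keys_mono_of] show ?thesis
      by (simp add: list_mono_def zero_symfun.rep_eq)
  qed
  have x: "?x \<in> comp_lists (a + b) a"
    using b descents_hook[OF b, of a] by (auto simp: comp_lists_def sum_list_replicate)
  have "?F xs = 0" if xs: "xs \<in> comp_lists (a + b) a - {?x}" for xs
  proof -
    have "length xs \<le> Suc a" "length xs \<noteq> Suc a"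
      using comp_lists_length[of xs "a + b" a] xs b by auto
    then show ?thesis using small[of xs] False by simp
  qed
  then have "comp_functional (a + b) a (hall_littlewood_P \<nu>) = (\<Sum>xs\<in>{?x}. ?F xs)"
    unfolding comp_functional_def using x finite_comp_lists by (intro sum.mono_neutral_right) auto
  also have "\<dots> = coefficient (hall_littlewood_P \<nu>) (list_mono ?x)"
    using descents_hook[OF b, of a] by (simp add: comp_weight_def)
  also have "\<dots> = (if \<nu> = b # replicate a 1 then 1 else 0)"
  proof (cases "length \<nu> = Suc a")
    case True
    then show ?thesis by (rule hook_coefficient[OF \<nu> _ b])
  next
    case ne: False
    then have "\<nu> \<noteq> b # replicate a 1" by auto
    moreover have "coefficient (hall_littlewood_P \<nu>) (list_mono ?x) = 0"
      using False ne by (intro small) simp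
    ultimately show ?thesis by simp
  qed
  finally show ?thesis .
qed

section \<open>The noncommutative side\<close>

lemma clength_eq_card_descents:
  assumes "csize \<beta> > 0"
  shows "clength \<beta> = Suc (card (descents \<beta>))"
proof -
  have "length xs = Suc (card (descents (Composition xs)))" if "0 \<notin> set xs" "xs \<noteq> []" for xs
    using that
  proof (induction xs rule: rev_induct)
    case (snoc k xs)
    then have nz: "0 \<notin> set xs" "0 < k" by auto
    show ?case
    proof (cases "xs = []")
      case True
      then show ?thesis using descents_snoc[OF nz] by simp
    next
      case False
      have "finite (descents (Composition xs))" "sum_list xs \<notin> descents (Composition xs)"
        using descents_list_subset[OF nz(1)] finite_subset by auto
      then show ?thesis using False snoc.IH nz descents_snoc[OF nz] by simp
    qed
  qed simp
  from this[of "parts \<beta>"] show ?thesis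
    using assms parts[of \<beta>]
    by (cases "parts \<beta> = []") (auto simp: clength_def csize_def parts_inverse)
qed

lemma chi_0: "chi 0 = 0"
  by (simp add: chi_def)

lemma chi_sum: "chi (sum F A) = (\<Sum>x\<in>A. chi (F x))"
  by (induction A rule: infinite_finite_induct) (simp_all add: chi_0 chi_add)

lemma chi_uminus: "chi (- F) = - chi F"
  using chi_add[of F "- F"] by (simp add: chi_0 eq_neg_iff_add_eq_0 add.commute)

lemma chi_sign_mult: "chi ((- 1) ^ k * F) = scale ((- 1) ^ k) (chi F)"
  by (cases "even k") (simp_all add: chi_uminus scale_simps scale_minus_one)

lemma chi_nc_h_comp: "chi (nc_h_comp \<gamma>) = prod_list (map complete_h (parts \<gamma>))"
  by (simp add: nc_h_comp_eq_single chi_single scale_simps)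

lemma chi_ribbon:
  "chi (ribbon \<beta>) = (\<Sum>\<gamma>\<in>coarsenings \<beta>. scale ((- 1) ^ (clength \<beta> - clength \<gamma>))
     (prod_list (map complete_h (parts \<gamma>))))"
  by (simp add: ribbon_def chi_sum chi_sign_mult chi_nc_h_comp)

text \<open>Expand the product of q^i + (-1) over the elements of {1..a} outside D(\<gamma>). A
  choice of the subset X receiving q^i is the same as a composition \<beta> with D(\<beta>) = {1..a}
  - X, which lies between \<gamma> and \<alpha>.\<close>

lemma sum_refinements:
  assumes \<alpha>: "descents \<alpha> = {1..a}" "csize \<alpha> > 0" and \<gamma>: "\<gamma> \<in> coarsenings \<alpha>"
  shows "(\<Sum>\<beta>\<in>{\<beta> \<in> coarsenings \<alpha>. \<gamma> \<in> coarsenings \<beta>}.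
      q ^ c_stat \<alpha> (complement \<beta>) * (- 1) ^ (clength \<beta> - clength \<gamma>)) = comp_weight a (parts \<gamma>)"
proof -
  let ?R = "{1..a} - descents \<gamma>"
  let ?B = "{\<beta> \<in> coarsenings \<alpha>. \<gamma> \<in> coarsenings \<beta>}"
  have an: "{1..a} \<subseteq> {1..<csize \<alpha>}" using descents_subset[of \<alpha>] \<alpha> by simp
  have fin: "finite (descents \<beta>)" for \<beta> using descents_subset finite_subset by blast
  have B: "\<beta> \<in> ?B \<longleftrightarrow> csize \<beta> = csize \<alpha> \<and> descents \<gamma> \<subseteq> descents \<beta> \<and> descents \<beta> \<subseteq> {1..a}" for \<beta>
    using \<gamma> \<alpha> by (auto simp: coarsenings_def)
  have \<gamma>': "csize \<gamma> = csize \<alpha>" "descents \<gamma> \<subseteq> {1..a}" using \<gamma> \<alpha> by (auto simp: coarsenings_def)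
  have "comp_weight a (parts \<gamma>) = (\<Prod>i\<in>?R. q ^ i + (- 1))"
    by (simp add: comp_weight_def parts_inverse)
  also have "\<dots> = (\<Sum>X\<in>Pow ?R. (\<Prod>i\<in>X. q ^ i) * (\<Prod>i\<in>?R - X. - 1))"
    by (rule prod_add) simp
  also have "\<dots> = (\<Sum>\<beta>\<in>?B. (\<Prod>i\<in>{1..a} - descents \<beta>. q ^ i) * (\<Prod>i\<in>?R - ({1..a} - descents \<beta>). - 1))"
  proof (rule sum.reindex_bij_betw[symmetric])
    show "bij_betw (\<lambda>\<beta>. {1..a} - descents \<beta>) ?B (Pow ?R)"
    proof (rule bij_betwI')
      fix \<beta> \<beta>' assume *: "\<beta> \<in> ?B" "\<beta>' \<in> ?B"
      show "{1..a} - descents \<beta> = {1..a} - descents \<beta>' \<longleftrightarrow> \<beta> = \<beta>'"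
      proof
        assume "{1..a} - descents \<beta> = {1..a} - descents \<beta>'"
        with * have "descents \<beta> = descents \<beta>'" unfolding B by blast
        with * show "\<beta> = \<beta>'" unfolding B by (intro descents_inject) auto
      qed simp
    next
      fix \<beta> assume "\<beta> \<in> ?B"
      then show "{1..a} - descents \<beta> \<in> Pow ?R" unfolding B by blast
    next
      fix X assume X: "X \<in> Pow ?R"
      have "{1..a} - X \<subseteq> {1..<csize \<alpha>}" using an by blast
      then obtain \<beta> where \<beta>: "csize \<beta> = csize \<alpha>" "descents \<beta> = {1..a} - X"
        using ex_composition_descents by blast
      have "\<beta> \<in> ?B" unfolding B using \<beta> X \<gamma>' by auto
      moreover have "X = {1..a} - descents \<beta>" using \<beta> X by auto
      ultimately show "\<exists>\<beta>\<in>?B. X = {1..a} - descents \<beta>" by blast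
    qed
  qed
  also have "\<dots> = (\<Sum>\<beta>\<in>?B. q ^ c_stat \<alpha> (complement \<beta>) * (- 1) ^ (clength \<beta> - clength \<gamma>))"
  proof (rule sum.cong)
    fix \<beta> assume "\<beta> \<in> ?B"
    then have \<beta>: "csize \<beta> = csize \<alpha>" "descents \<gamma> \<subseteq> descents \<beta>" "descents \<beta> \<subseteq> {1..a}"
      unfolding B by auto
    \<comment> \<open>As D(\<alpha>) = {1..a}, the statistic adds up precisely the elements of X;
      the rest of the product runs over D(\<beta>) - D(\<gamma>) and gives the sign.\<close>
    have "descents \<alpha> \<inter> descents (complement \<beta>) = {1..a} - descents \<beta>"
      unfolding complement(2) \<alpha> \<beta>(1) using an by blast
    then have "c_stat \<alpha> (complement \<beta>) = \<Sum>({1..a} - descents \<beta>)" by (simp add: c_stat_def)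
    then have "q ^ c_stat \<alpha> (complement \<beta>) = (\<Prod>i\<in>{1..a} - descents \<beta>. q ^ i)"
      by (simp add: power_sum)
    moreover have "?R - ({1..a} - descents \<beta>) = descents \<beta> - descents \<gamma>" using \<beta> by blast
    moreover have "card (descents \<beta> - descents \<gamma>) = clength \<beta> - clength \<gamma>"
      using \<beta> \<gamma>' \<alpha> fin by (simp add: card_Diff_subset clength_eq_card_descents)
    ultimately show "(\<Prod>i\<in>{1..a} - descents \<beta>. q ^ i) * (\<Prod>i\<in>?R - ({1..a} - descents \<beta>). - 1) =
        q ^ c_stat \<alpha> (complement \<beta>) * (- 1) ^ (clength \<beta> - clength \<gamma>)"
      by simp
  qed simp
  finally show ?thesis by simp
qed

lemma chi_nc_hall_littlewood:
  assumes \<alpha>: "descents \<alpha> = {1..a}" "csize \<alpha> = n" "n > 0"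
  shows "chi (nc_hall_littlewood \<alpha>) =
    (\<Sum>xs\<in>comp_lists n a. scale (comp_weight a xs) (prod_list (map complete_h xs)))"
proof -
  let ?h = "\<lambda>\<gamma>. prod_list (map complete_h (parts \<gamma>)) :: Qq symfun"
  let ?c = "\<lambda>\<beta> \<gamma>. q ^ c_stat \<alpha> (complement \<beta>) * (- 1) ^ (clength \<beta> - clength \<gamma>)"
  have sub: "coarsenings \<beta> = {\<gamma> \<in> coarsenings \<alpha>. \<gamma> \<in> coarsenings \<beta>}" if "\<beta> \<in> coarsenings \<alpha>" for \<beta>
    using that by (auto simp: coarsenings_def)
  have "chi (nc_hall_littlewood \<alpha>) =
      (\<Sum>\<beta>\<in>coarsenings \<alpha>. \<Sum>\<gamma>\<in>coarsenings \<beta>. scale (?c \<beta> \<gamma>) (?h \<gamma>))"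
    by (simp add: nc_hall_littlewood_def chi_sum chi_scale chi_ribbon scale_sum_right scale_simps)
  also have "\<dots> = (\<Sum>\<beta>\<in>coarsenings \<alpha>. \<Sum>\<gamma>\<in>{\<gamma> \<in> coarsenings \<alpha>. \<gamma> \<in> coarsenings \<beta>}. scale (?c \<beta> \<gamma>) (?h \<gamma>))"
    using sub by (intro sum.cong refl) auto
  also have "\<dots> = (\<Sum>\<gamma>\<in>coarsenings \<alpha>. \<Sum>\<beta>\<in>{\<beta> \<in> coarsenings \<alpha>. \<gamma> \<in> coarsenings \<beta>}. scale (?c \<beta> \<gamma>) (?h \<gamma>))"
    by (rule sum.swap_restrict) (rule finite_coarsenings)+
  also have "\<dots> = (\<Sum>\<gamma>\<in>coarsenings \<alpha>. scale (comp_weight a (parts \<gamma>)) (?h \<gamma>))"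
    using sum_refinements[OF \<alpha>(1)] \<alpha>(2,3) by (intro sum.cong refl) (simp flip: scale_sum_left)
  also have "\<dots> = (\<Sum>xs\<in>comp_lists n a. scale (comp_weight a xs) (prod_list (map complete_h xs)))"
  proof (rule sum.reindex_bij_witness[where i = Composition and j = parts])
    fix \<gamma> assume "\<gamma> \<in> coarsenings \<alpha>"
    then show "parts \<gamma> \<in> comp_lists n a"
      using parts[of \<gamma>] \<alpha> by (auto simp: coarsenings_def comp_lists_def csize_def parts_inverse)
  next
    fix xs assume xs: "xs \<in> comp_lists n a"
    then show p: "parts (Composition xs) = xs" by (auto simp: comp_lists_def Composition_inverse)
    show "Composition xs \<in> coarsenings \<alpha>"
      using xs \<alpha> p by (auto simp: coarsenings_def comp_lists_def csize_def)
  qed (simp_all add: parts_inverse)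
  finally show ?thesis .
qed

theorem proposition9:
  fixes a b :: nat
  assumes "b \<ge> 1"
  shows "chi (nc_hall_littlewood (Composition (replicate a 1 @ [b]))) =
         hall_littlewood_H (b # replicate a 1)"
proof -
  let ?n = "a + b" and ?l = "b # replicate a 1"
  let ?I = "partitions ?n"
  have "sorted_wrt (\<ge>) (replicate a (1 :: nat))" by (induction a) auto
  then have l: "?l \<in> ?I" using assms by (auto simp: partitions_def sum_list_replicate)
  have size: "csize (Composition (replicate a 1 @ [b])) = ?n"
    unfolding csize_def parts_hook[OF assms] by (simp add: sum_list_replicate)
  have cf_sum: "comp_functional ?n a (sum F A) = (\<Sum>x\<in>A. comp_functional ?n a (F x))" for F and A :: "nat list set"
    by (induction A rule: infinite_finite_induct) (simp_all add: comp_functional_simps)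
  \<comment> \<open>The functional picks out the coefficient of the hook P-function, so applied to
    s_\<mu> it returns the corresponding Kostka-Foulkes coefficient.\<close>
  have K: "comp_functional ?n a (schur \<mu>) = kostka_foulkes \<mu> ?l" if \<mu>: "\<mu> \<in> ?I" for \<mu>
  proof -
    have "comp_functional ?n a (schur \<mu>) =
        (\<Sum>\<nu>\<in>?I. kostka_foulkes \<mu> \<nu> * comp_functional ?n a (hall_littlewood_P \<nu>))"
      by (subst schur_eq_sum_kostka_foulkes[OF \<mu>]) (simp add: cf_sum comp_functional_simps)
    also have "\<dots> = (\<Sum>\<nu>\<in>?I. if \<nu> = ?l then kostka_foulkes \<mu> ?l else 0)"
      using comp_functional_P[OF _ assms] by (intro sum.cong) auto
    also have "\<dots> = kostka_foulkes \<mu> ?l" using l finite_partitions by simp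
    finally show ?thesis .
  qed
  have "chi (nc_hall_littlewood (Composition (replicate a 1 @ [b]))) =
      (\<Sum>xs\<in>comp_lists ?n a. scale (comp_weight a xs) (prod_list (map complete_h xs)))"
    using descents_hook[OF assms] size assms by (intro chi_nc_hall_littlewood) auto
  also have "\<dots> = (\<Sum>xs\<in>comp_lists ?n a. \<Sum>\<mu>\<in>?I.
      scale (comp_weight a xs * coefficient (schur \<mu>) (list_mono xs)) (schur \<mu>))"
  proof (rule sum.cong)
    fix xs assume "xs \<in> comp_lists ?n a"
    then have "sum_list xs = ?n" by (simp add: comp_lists_def)
    then show "scale (comp_weight a xs) (prod_list (map complete_h xs)) =
        (\<Sum>\<mu>\<in>?I. scale (comp_weight a xs * coefficient (schur \<mu>) (list_mono xs)) (schur \<mu>))"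
      unfolding complete_h_expansion by (simp add: scale_sum_right scale_simps)
  qed simp
  \<comment> \<open>Interchanging the sums collects, for each s_\<mu>, the weighted coefficients of
    s_\<mu> over all compositions, which is the functional by definition.\<close>
  also have "\<dots> = (\<Sum>\<mu>\<in>?I. scale (comp_functional ?n a (schur \<mu>)) (schur \<mu>))"
    by (subst sum.swap) (simp add: comp_functional_def scale_sum_left)
  also have "\<dots> = (\<Sum>\<mu>\<in>?I. scale (kostka_foulkes \<mu> ?l) (schur \<mu>))"
    using K by (intro sum.cong) auto
  also have "\<dots> = hall_littlewood_H ?l"
    by (simp add: hall_littlewood_H_def sum_list_replicate add.commute)
  finally show ?thesis .
qed

end
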